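(* Let $\Omega$ be either the triangle $\mathcal{D}$ or a box $\mathcal{B}^{(n)}$ ($n\ge2$). Let $\lambda^{(0)}\in\sigma_{\mathrm{odd}}(\Omega)$ and $k\in\mathbb{N}_0$. The nodal deficiency of the Neumann eigenvalue $\gamma(\Omega)^{2k}\cdot\lambda^{(0)}$ satisfies $$\delta\left(\gamma(\Omega)^{2k}\cdot\lambda^{(0)}\right)\ \ge\ \left(\mathrm{d}(\lambda^{(0)})-1\right)\cdot\left(M(k,\Omega)-1\right),$$ where $M(k,\Omega)$ is the number of subdomains of the $k$-frame partition of $\Omega$ and $\mathrm{d}(\lambda^{(0)})$ is the multiplicity of $\lambda^{(0)}$ as a Neumann eigenvalue of $\Omega$.
   Context: $\mathbb{N}_0=\mathbb{N}\cup\{0\}$. All eigenvalues are those of the Neumann Laplacian $-\Delta$ on $\Omega$ (the domains are taken closed and the Laplacian is defined on the interior $\Omega^\circ$). Triangle: $\mathcal{D}=\{(x,y)\in[0,\pi]^2 : y\le x\}$. Neumann eigenvalues (with multiplicity): $\lambda_{m,n}=m^2+n^2$ for $m,n\in\mathbb{N}_0$, $m\ge n$, with eigenfunctions $\cos(mx)\cos(ny)+\cos(my)\cos(nx)$. $\sigma_{\mathrm{odd}}(\mathcal{D})$ is the set of $\lambda_{m,n}$ with $m\not\equiv n\pmod2$. $\gamma(\mathcal{D})=\sqrt2$. Put $\mathrm{L}=\{(x,y)\in\mathcal{D}:x+y=\pi\}$, $R(x,y)=(\pi-y,\pi-x)$, $\frac12\mathcal{D}=\{(x,y)\in\mathcal{D}:(x+y,x-y)\in[0,\pi]^2\}$,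 and $F:\frac12\mathcal{D}\to\mathcal{D}$, $F(x,y)=(x+y,x-y)$. Box: $\gamma_n=2^{1/n}$ and $\mathcal{B}^{(n)}=\prod_{j=1}^n[0,l_j]$ with $l_j=\pi\gamma_n^{-(j-1)}$. Neumann eigenvalues (with multiplicity): $\lambda_{\vec m}=\sum_{j=1}^n(\gamma_n^{j-1}m_j)^2$, $\vec m\in\mathbb{N}_0^n$, with eigenfunctions $\prod_{j=1}^n\cos(\gamma_n^{j-1}m_jx_j)$. $\sigma_{\mathrm{odd}}(\mathcal{B}^{(n)})$ is the set of $\lambda_{\vec m}$ with $m_1$ odd. $\gamma(\mathcal{B}^{(n)})=\gamma_n$. Put $\mathrm{L}=\{\vec x\in\mathcal{B}^{(n)}:x_1=\pi/2\}$, $R(\vec x)=(\pi-x_1,x_2,\dots,x_n)$, $\frac12\mathcal{B}^{(n)}=\{\vec x\in\mathcal{B}^{(n)}:x_1\le\pi/2\}$, and $F:\frac12\mathcal{B}^{(n)}\to\mathcal{B}^{(n)}$, $F(x_1,\dots,x_n)=\gamma_n\cdot(x_2,x_3,\dots,x_n,x_1)$. $k$-frame: for $A\subseteq\Omega$ put $U(A)=\{\vec x\in\frac12\Omega:F(\vec x)\in A\}\cup\{\vec x\in\Omega\setminus\frac12\Omega:F(R(\vec x))\in A\}$; $S^{(0)}=\mathrm{L}$ and $S^{(k)}=U^k(\mathrm{L})$ for $k\ge1$. The $k$-frame partition of $\Omega$ is the decomposition of $\Omega^\circ\setminus S^{(k)}$ into its connected components (the subdomains). Nodal deficiency: list the eigenvalues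 with multiplicity as $0=\lambda_1<\lambda_2\le\cdots$ and put $N(\lambda)=|\{j:\lambda_j<\lambda\}|+1$ for an eigenvalue $\lambda$. For an eigenfunction $\varphi$ of $\lambda$, $\nu(\varphi)$ is the number of connected components of $\Omega^\circ\setminus\varphi^{-1}(0)$ and $\delta(\varphi)=N(\lambda)-\nu(\varphi)$; $\delta(\lambda)$ is the minimum of $\delta(\varphi)$ over all eigenfunctions $\varphi$ of $\lambda$. *)

theory Defs
  imports "HOL-Analysis.Analysis" "HOL-Library.Function_Algebras"
begin

section \<open>The Neumann Laplacian in weak form\<close>

text \<open>
  Weak derivatives are tested against \<open>C\<^sup>1\<close> functions of compact support; by mollification this gives the
  same notion as testing against \<open>C\<^sup>\<infinity>\<close> functions of compact support.
\<close>

definition test_function_on ::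
    "'a::euclidean_space set \<Rightarrow> ('a \<Rightarrow> real) \<Rightarrow> ('a \<Rightarrow> 'a) \<Rightarrow> bool" where
  "test_function_on U \<psi> D\<psi> \<longleftrightarrow>
     (\<forall>x. GDERIV \<psi> x :> D\<psi> x) \<and> continuous_on UNIV D\<psi> \<and>
     (\<exists>K. compact K \<and> K \<subseteq> U \<and> (\<forall>x. x \<notin> K \<longrightarrow> \<psi> x = 0))"

definition square_integrable_on ::
    "'a::euclidean_space set \<Rightarrow> ('a \<Rightarrow> 'b::euclidean_space) \<Rightarrow> bool" where
  "square_integrable_on U f \<longleftrightarrow>
     set_borel_measurable lborel U f \<and> set_integrable lborel U (\<lambda>x. (norm (f x))\<^sup>2)"

text \<open>\<open>sobolev_H1 U u Du\<close>: the function \<open>u\<close> lies in \<open>H\<^sup>1(U)\<close> and \<open>Du\<close> is its weak gradient.\<close>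

definition sobolev_H1 ::
    "'a::euclidean_space set \<Rightarrow> ('a \<Rightarrow> real) \<Rightarrow> ('a \<Rightarrow> 'a) \<Rightarrow> bool" where
  "sobolev_H1 U u Du \<longleftrightarrow>
     square_integrable_on U u \<and> square_integrable_on U Du \<and>
     (\<forall>\<psi> D\<psi>. test_function_on U \<psi> D\<psi> \<longrightarrow>
        (LINT x:U|lborel. u x *\<^sub>R D\<psi> x) = - (LINT x:U|lborel. \<psi> x *\<^sub>R Du x))"

text \<open>
  The Neumann Laplacian on the interior of \<open>\<Omega>\<close> is the self-adjoint operator of the Dirichlet form with
  form domain \<open>H\<^sup>1\<close>, so that the Neumann condition is the natural boundary condition. An element of an
  eigenspace is a class of functions modulo null sets that has a unique continuous representative on
  the interior (interior regularity). The eigenspace consists of these representatives, extended by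
  \<open>0\<close> to the whole space in order that distinct functions are distinct elements.
\<close>

definition neumann_eigenspace ::
    "'a::euclidean_space set \<Rightarrow> real \<Rightarrow> ('a \<Rightarrow> real) set" where
  "neumann_eigenspace \<Omega> \<mu> =
     {\<phi>. continuous_on (interior \<Omega>) \<phi> \<and> (\<forall>x. x \<notin> interior \<Omega> \<longrightarrow> \<phi> x = 0) \<and>
        (\<exists>D\<phi>. sobolev_H1 (interior \<Omega>) \<phi> D\<phi> \<and>
           (\<forall>v Dv. sobolev_H1 (interior \<Omega>) v Dv \<longrightarrow>
              (LINT x:interior \<Omega>|lborel. D\<phi> x \<bullet> Dv x)
                = \<mu> * (LINT x:interior \<Omega>|lborel. \<phi> x * v x)))}"

definition neumann_eigenfunction ::
    "'a::euclidean_space set \<Rightarrow> real \<Rightarrow> ('a \<Rightarrow> real) \<Rightarrow> bool" where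
  "neumann_eigenfunction \<Omega> \<mu> \<phi> \<longleftrightarrow> \<phi> \<in> neumann_eigenspace \<Omega> \<mu> \<and> \<phi> \<noteq> 0"

definition neumann_eigenvalue :: "'a::euclidean_space set \<Rightarrow> real \<Rightarrow> bool" where
  "neumann_eigenvalue \<Omega> \<mu> \<longleftrightarrow> (\<exists>\<phi>. neumann_eigenfunction \<Omega> \<mu> \<phi>)"

interpretation function_space:
  vector_space "(\<lambda>c f x. c * f x) :: real \<Rightarrow> ('a \<Rightarrow> real) \<Rightarrow> 'a \<Rightarrow> real"
  by unfold_locales (auto simp: fun_eq_iff algebra_simps)

definition multiplicity_of :: "'a::euclidean_space set \<Rightarrow> real \<Rightarrow> nat" where
  "multiplicity_of \<Omega> \<mu> = function_space.dim (neumann_eigenspace \<Omega> \<mu>)"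


section \<open>The nodal deficiency\<close>

definition num_components :: "'a::topological_space set \<Rightarrow> enat" where
  "num_components U = (if finite (components U) then enat (card (components U)) else \<infinity>)"

text \<open>
  \<open>N(\<mu>)\<close>: the number of indices \<open>j\<close> with \<open>\<mu>\<^sub>j < \<mu>\<close> in the list of eigenvalues repeated by multiplicity
  is the sum of the multiplicities of the distinct eigenvalues below \<open>\<mu>\<close>.
\<close>

definition spectral_position :: "'a::euclidean_space set \<Rightarrow> real \<Rightarrow> nat" where
  "spectral_position \<Omega> \<mu> = (\<Sum>\<nu> | neumann_eigenvalue \<Omega> \<nu> \<and> \<nu> < \<mu>. multiplicity_of \<Omega> \<nu>) + 1"

definition nodal_count :: "'a::euclidean_space set \<Rightarrow> ('a \<Rightarrow> real) \<Rightarrow> enat" where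
  "nodal_count \<Omega> \<phi> = num_components (interior \<Omega> - {x. \<phi> x = 0})"

text \<open>
  The deficiency takes values in the extended reals, so a function with infinitely many nodal domains
  would have deficiency \<open>-\<infinity>\<close>, and the infimum below needs no boundedness assumption.
  The deficiencies of eigenfunctions are integers or \<open>-\<infinity>\<close>, so for an eigenvalue
  the infimum is the minimum.
\<close>

definition deficiency_fun :: "'a::euclidean_space set \<Rightarrow> real \<Rightarrow> ('a \<Rightarrow> real) \<Rightarrow> ereal" where
  "deficiency_fun \<Omega> \<mu> \<phi> =
     ereal (real (spectral_position \<Omega> \<mu>)) - ereal_of_enat (nodal_count \<Omega> \<phi>)"

definition nodal_deficiency :: "'a::euclidean_space set \<Rightarrow> real \<Rightarrow> ereal" where
  "nodal_deficiency \<Omega> \<mu> = (INF \<phi>\<in>{\<phi>. neumann_eigenfunction \<Omega> \<mu> \<phi>}. deficiency_fun \<Omega> \<mu> \<phi>)"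


section \<open>Folding domains and their frames\<close>

record 'a folding_domain =
  domain_set :: "'a set"
  half_set :: "'a set"
  mid_set :: "'a set"
  reflection :: "'a \<Rightarrow> 'a"
  fold_map :: "'a \<Rightarrow> 'a"
  ratio :: real
  odd_spectrum :: "real set"

definition unfold_set :: "'a folding_domain \<Rightarrow> 'a set \<Rightarrow> 'a set" where
  "unfold_set D A =
     {x \<in> half_set D. fold_map D x \<in> A} \<union>
     {x \<in> domain_set D - half_set D. fold_map D (reflection D x) \<in> A}"

definition frame :: "'a folding_domain \<Rightarrow> nat \<Rightarrow> 'a set" where
  "frame D k = (unfold_set D ^^ k) (mid_set D)"

definition num_subdomains :: "'a::topological_space folding_domain \<Rightarrow> nat \<Rightarrow> enat" where
  "num_subdomains D k = num_components (interior (domain_set D) - frame D k)"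


subsection \<open>The triangle\<close>

definition triangle_set :: "(real \<times> real) set" where
  "triangle_set = {(x, y). x \<in> {0..pi} \<and> y \<in> {0..pi} \<and> y \<le> x}"

definition triangle :: "(real \<times> real) folding_domain" where
  "triangle =
     \<lparr> domain_set = triangle_set,
       half_set = {(x, y) \<in> triangle_set. x + y \<in> {0..pi} \<and> x - y \<in> {0..pi}},
       mid_set = {(x, y) \<in> triangle_set. x + y = pi},
       reflection = (\<lambda>(x, y). (pi - y, pi - x)),
       fold_map = (\<lambda>(x, y). (x + y, x - y)),
       ratio = sqrt 2,
       odd_spectrum = {(real m)\<^sup>2 + (real n)\<^sup>2 | m n :: nat. n \<le> m \<and> m mod 2 \<noteq> n mod 2} \<rparr>"


subsection \<open>The boxes\<close>

text \<open>
  The dimension is \<open>n = CARD('n)\<close>. The index type is linearly ordered, and the coordinates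
  \<open>x\<^sub>1, \<dots>, x\<^sub>n\<close> are the components in increasing order of the index: \<open>axis_of j\<close> is the \<open>j\<close>-th smallest
  index for \<open>j \<in> {1..n}\<close>, and \<open>position\<close> is its inverse.
\<close>

definition axis_of :: "nat \<Rightarrow> 'n::{finite,linorder}" where
  "axis_of j = sorted_list_of_set UNIV ! (j - 1)"

definition position :: "'n::{finite,linorder} \<Rightarrow> nat" where
  "position i = card {..i}"

definition box_gamma :: "nat \<Rightarrow> real" where
  "box_gamma n = 2 powr (1 / real n)"

definition box_set :: "(real ^ 'n::{finite,linorder}) set" where
  "box_set = {x. \<forall>j\<in>{1..CARD('n)}. x $ axis_of j \<in> {0..pi / box_gamma CARD('n) ^ (j - 1)}}"

definition box :: "(real ^ 'n::{finite,linorder}) folding_domain" where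
  "box =
     \<lparr> domain_set = box_set,
       half_set = {x \<in> box_set. x $ axis_of 1 \<le> pi / 2},
       mid_set = {x \<in> box_set. x $ axis_of 1 = pi / 2},
       reflection = (\<lambda>x. \<chi> i. if i = axis_of 1 then pi - x $ i else x $ i),
       fold_map = (\<lambda>x. \<chi> i. box_gamma CARD('n) *
         x $ axis_of (if position i = CARD('n) then 1 else position i + 1)),
       ratio = box_gamma CARD('n),
       odd_spectrum =
         {(\<Sum>j = 1..CARD('n). (box_gamma CARD('n) ^ (j - 1) * real (m j))\<^sup>2) | m :: nat \<Rightarrow> nat.
            odd (m 1)} \<rparr>"

lemma axis_of_position: "axis_of (position i) = (i :: 'n::{finite,linorder})"
proof -
  let ?xs = "sorted_list_of_set (UNIV :: 'n set)"
  have xs: "sorted_wrt (<) ?xs" "distinct ?xs" "set ?xs = UNIV"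
    by auto
  then obtain p where p: "p < length ?xs" "?xs ! p = i"
    by (metis UNIV_I in_set_conv_nth)
  have less: "?xs ! a < ?xs ! b \<longleftrightarrow> a < b" if "a < length ?xs" "b < length ?xs" for a b
    using that xs(1) by (metis less_asym linorder_neqE_nat sorted_wrt_nth_less less_irrefl)
  have "{..i} = (\<lambda>a. ?xs ! a) ` {..p}"
  proof (intro set_eqI iffI)
    fix z assume "z \<in> {..i}"
    obtain a where a: "a < length ?xs" "?xs ! a = z"
      using xs(3) by (metis UNIV_I in_set_conv_nth)
    with \<open>z \<in> {..i}\<close> p less[of p a] have "a \<le> p" by (auto simp: not_less[symmetric])
    with a show "z \<in> (\<lambda>a. ?xs ! a) ` {..p}" by blast
  next
    fix z assume "z \<in> (\<lambda>a. ?xs ! a) ` {..p}"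
    then obtain a where "a \<le> p" "z = ?xs ! a" by blast
    with p less[of p a] show "z \<in> {..i}" by (auto simp: not_less[symmetric])
  qed
  moreover have "inj_on (\<lambda>a. ?xs ! a) {..p}"
    using xs(2) p(1) by (intro inj_onI) (auto simp: nth_eq_iff_index_eq)
  ultimately have "card {..i} = Suc p" by (simp add: card_image)
  with p show ?thesis by (simp add: axis_of_def position_def)
qed

end

theory Submission
  imports Defs "HOL-Complex_Analysis.Conformal_Mappings" "HOL-Computational_Algebra.Polynomial_Factorial"
begin

text \<open>
  Let \<open>\<Psi>\<close> be an eigenfunction of \<open>\<mu> = \<gamma>\<^bsup>2k\<^esup> \<lambda>\<^sub>0\<close> with nodal domains \<open>C\<close>, and let \<open>D\<close> range over the \<open>M\<close>
  subdomains of the \<open>k\<close>-frame. Every eigenfunction of \<open>\<mu>\<close> arises by folding \<open>k\<close> times from an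
  eigenfunction of \<open>\<lambda>\<^sub>0\<close>, which is odd under the reflection since the parity of a wave vector is
  determined by its norm; hence it vanishes on the \<open>k\<close>-frame. The functions \<open>\<Psi> 1\<^sub>C\<close> and \<open>\<Phi> 1\<^sub>D\<close>, for
  eigenfunctions \<open>\<Phi>\<close> of \<open>\<mu>\<close>, therefore lie in \<open>H\<^sup>1\<close>, and the form \<open>\<integral>|\<nabla>u|\<^sup>2 - \<mu> \<integral>u\<^sup>2\<close> vanishes on their
  span. By unique continuation the span has dimension \<open>\<nu>(\<Psi>) + M (d - 1)\<close> with \<open>d\<close> the multiplicity of
  \<open>\<mu>\<close>, and by the variational principle this is at most the number \<open>N(\<mu>) - 1 + d\<close> of eigenvalues up to
  \<open>\<mu>\<close>. So \<open>N(\<mu>) - \<nu>(\<Psi>) \<ge> (d - 1) (M - 1)\<close>, and composition with the fold map is an injection of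
  eigenspaces that shows \<open>d \<ge> d(\<lambda>\<^sub>0)\<close>.
\<close>

section \<open>Gradients and zero sets\<close>

text \<open>The eigenspaces are defined weakly, so the explicit spectra have to be derived. The
  triangle and the boxes are treated together as polytopes whose wall reflections have linear parts
  in a finite group: the symmetrized plane waves are weak eigenfunctions and span an algebra
  separating points, so by Stone-Weierstrass nothing is orthogonal to all of them. The count
  contains \<open>d - 1\<close> and not \<open>d\<close> for each subdomain, since the restriction
  of \<Psi> to a subdomain is already the sum of its restrictions to the nodal domains inside. The
  form vanishes on all pairs because two supports are either nested or disjoint: the weak equation
  of the function with the larger support is tested with the other function. A function orthogonal
  to all eigenfunctions up to and including \<mu> has energy strictly above \<mu> times its squared
  norm; this strictness is why the eigenvalues equal to \<mu> enter the upper bound. For the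
  triangle, parity is read off modulo 2. For the boxes the squared norm is a sum of powers of the
  n-th root of 2 that may be rationally dependent, and an Eisenstein argument at the prime 2
  replaces linear independence.\<close>

lemma gderiv_unfold: "GDERIV f x :> D \<longleftrightarrow> (f has_derivative (\<lambda>h. h \<bullet> D)) (at x)"
  by (simp add: gderiv_def)

lemma gradient_zero_outside_support:
  fixes \<psi> :: "'a::real_inner \<Rightarrow> real"
  assumes "\<And>x. GDERIV \<psi> x :> D\<psi> x" "closed K" "\<And>x. x \<notin> K \<Longrightarrow> \<psi> x = 0" "x \<notin> K"
  shows "D\<psi> x = 0"
proof -
  have "((\<lambda>_. 0) has_derivative (\<lambda>h. h \<bullet> D\<psi> x)) (at x)"
    using assms(1)[of x] unfolding gderiv_unfold
    by (rule has_derivative_transform_within_open[of _ _ _ _ "- K"]) (use assms in auto)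
  then have "(\<lambda>h. h \<bullet> D\<psi> x) = (\<lambda>h. 0)"
    by (intro has_derivative_unique) auto
  then show ?thesis by (metis inner_eq_zero_iff)
qed

lemma integrable_continuous_compact_support:
  fixes f :: "'a::euclidean_space \<Rightarrow> 'b::{banach, second_countable_topology}"
  assumes "continuous_on UNIV f" "compact K" "\<And>x. x \<notin> K \<Longrightarrow> f x = 0"
  shows "integrable lborel f"
proof -
  have "integrable lborel (\<lambda>x. indicator K x *\<^sub>R f x)"
    using assms by (intro borel_integrable_compact) (auto intro: continuous_on_subset)
  also have "(\<lambda>x. indicator K x *\<^sub>R f x) = f"
    using assms(3) by (auto simp: indicator_def fun_eq_iff)
  finally show ?thesis .
qed

lemma integral_lborel_shift:
  fixes f :: "'a::euclidean_space \<Rightarrow> 'b::{banach, second_countable_topology}"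
  assumes [measurable]: "f \<in> borel_measurable borel"
  shows "(LINT x|lborel. f (c + x)) = (LINT x|lborel. f x)"
proof -
  have "(LINT x|lborel. f x) = (LINT x|distr lborel borel ((+) c). f x)"
    by (simp add: lborel_distr_plus)
  also have "\<dots> = (LINT x|lborel. f (c + x))"
    by (subst integral_distr) auto
  finally show ?thesis by simp
qed

text \<open>Difference quotients in a direction \<open>v\<close> have integral \<open>0\<close> by
  translation invariance. They converge to the directional derivative with an integrable majorant,
  because a bounded gradient makes \<open>\<psi>\<close> Lipschitz.\<close>

lemma integral_gradient_compact_support:
  fixes \<psi> :: "'a::euclidean_space \<Rightarrow> real"
  assumes D: "\<And>x. GDERIV \<psi> x :> D\<psi> x" and cont: "continuous_on UNIV D\<psi>"
    and K: "compact K" "\<And>x. x \<notin> K \<Longrightarrow> \<psi> x = 0"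
  shows "integrable lborel D\<psi>" "(LINT x|lborel. D\<psi> x) = 0"
proof -
  have D0: "D\<psi> x = 0" if "x \<notin> K" for x
    using gradient_zero_outside_support[OF D compact_imp_closed[OF K(1)] K(2) that] .
  show int: "integrable lborel D\<psi>"
    using cont K(1) D0 by (rule integrable_continuous_compact_support)
  have cpsi: "continuous_on UNIV \<psi>"
    using D by (meson continuous_at_imp_continuous_on gderiv_unfold has_derivative_continuous)
  then have [measurable]: "\<psi> \<in> borel_measurable borel"
    by (rule borel_measurable_continuous_onI)
  have [measurable]: "D\<psi> \<in> borel_measurable borel"
    using cont by (rule borel_measurable_continuous_onI)
  have intpsi: "integrable lborel \<psi>"
    using cpsi K by (rule integrable_continuous_compact_support)
  obtain B where B: "\<And>x. norm (D\<psi> x) \<le> B" "0 \<le> B"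
  proof -
    have "compact (D\<psi> ` K)" using cont K(1) by (meson compact_continuous_image continuous_on_subset subset_UNIV)
    then obtain b where "\<And>x. x \<in> K \<Longrightarrow> norm (D\<psi> x) \<le> b"
      by (meson compact_imp_bounded bounded_iff image_eqI)
    then have "norm (D\<psi> x) \<le> max b 0" for x
      by (cases "x \<in> K") (auto simp: D0 le_max_iff_disj)
    then show thesis by (rule that) simp
  qed
  have lip: "\<bar>\<psi> y - \<psi> x\<bar> \<le> B * norm (y - x)" for x y
  proof -
    have "norm (\<psi> y - \<psi> x) \<le> B * norm (y - x)"
    proof (rule differentiable_bound[of UNIV \<psi> "\<lambda>x h. h \<bullet> D\<psi> x" B y x])
      show "(\<psi> has_derivative (\<lambda>h. h \<bullet> D\<psi> x)) (at x within UNIV)" for x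
        using D[of x] by (simp add: gderiv_unfold)
      show "onorm (\<lambda>h. h \<bullet> D\<psi> x) \<le> B" for x
      proof (rule onorm_le)
        fix h
        have "\<bar>h \<bullet> D\<psi> x\<bar> \<le> norm h * norm (D\<psi> x)" by (rule Cauchy_Schwarz_ineq2)
        also have "\<dots> \<le> norm h * B" using B(1) by (intro mult_left_mono) auto
        finally show "norm (h \<bullet> D\<psi> x) \<le> B * norm h" by (simp add: mult.commute)
      qed
    qed auto
    then show ?thesis by simp
  qed
  obtain r where r: "\<And>x. x \<in> K \<Longrightarrow> norm x \<le> r"
    using K(1) by (meson bounded_iff compact_imp_bounded)
  have "(LINT x|lborel. D\<psi> x \<bullet> v) = 0" for v
  proof -
    define f where "f n x = real (Suc n) * (\<psi> (inverse (real (Suc n)) *\<^sub>R v + x) - \<psi> x)" for n x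
    have f0: "(LINT x|lborel. f n x) = 0" for n
    proof -
      let ?c = "inverse (real (Suc n)) *\<^sub>R v"
      have "integrable lborel (\<lambda>x. \<psi> (?c + x))"
      proof (rule integrable_continuous_compact_support)
        show "continuous_on UNIV (\<lambda>x. \<psi> (?c + x))"
          by (rule continuous_on_compose2[OF cpsi]) (auto intro!: continuous_intros)
        show "compact ((+) (- ?c) ` K)" using K(1) by (rule compact_translation)
        show "\<psi> (?c + x) = 0" if "x \<notin> (+) (- ?c) ` K" for x
          using that by (intro K(2)) (auto simp: image_iff algebra_simps)
      qed
      then have "(LINT x|lborel. \<psi> (?c + x) - \<psi> x) = 0"
        using intpsi by (simp add: integral_lborel_shift)
      then show ?thesis by (simp add: f_def)
    qed
    \<comment> \<open>A quotient is nonzero only if \<open>x\<close> or its translate by at most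
      \<open>norm v\<close> lies in \<open>K\<close>; this gives the radius
      \<open>r + norm v\<close> of the majorant.\<close>
    have "(\<lambda>n. LINT x|lborel. f n x) \<longlonglongrightarrow> (LINT x|lborel. D\<psi> x \<bullet> v)"
    proof (rule integral_dominated_convergence[where w = "\<lambda>x. indicator (cball 0 (r + norm v)) x *\<^sub>R (B * norm v)"])
      show "integrable lborel (\<lambda>x. indicator (cball 0 (r + norm v)) x *\<^sub>R (B * norm v))"
        by (intro borel_integrable_compact) auto
      show "AE x in lborel. norm (f n x) \<le> indicator (cball 0 (r + norm v)) x *\<^sub>R (B * norm v)" for n
      proof (rule AE_I2)
        fix x
        let ?c = "inverse (real (Suc n)) *\<^sub>R v"
        have c: "norm ?c \<le> norm v"
        proof -
          have "inverse (real (Suc n)) * norm v \<le> 1 * norm v"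
            by (intro mult_right_mono) (auto simp: inverse_le_1_iff)
          then show ?thesis by simp
        qed
        show "norm (f n x) \<le> indicator (cball 0 (r + norm v)) x *\<^sub>R (B * norm v)"
        proof (cases "x \<in> K \<or> ?c + x \<in> K")
          case True
          then have "norm x \<le> r + norm v"
          proof
            assume "?c + x \<in> K"
            then have "norm (?c + x) \<le> r" by (rule r)
            then show ?thesis using c norm_triangle_ineq4[of "?c + x" ?c] by simp
          qed (use r[of x] in \<open>simp add: add_increasing2\<close>)
          moreover have "norm (f n x) \<le> B * norm v"
          proof -
            have "norm (f n x) = real (Suc n) * \<bar>\<psi> (?c + x) - \<psi> x\<bar>" by (simp add: f_def abs_mult)
            also have "\<dots> \<le> real (Suc n) * (B * norm ?c)"
              using lip[of "?c + x" x] by (intro mult_left_mono) auto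
            also have "\<dots> = (real (Suc n) * inverse (real (Suc n))) * (B * norm v)"
              by (simp only: norm_scaleR abs_inverse abs_of_nat mult_ac)
            also have "\<dots> = B * norm v"
              by (simp only: right_inverse of_nat_eq_0_iff nat.simps mult_1_left not_False_eq_True)
            finally show ?thesis .
          qed
          ultimately show ?thesis by (simp add: indicator_def)
        next
          case False
          then show ?thesis using B by (simp add: f_def K(2) zero_le_mult_iff indicator_def)
        qed
      qed
      show "AE x in lborel. (\<lambda>n. f n x) \<longlonglongrightarrow> D\<psi> x \<bullet> v"
      proof (rule AE_I2)
        fix x
        have "((\<lambda>t. x + t *\<^sub>R v) has_derivative (\<lambda>t. t *\<^sub>R v)) (at (0::real))"
          by (auto intro!: derivative_eq_intros)
        moreover have "(\<psi> has_derivative (\<lambda>h. h \<bullet> D\<psi> x)) (at (x + 0 *\<^sub>R v))"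
          using D[of x] by (simp add: gderiv_unfold)
        ultimately have "((\<lambda>t. \<psi> (x + t *\<^sub>R v)) has_derivative (\<lambda>t. (t *\<^sub>R v) \<bullet> D\<psi> x)) (at 0)"
          by (rule has_derivative_compose)
        then have "((\<lambda>t. \<psi> (x + t *\<^sub>R v)) has_field_derivative (v \<bullet> D\<psi> x)) (at 0)"
          by (simp add: has_field_derivative_def mult_commute_abs)
        then have lim: "((\<lambda>h. (\<psi> (x + h *\<^sub>R v) - \<psi> x) / h) \<longlongrightarrow> v \<bullet> D\<psi> x) (at 0)"
          by (simp add: has_field_derivative_iff)
        have "filterlim (\<lambda>n. inverse (real (Suc n))) (at 0) sequentially"
          unfolding filterlim_at using LIMSEQ_inverse_real_of_nat by (auto intro!: always_eventually)
        from filterlim_compose[OF lim this]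
        have lim': "(\<lambda>n. (\<psi> (x + inverse (real (Suc n)) *\<^sub>R v) - \<psi> x) / inverse (real (Suc n)))
          \<longlonglongrightarrow> v \<bullet> D\<psi> x" .
        have f_eq: "(\<lambda>n. f n x) = (\<lambda>n. (\<psi> (x + inverse (real (Suc n)) *\<^sub>R v) - \<psi> x) / inverse (real (Suc n)))"
          unfolding f_def divide_inverse inverse_inverse_eq
          by (rule ext, subst add.commute, rule mult.commute)
        show "(\<lambda>n. f n x) \<longlonglongrightarrow> D\<psi> x \<bullet> v"
          unfolding f_eq inner_commute[of "D\<psi> x" v] by (rule lim')
      qed
    qed (auto simp: f_def)
    then show ?thesis by (simp only: f0 LIMSEQ_const_iff)
  qed
  then have "(LINT x|lborel. D\<psi> x) \<bullet> v = 0" for v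
    using integral_inner_left[of v lborel D\<psi>] int by simp
  then show "(LINT x|lborel. D\<psi> x) = 0"
    by (metis inner_eq_zero_iff)
qed

text \<open>A one-variable substitute for real analyticity: only the restrictions to lines extend to
  entire functions, and \<open>g\<close> depends on the line. The notion is stable under linear
  combinations and strong enough to make zero sets null.\<close>

definition entire_on_lines :: "('a::real_vector \<Rightarrow> real) \<Rightarrow> bool" where
  "entire_on_lines f \<longleftrightarrow>
     (\<forall>p v. \<exists>g. g holomorphic_on UNIV \<and> (\<forall>t. g (of_real t) = of_real (f (p + t *\<^sub>R v))))"

lemma entire_on_lines_add:
  assumes "entire_on_lines f" "entire_on_lines g"
  shows "entire_on_lines (\<lambda>x. f x + g x)"
  unfolding entire_on_lines_def
proof (intro allI)
  fix p v
  obtain F G where "F holomorphic_on UNIV" "\<forall>t. F (of_real t) = of_real (f (p + t *\<^sub>R v))"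
    "G holomorphic_on UNIV" "\<forall>t. G (of_real t) = of_real (g (p + t *\<^sub>R v))"
    using assms unfolding entire_on_lines_def by meson
  then show "\<exists>h. h holomorphic_on UNIV \<and> (\<forall>t. h (of_real t) = of_real (f (p + t *\<^sub>R v) + g (p + t *\<^sub>R v)))"
    by (intro exI[of _ "\<lambda>z. F z + G z"]) (auto intro: holomorphic_intros)
qed

lemma entire_on_lines_cmult:
  assumes "entire_on_lines f"
  shows "entire_on_lines (\<lambda>x. c * f x)"
  unfolding entire_on_lines_def
proof (intro allI)
  fix p v
  obtain F where "F holomorphic_on UNIV" "\<forall>t. F (of_real t) = of_real (f (p + t *\<^sub>R v))"
    using assms unfolding entire_on_lines_def by meson
  then show "\<exists>h. h holomorphic_on UNIV \<and> (\<forall>t. h (of_real t) = of_real (c * f (p + t *\<^sub>R v)))"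
    by (intro exI[of _ "\<lambda>z. of_real c * F z"]) (auto intro: holomorphic_intros)
qed

lemma entire_on_lines_zero: "entire_on_lines (\<lambda>_. 0)"
  unfolding entire_on_lines_def by (auto intro!: exI[of _ "\<lambda>_. 0"])

lemma entire_on_lines_sum:
  assumes "\<And>i. i \<in> I \<Longrightarrow> entire_on_lines (f i)"
  shows "entire_on_lines (\<lambda>x. \<Sum>i\<in>I. f i x)"
  using assms
  by (induction I rule: infinite_finite_induct)
    (auto intro: entire_on_lines_add entire_on_lines_zero)

lemma entire_on_lines_cos_inner: "entire_on_lines (\<lambda>x. cos (w \<bullet> x))"
  unfolding entire_on_lines_def
  \<comment> \<open>On the line the argument of the cosine is affine in the parameter; the inner
    dummies stand for the base point and the direction.\<close>
  by (intro allI exI[of _ "\<lambda>z. cos (of_real (w \<bullet> _) + z * of_real (w \<bullet> _))"])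
    (auto intro!: holomorphic_intros simp: inner_add_right simp flip: cos_of_real)

text \<open>
  Every line through \<open>p\<close> meets the zero set in a countable set, so by Fubini the preimage of the zero
  set under \<open>v \<mapsto> p + t v\<close> is null for almost every \<open>t\<close>; dilations preserve null sets.
\<close>

lemma entire_on_lines_zeros_null:
  fixes f :: "'a::euclidean_space \<Rightarrow> real"
  assumes f: "entire_on_lines f" and cont: "continuous_on UNIV f" and p: "f p \<noteq> 0"
  shows "{x. f x = 0} \<in> null_sets lborel"
proof -
  define Z where "Z = {x. f x = 0}"
  have "closed Z"
    unfolding Z_def using cont by (simp add: closed_Collect_eq)
  then have [measurable]: "Z \<in> sets borel" by simp
  have line: "(\<integral>\<^sup>+ t. indicator Z (p + t *\<^sub>R v) \<partial>lborel) = 0" for v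
  proof -
    obtain g where g: "g holomorphic_on UNIV" "\<And>t. g (of_real t) = of_real (f (p + t *\<^sub>R v))"
      using f unfolding entire_on_lines_def by meson
    have "countable {t. f (p + t *\<^sub>R v) = 0}"
    proof (cases "g constant_on UNIV")
      case True
      then obtain c where "\<And>z. g z = c" by (auto simp: constant_on_def)
      then have "complex_of_real (f (p + t *\<^sub>R v)) = complex_of_real (f (p + 0 *\<^sub>R v))" for t
        using g(2) by metis
      then have "{t. f (p + t *\<^sub>R v) = 0} = {}" using p by auto
      then show ?thesis by simp
    next
      case False
      have "countable {z \<in> UNIV. g z = 0}"
        using False g(1) by (intro holomorphic_countable_zeros) auto
      moreover have "of_real ` {t. f (p + t *\<^sub>R v) = 0} \<subseteq> {z \<in> UNIV. g z = 0}"
        using g(2) by auto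
      ultimately have "countable (complex_of_real ` {t. f (p + t *\<^sub>R v) = 0})"
        by (rule countable_subset[rotated])
      then show ?thesis
        by (rule countable_image_inj_on) (auto simp: inj_on_def)
    qed
    then have "AE t in lborel. t \<notin> {t. f (p + t *\<^sub>R v) = 0}"
      by (intro AE_not_in) (simp add: countable_imp_null_set_lborel)
    then have "AE t in lborel. (indicator Z (p + t *\<^sub>R v) :: ennreal) = 0"
      by eventually_elim (auto simp: Z_def)
    then show ?thesis by (subst nn_integral_0_iff_AE) auto
  qed
  have "(\<integral>\<^sup>+ t. (\<integral>\<^sup>+ v. indicator Z (p + t *\<^sub>R v) \<partial>lborel) \<partial>lborel)
      = (\<integral>\<^sup>+ v. (\<integral>\<^sup>+ t. indicator Z (p + t *\<^sub>R v) \<partial>lborel) \<partial>lborel)"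
    by (rule lborel_pair.Fubini'[where f = "\<lambda>x y. indicator Z (p + y *\<^sub>R x)"]) measurable
  also have "\<dots> = 0" by (simp add: line)
  finally have "AE t in lborel. (\<integral>\<^sup>+ v. indicator Z (p + t *\<^sub>R v) \<partial>lborel) = 0"
    by (subst (asm) nn_integral_0_iff_AE) auto
  moreover have "AE t::real in lborel. t \<noteq> 0"
    by (rule AE_lborel_singleton)
  ultimately have "AE t::real in lborel. t \<noteq> 0 \<and> (\<integral>\<^sup>+ v. indicator Z (p + t *\<^sub>R v) \<partial>lborel) = 0"
    by eventually_elim simp
  moreover have "ae_filter (lborel :: real measure) \<noteq> bot"
    by (simp add: ae_filter_eq_bot_iff)
  ultimately obtain t :: real where t: "t \<noteq> 0" "(\<integral>\<^sup>+ v. indicator Z (p + t *\<^sub>R v) \<partial>lborel) = 0"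
    using eventually_happens by blast
  have "emeasure lborel Z = (\<integral>\<^sup>+ v. indicator Z v \<partial>lborel)" by simp
  also have "\<dots> = (\<integral>\<^sup>+ v. ennreal (\<bar>t\<bar> ^ DIM('a)) * indicator Z (p + t *\<^sub>R v) \<partial>lborel)"
    by (subst lborel_affine[OF t(1), of p])
      (simp add: emeasure_density nn_integral_density nn_integral_distr)
  also have "\<dots> = 0" using t(2) by (simp add: nn_integral_cmult)
  finally have "Z \<in> null_sets lborel" by (intro null_setsI) auto
  then show ?thesis by (simp add: Z_def)
qed

section \<open>A continuously differentiable step function\<close>

definition smooth_step :: "real \<Rightarrow> real" where
  "smooth_step s = (if s \<le> 0 then 0 else if 1 \<le> s then 1 else 3 * s\<^sup>2 - 2 * s ^ 3)"

text \<open>The factor \<open>s * (1 - s)\<close> vanishes at both ends, so the cubic step joins its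
  constant pieces with a continuous derivative. This regularity suffices, since test functions are
  only required to be \<open>C^1\<close>.\<close>

definition smooth_step' :: "real \<Rightarrow> real" where
  "smooth_step' s = (if 0 \<le> s \<and> s \<le> 1 then 6 * s * (1 - s) else 0)"

text \<open>Settles the two junctions of \<open>smooth_step\<close>, where no single formula holds
  in a neighbourhood but the function leaves its value at quadratic order.\<close>

lemma DERIV_zero_quadratic:
  fixes f :: "real \<Rightarrow> real"
  assumes "\<And>x. \<bar>f x - f a\<bar> \<le> C * (x - a)\<^sup>2"
  shows "DERIV f a :> 0"
proof -
  have "((\<lambda>h. (f (a + h) - f a) / h) \<longlongrightarrow> 0) (at 0)"
  proof (rule Lim_null_comparison)
    show "\<forall>\<^sub>F h in at 0. norm ((f (a + h) - f a) / h) \<le> C * \<bar>h\<bar>"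
    proof (rule eventually_mono[OF eventually_at_ball[of 1]])
      fix h :: real
      have "norm ((f (a + h) - f a) / h) = \<bar>f (a + h) - f a\<bar> / \<bar>h\<bar>" by simp
      also have "\<dots> \<le> C * h\<^sup>2 / \<bar>h\<bar>" using assms[of "a + h"] by (intro divide_right_mono) auto
      also have "\<dots> = C * \<bar>h\<bar>" by (simp add: power2_eq_square abs_if)
      finally show "norm ((f (a + h) - f a) / h) \<le> C * \<bar>h\<bar>" .
    qed simp
    show "((\<lambda>h. C * \<bar>h\<bar>) \<longlongrightarrow> 0) (at 0)" by (auto intro!: tendsto_eq_intros)
  qed
  then show ?thesis by (simp add: DERIV_def)
qed

lemma smooth_step_bounds: "0 \<le> smooth_step s" "smooth_step s \<le> 1" "0 \<le> smooth_step' s" "smooth_step' s \<le> 2"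
proof -
  have "0 \<le> s\<^sup>2 * (3 - 2 * s)" if "0 \<le> s" "s \<le> 1" using that by simp
  then show "0 \<le> smooth_step s"
    by (auto simp: smooth_step_def algebra_simps power2_eq_square power3_eq_cube)
  have "0 \<le> (1 - s)\<^sup>2 * (1 + 2 * s)" if "0 \<le> s" "s \<le> 1" using that by simp
  then show "smooth_step s \<le> 1"
    by (auto simp: smooth_step_def algebra_simps power2_eq_square power3_eq_cube)
  show "0 \<le> smooth_step' s" by (auto simp: smooth_step'_def)
  \<comment> \<open>Completing the square shows the maximum \<open>3 / 2\<close>; \<open>2\<close>
    is a rounded bound.\<close>
  have "6 * s * (1 - s) = 3 / 2 - 6 * (s - 1/2)\<^sup>2" by (simp add: power2_eq_square field_simps)
  then have "6 * s * (1 - s) \<le> 2" using zero_le_power2[of "s - 1/2"] by linarith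
  then show "smooth_step' s \<le> 2" by (auto simp: smooth_step'_def)
qed

lemma DERIV_smooth_step: "DERIV smooth_step s :> smooth_step' s"
proof -
  consider "s < 0" | "s = 0" | "0 < s" "s < 1" | "s = 1" | "1 < s" by linarith
  then show ?thesis
  proof cases
    case 1
    have "DERIV (\<lambda>_. 0) s :> smooth_step' s" using 1 by (simp add: smooth_step'_def)
    then show ?thesis
      by (rule has_field_derivative_transform_within_open[of _ _ _ "{..<0}"])
        (use 1 in \<open>auto simp: smooth_step_def\<close>)
  next
    case 2
    have "\<bar>smooth_step x - smooth_step 0\<bar> \<le> 3 * (x - 0)\<^sup>2" for x
    proof (cases "0 < x \<and> x < 1")
      case True
      then have "0 \<le> smooth_step x" "0 \<le> x ^ 3" by (auto intro: smooth_step_bounds)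
      with True show ?thesis by (auto simp: smooth_step_def)
    next
      case False
      then have "x \<le> 0 \<or> 1 \<le> x" by linarith
      moreover have "1 \<le> 3 * x\<^sup>2" if "1 \<le> x" using one_le_power[OF that, of 2] by linarith
      ultimately show ?thesis by (auto simp: smooth_step_def)
    qed
    then show ?thesis using 2 DERIV_zero_quadratic[of smooth_step 0 3] by (simp add: smooth_step'_def)
  next
    case 3
    have "DERIV (\<lambda>s. 3 * s\<^sup>2 - 2 * s ^ 3) s :> smooth_step' s"
      using 3 by (auto intro!: derivative_eq_intros simp: smooth_step'_def algebra_simps power2_eq_square)
    then show ?thesis
      by (rule has_field_derivative_transform_within_open[of _ _ _ "{0<..<1}"])
        (use 3 in \<open>auto simp: smooth_step_def\<close>)
  next
    case 4
    have "\<bar>smooth_step x - smooth_step 1\<bar> \<le> 3 * (x - 1)\<^sup>2" for x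
    proof (cases "0 < x \<and> x < 1")
      case True
      have "1 - smooth_step x = (x - 1)\<^sup>2 * (1 + 2 * x)"
        using True by (simp add: smooth_step_def power2_eq_square power3_eq_cube algebra_simps)
      also have "\<dots> \<le> (x - 1)\<^sup>2 * 3" using True by (intro mult_left_mono) auto
      finally show ?thesis using smooth_step_bounds(2)[of x] by (simp add: smooth_step_def)
    next
      case False
      then have "x \<le> 0 \<or> 1 \<le> x" by linarith
      moreover have "1 \<le> 3 * (x - 1)\<^sup>2" if "x \<le> 0"
      proof -
        have "1 \<le> (1 - x)\<^sup>2" using that by (intro one_le_power) auto
        then show ?thesis unfolding power2_commute[of x 1] by linarith
      qed
      ultimately show ?thesis by (auto simp: smooth_step_def)
    qed
    then show ?thesis using 4 DERIV_zero_quadratic[of smooth_step 1 3] by (simp add: smooth_step'_def)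
  next
    case 5
    have "DERIV (\<lambda>_. 1) s :> smooth_step' s" using 5 by (simp add: smooth_step'_def)
    then show ?thesis
      by (rule has_field_derivative_transform_within_open[of _ _ _ "{1<..}"])
        (use 5 in \<open>auto simp: smooth_step_def\<close>)
  qed
qed

lemma continuous_on_smooth_step': "continuous_on UNIV smooth_step'"
proof -
  have eq: "smooth_step' = (\<lambda>s. max 0 (6 * s * (1 - s)))"
  proof
    fix s :: real
    show "smooth_step' s = max 0 (6 * s * (1 - s))"
      by (auto simp: smooth_step'_def max_def mult_le_0_iff zero_le_mult_iff not_le)
  qed
  show ?thesis by (subst eq) (intro continuous_intros)
qed

section \<open>Piecewise defined Sobolev functions\<close>

lemma set_integral_restrict_space:
  fixes f :: "'a::euclidean_space \<Rightarrow> 'b::{banach, second_countable_topology}"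
  assumes "U \<in> sets lborel"
  shows "(LINT x:U|lborel. f x) = (LINT x|restrict_space lborel U. f x)"
  using assms unfolding set_lebesgue_integral_def by (subst integral_restrict_space) auto

text \<open>Stated for an arbitrary measure, so that \<open>U\<close> becomes the whole space of
  \<open>restrict_space lborel U\<close>: integrals carry no indicator functions, and boundedness of
  \<open>U\<close> enters as finiteness of the measure.\<close>

definition L2_on :: "'a measure \<Rightarrow> ('a \<Rightarrow> 'b::euclidean_space) \<Rightarrow> bool" where
  "L2_on M f \<longleftrightarrow> f \<in> borel_measurable M \<and> integrable M (\<lambda>x. (norm (f x))\<^sup>2)"

lemma square_integrable_on_eq:
  assumes "U \<in> sets lborel"
  shows "square_integrable_on U f \<longleftrightarrow> L2_on (restrict_space lborel U) f"
  using assms unfolding square_integrable_on_def L2_on_def set_borel_measurable_def set_integrable_def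
  by (simp add: integrable_restrict_space borel_measurable_restrict_space_iff)

lemma norm_mult_norm_le: "norm a * norm b \<le> (norm a)\<^sup>2 + (norm b)\<^sup>2"
proof -
  have "0 \<le> (norm a - norm b)\<^sup>2" "0 \<le> norm a * norm b" by auto
  then show ?thesis unfolding power2_diff by linarith
qed

text \<open>The majorant is the sum of the squared norms. Proved once for the products, inner
  products and scalings that occur below.\<close>

lemma L2_on_bounded_bilinear:
  assumes "bounded_bilinear h" "L2_on M f" "L2_on M g"
  shows "integrable M (\<lambda>x. h (f x) (g x) :: 'c::euclidean_space)"
proof -
  interpret bounded_bilinear h by fact
  obtain K where K: "\<And>a b. norm (h a b) \<le> norm a * norm b * K" "0 < K" using pos_bounded by blast
  have [measurable]: "f \<in> borel_measurable M" "g \<in> borel_measurable M"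
    using assms by (auto simp: L2_on_def)
  show ?thesis
  proof (rule Bochner_Integration.integrable_bound)
    show "integrable M (\<lambda>x. ((norm (f x))\<^sup>2 + (norm (g x))\<^sup>2) * K)"
      using assms by (auto simp: L2_on_def)
    have "continuous_on UNIV (\<lambda>p. h (fst p) (snd p))"
      by (intro bounded_bilinear.continuous_on[OF assms(1)] continuous_on_fst continuous_on_snd continuous_on_id)
    then show "(\<lambda>x. h (f x) (g x)) \<in> borel_measurable M"
      using borel_measurable_continuous_Pair[of f M g h] assms(2,3) by (simp only: L2_on_def)
    show "AE x in M. norm (h (f x) (g x)) \<le> norm (((norm (f x))\<^sup>2 + (norm (g x))\<^sup>2) * K)"
    proof (rule AE_I2)
      fix x
      have "norm (h (f x) (g x)) \<le> norm (f x) * norm (g x) * K" by (rule K)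
      also have "\<dots> \<le> ((norm (f x))\<^sup>2 + (norm (g x))\<^sup>2) * K"
        using K(2) norm_mult_norm_le by (intro mult_right_mono) auto
      finally show "norm (h (f x) (g x)) \<le> norm (((norm (f x))\<^sup>2 + (norm (g x))\<^sup>2) * K)" by simp
    qed
  qed
qed

lemma L2_on_mult: "L2_on M f \<Longrightarrow> L2_on M g \<Longrightarrow> integrable M (\<lambda>x. f x * g x :: real)"
  and L2_on_inner: "L2_on M u \<Longrightarrow> L2_on M v \<Longrightarrow> integrable M (\<lambda>x. u x \<bullet> v x)"
  and L2_on_scaleR: "L2_on M f \<Longrightarrow> L2_on M v \<Longrightarrow> integrable M (\<lambda>x. f x *\<^sub>R v x)"
  by (auto intro: L2_on_bounded_bilinear bounded_bilinear_mult bounded_bilinear_inner bounded_bilinear_scaleR)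

lemma L2_on_add:
  assumes "L2_on M f" "L2_on M g"
  shows "L2_on M (\<lambda>x. f x + g x)"
proof -
  have [measurable]: "f \<in> borel_measurable M" "g \<in> borel_measurable M"
    using assms by (auto simp: L2_on_def)
  have "integrable M (\<lambda>x. (norm (f x))\<^sup>2 + 2 * (f x \<bullet> g x) + (norm (g x))\<^sup>2)"
    using assms L2_on_inner[OF assms] by (auto simp: L2_on_def)
  moreover have "(norm (f x + g x))\<^sup>2 = (norm (f x))\<^sup>2 + 2 * (f x \<bullet> g x) + (norm (g x))\<^sup>2" for x
    by (simp add: power2_norm_eq_inner inner_add inner_commute)
  ultimately show ?thesis by (simp add: L2_on_def)
qed

lemma L2_on_cmult: "L2_on M f \<Longrightarrow> L2_on M (\<lambda>x. c *\<^sub>R f x)"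
  by (auto simp: L2_on_def power_mult_distrib)

lemma L2_on_zero: "L2_on M (\<lambda>_. 0)"
  by (simp add: L2_on_def)

lemma L2_on_sum:
  assumes "\<And>i. i \<in> I \<Longrightarrow> L2_on M (f i)"
  shows "L2_on M (\<lambda>x. \<Sum>i\<in>I. f i x)"
  using assms
  by (induction I rule: infinite_finite_induct) (auto intro: L2_on_add L2_on_zero)

lemma (in finite_measure) L2_on_bounded:
  assumes "f \<in> borel_measurable M" "\<And>x. x \<in> space M \<Longrightarrow> norm (f x) \<le> B"
  shows "L2_on M f"
  unfolding L2_on_def
proof
  have "AE x in M. norm ((norm (f x))\<^sup>2) \<le> B\<^sup>2"
    using assms(2) by (intro AE_I2) (auto intro: power_mono)
  then show "integrable M (\<lambda>x. (norm (f x))\<^sup>2)"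
    by (rule integrable_const_bound) (use assms(1) in measurable)
qed fact

lemma finite_measure_restrict_lborel:
  assumes "bounded U" "U \<in> sets lborel"
  shows "finite_measure (restrict_space lborel U)"
  using assms emeasure_bounded_finite[of U]
  by (intro finite_measureI) (auto simp: emeasure_restrict_space space_restrict_space)

lemma continuous_bounded_on_bounded:
  fixes f :: "'a::heine_borel \<Rightarrow> 'b::real_normed_vector"
  assumes "continuous_on UNIV f" "bounded U"
  obtains B where "0 \<le> B" "\<And>x. x \<in> U \<Longrightarrow> norm (f x) \<le> B"
proof -
  have "compact (f ` closure U)"
    using assms by (intro compact_continuous_image) (auto intro: continuous_on_subset simp: compact_closure)
  then obtain b where b: "\<And>y. y \<in> f ` closure U \<Longrightarrow> norm y \<le> b"
    by (meson bounded_iff compact_imp_bounded)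
  show thesis
  proof (rule that[of "max b 0"])
    fix x assume "x \<in> U"
    then show "norm (f x) \<le> max b 0" using b[of "f x"] closure_subset by fastforce
  qed simp
qed

lemma L2_on_piecewise:
  fixes f :: "'a::euclidean_space \<Rightarrow> 'b::euclidean_space"
  assumes "continuous_on UNIV f" "bounded U" "U \<in> sets lborel" "C \<in> sets lborel"
  shows "L2_on (restrict_space lborel U) (\<lambda>x. if x \<in> C then f x else 0)"
proof -
  interpret finite_measure "restrict_space lborel U" using assms by (intro finite_measure_restrict_lborel)
  obtain B where B: "0 \<le> B" "\<And>x. x \<in> U \<Longrightarrow> norm (f x) \<le> B"
    using continuous_bounded_on_bounded[OF assms(1,2)] by metis
  have [measurable]: "f \<in> borel_measurable borel" "C \<in> sets borel"
    using assms by (auto intro: borel_measurable_continuous_onI)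
  show ?thesis
    by (rule L2_on_bounded[where B = B])
      (use B in \<open>auto intro!: measurable_restrict_space1 simp: space_restrict_space\<close>)
qed

lemma L2_on_continuous:
  fixes f :: "'a::euclidean_space \<Rightarrow> 'b::euclidean_space"
  assumes "continuous_on UNIV f" "bounded U" "U \<in> sets lborel"
  shows "L2_on (restrict_space lborel U) f"
  using L2_on_piecewise[OF assms, of UNIV] by simp

lemma L2_on_test_function:
  assumes "test_function_on U \<psi> D\<psi>" "bounded U" "U \<in> sets lborel"
  shows "L2_on (restrict_space lborel U) \<psi>" "L2_on (restrict_space lborel U) D\<psi>"
proof -
  have "continuous_on UNIV \<psi>" "continuous_on UNIV D\<psi>"
    using assms(1) unfolding test_function_on_def gderiv_unfold
    by (auto intro!: continuous_at_imp_continuous_on has_derivative_continuous)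
  then show "L2_on (restrict_space lborel U) \<psi>" "L2_on (restrict_space lborel U) D\<psi>"
    using assms by (auto intro: L2_on_continuous)
qed

section \<open>Linear operations in \<open>H^1\<close> and truncation of small values\<close>

lemma sobolev_H1_add:
  assumes "sobolev_H1 U u Du" "sobolev_H1 U v Dv" "bounded U" "U \<in> sets lborel"
  shows "sobolev_H1 U (\<lambda>x. u x + v x) (\<lambda>x. Du x + Dv x)"
  using assms L2_on_test_function[OF _ assms(3,4)]
  unfolding sobolev_H1_def
  by (auto simp: square_integrable_on_eq set_integral_restrict_space scaleR_add_left scaleR_add_right
      intro!: L2_on_add)
    (simp add: L2_on_scaleR)

lemma sobolev_H1_cmult:
  fixes Du :: "'a::euclidean_space \<Rightarrow> 'a"
  assumes "sobolev_H1 U u Du" "U \<in> sets lborel"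
  shows "sobolev_H1 U (\<lambda>x. c * u x) (\<lambda>x. c *\<^sub>R Du x)"
proof -
  have "square_integrable_on U (\<lambda>x. c * u x)" "square_integrable_on U (\<lambda>x. c *\<^sub>R Du x)"
    using assms L2_on_cmult[of "restrict_space lborel U" u c] L2_on_cmult[of "restrict_space lborel U" Du c]
    by (auto simp: sobolev_H1_def square_integrable_on_eq)
  moreover have "(LINT x:U|lborel. (c * u x) *\<^sub>R D\<psi> x) = c *\<^sub>R (LINT x:U|lborel. u x *\<^sub>R D\<psi> x)"
    "(LINT x:U|lborel. \<psi> x *\<^sub>R c *\<^sub>R Du x) = c *\<^sub>R (LINT x:U|lborel. \<psi> x *\<^sub>R Du x)" for \<psi> and D\<psi> :: "'a \<Rightarrow> 'a"
    unfolding set_lebesgue_integral_def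
    by (simp_all add: scaleR_left_commute[of _ c] flip: scaleR_scaleR)
  moreover have "(LINT x:U|lborel. u x *\<^sub>R D\<psi> x) = - (LINT x:U|lborel. \<psi> x *\<^sub>R Du x)"
    if "test_function_on U \<psi> D\<psi>" for \<psi> D\<psi>
    using assms(1) that unfolding sobolev_H1_def by blast
  ultimately show ?thesis
    unfolding sobolev_H1_def by (intro conjI allI impI) (simp_all only: scaleR_minus_right)
qed

lemma sobolev_H1_sum:
  assumes "finite I" "\<And>i. i \<in> I \<Longrightarrow> sobolev_H1 U (u i) (Du i)" "bounded U" "U \<in> sets lborel"
  shows "sobolev_H1 U (\<lambda>x. \<Sum>i\<in>I. u i x) (\<lambda>x. \<Sum>i\<in>I. Du i x)"
  using assms(1,2)
proof (induction I rule: finite_induct)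
  case empty
  show ?case
    by (simp add: sobolev_H1_def square_integrable_on_def set_borel_measurable_def set_integrable_def)
qed (use assms(3,4) in \<open>auto intro: sobolev_H1_add\<close>)

text \<open>The step acts on the square of \<open>t / \<epsilon>\<close>, which treats both signs at
  once and avoids the corner of the absolute value. For positive \<open>\<epsilon>\<close> the
  result is \<open>0\<close> up to absolute value \<open>\<epsilon>\<close> and the identity from
  \<open>sqrt 2 * \<epsilon>\<close> on.\<close>

definition trunc :: "real \<Rightarrow> real \<Rightarrow> real" where
  "trunc \<epsilon> t = t * smooth_step ((t / \<epsilon>)\<^sup>2 - 1)"

definition trunc' :: "real \<Rightarrow> real \<Rightarrow> real" where
  "trunc' \<epsilon> t = smooth_step ((t / \<epsilon>)\<^sup>2 - 1) + 2 * (t / \<epsilon>)\<^sup>2 * smooth_step' ((t / \<epsilon>)\<^sup>2 - 1)"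

lemma DERIV_trunc:
  assumes "0 < \<epsilon>"
  shows "DERIV (trunc \<epsilon>) t :> trunc' \<epsilon> t"
proof -
  have "DERIV (\<lambda>t. smooth_step ((t / \<epsilon>)\<^sup>2 - 1)) t :> smooth_step' ((t / \<epsilon>)\<^sup>2 - 1) * (2 * t / \<epsilon>\<^sup>2)"
    by (rule DERIV_chain'[OF _ DERIV_smooth_step])
      (use assms in \<open>auto intro!: derivative_eq_intros simp: power2_eq_square\<close>)
  then show ?thesis
    unfolding trunc_def[abs_def] trunc'_def
    by (auto intro!: derivative_eq_intros simp: power2_eq_square)
qed

lemma continuous_on_trunc': "0 < \<epsilon> \<Longrightarrow> continuous_on UNIV (trunc' \<epsilon>)"
  unfolding trunc'_def[abs_def]
  by (intro continuous_intros continuous_on_compose2[OF continuous_on_smooth_step']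
      DERIV_continuous_on[OF DERIV_subset[OF DERIV_smooth_step]]
      continuous_on_compose2[of UNIV smooth_step]) (auto intro: DERIV_smooth_step)

lemma trunc_bound: "\<bar>trunc \<epsilon> t\<bar> \<le> \<bar>t\<bar>"
  unfolding trunc_def abs_mult using smooth_step_bounds by (simp add: mult_left_le)

text \<open>The bound is independent of \<open>\<epsilon>\<close>, as dominated convergence
  requires: the derivative of the step acts only where
  \<open>(t / \<epsilon>)\<^sup>2 \<le> 2\<close>, so the chain-rule factor stays bounded. The total
  is \<open>1 + 2 * (2 * 2)\<close>.\<close>

lemma trunc'_bound: "\<bar>trunc' \<epsilon> t\<bar> \<le> 9"
proof -
  let ?s = "(t / \<epsilon>)\<^sup>2"
  have "0 \<le> ?s * smooth_step' (?s - 1)" "?s * smooth_step' (?s - 1) \<le> 2 * 2"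
  proof -
    show "0 \<le> ?s * smooth_step' (?s - 1)" using smooth_step_bounds by simp
    show "?s * smooth_step' (?s - 1) \<le> 2 * 2"
    proof (cases "?s \<le> 2")
      case True
      then show ?thesis using smooth_step_bounds by (intro mult_mono) auto
    qed (simp add: smooth_step'_def)
  qed
  then show ?thesis using smooth_step_bounds[of "?s - 1"] unfolding trunc'_def by linarith
qed

lemma trunc_eq_0:
  assumes "0 < \<epsilon>" "\<bar>t\<bar> < \<epsilon>"
  shows "trunc \<epsilon> t = 0" "trunc' \<epsilon> t = 0"
proof -
  have "(t / \<epsilon>)\<^sup>2 < 1" using assms by (simp add: abs_square_less_1)
  then show "trunc \<epsilon> t = 0" "trunc' \<epsilon> t = 0"
    by (auto simp: trunc_def trunc'_def smooth_step_def smooth_step'_def)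
qed

lemma trunc_eq_id:
  assumes "0 < \<epsilon>" "2 * \<epsilon> \<le> \<bar>t\<bar>"
  shows "trunc \<epsilon> t = t" "trunc' \<epsilon> t = 1"
proof -
  have "2 \<le> \<bar>t / \<epsilon>\<bar>" using assms by (simp add: field_simps)
  then have "2 * 2 \<le> \<bar>t / \<epsilon>\<bar> * \<bar>t / \<epsilon>\<bar>" by (intro mult_mono) auto
  then have "4 \<le> (t / \<epsilon>)\<^sup>2" by (simp add: power2_eq_square flip: abs_mult)
  then show "trunc \<epsilon> t = t" "trunc' \<epsilon> t = 1"
    by (auto simp: trunc_def trunc'_def smooth_step_def smooth_step'_def)
qed

lemma eventually_inverse_Suc_le:
  assumes "0 < (d::real)"
  shows "\<forall>\<^sub>F n in sequentially. 2 * inverse (real (Suc n)) \<le> d"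
proof -
  have "\<forall>\<^sub>F n in sequentially. inverse (real (Suc n)) < d / 2"
    using assms by (intro order_tendstoD(2)[OF LIMSEQ_inverse_real_of_nat]) simp
  then show ?thesis by eventually_elim simp
qed

lemma trunc_tendsto:
  "(\<lambda>n. trunc (inverse (real (Suc n))) t) \<longlonglongrightarrow> t"
  "t \<noteq> 0 \<Longrightarrow> (\<lambda>n. trunc' (inverse (real (Suc n))) t) \<longlonglongrightarrow> 1"
proof -
  have ev: "\<forall>\<^sub>F n in sequentially. 2 * inverse (real (Suc n)) \<le> \<bar>t\<bar>" if "t \<noteq> 0"
    using that by (intro eventually_inverse_Suc_le) auto
  show "(\<lambda>n. trunc' (inverse (real (Suc n))) t) \<longlonglongrightarrow> 1" if "t \<noteq> 0"
    by (rule tendsto_eventually, rule eventually_mono[OF ev[OF that]], rule trunc_eq_id(2)) auto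
  show "(\<lambda>n. trunc (inverse (real (Suc n))) t) \<longlonglongrightarrow> t"
  proof (cases "t = 0")
    case False
    show ?thesis
      by (rule tendsto_eventually, rule eventually_mono[OF ev[OF False]], rule trunc_eq_id(1)) auto
  qed (simp add: trunc_def)
qed

lemma GDERIV_transform_within_open:
  "GDERIV f x :> D \<Longrightarrow> open S \<Longrightarrow> x \<in> S \<Longrightarrow> (\<And>y. y \<in> S \<Longrightarrow> f y = g y) \<Longrightarrow> GDERIV g x :> D"
  unfolding gderiv_unfold by (rule has_derivative_transform_within_open)

lemma GDERIV_continuous_on: "(\<And>x. GDERIV f x :> D x) \<Longrightarrow> continuous_on S f"
  unfolding gderiv_unfold
  by (auto intro!: continuous_at_imp_continuous_on has_derivative_continuous)

text \<open>
  Truncating \<open>\<Psi>\<close> near \<open>0\<close> makes its restriction to \<open>C\<close> continuously differentiable; the derivative of the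
  truncation converges to \<open>1\<close> off the zero set of \<open>\<Psi>\<close>, which is a null set.
\<close>

lemma sobolev_H1_piecewise:
  fixes \<Psi> :: "'a::euclidean_space \<Rightarrow> real"
  assumes U: "open U" "bounded U" and C: "open C" "C \<subseteq> U"
    and D: "\<And>x. GDERIV \<Psi> x :> D\<Psi> x" and cont: "continuous_on UNIV D\<Psi>"
    and null: "{x. \<Psi> x = 0} \<in> null_sets lborel"
    and bd: "\<And>x. x \<in> U \<Longrightarrow> x \<in> closure C \<Longrightarrow> x \<notin> C \<Longrightarrow> \<Psi> x = 0"
  shows "sobolev_H1 U (\<lambda>x. if x \<in> C then \<Psi> x else 0) (\<lambda>x. if x \<in> C then D\<Psi> x else 0)"
proof -
  have meas: "U \<in> sets lborel" "C \<in> sets lborel" using U C by auto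
  have cPsi: "continuous_on UNIV \<Psi>" using D by (rule GDERIV_continuous_on)
  have "(LINT x:U|lborel. (if x \<in> C then \<Psi> x else 0) *\<^sub>R D\<eta> x) =
      - (LINT x:U|lborel. \<eta> x *\<^sub>R (if x \<in> C then D\<Psi> x else 0))"
    if test: "test_function_on U \<eta> D\<eta>" for \<eta> D\<eta>
  proof -
    obtain K where K: "compact K" "K \<subseteq> U" "\<And>x. x \<notin> K \<Longrightarrow> \<eta> x = 0"
      and eta: "\<And>x. GDERIV \<eta> x :> D\<eta> x" "continuous_on UNIV D\<eta>"
      using test unfolding test_function_on_def by blast
    have Deta0: "D\<eta> x = 0" if "x \<notin> K" for x
      using gradient_zero_outside_support[OF eta(1) compact_imp_closed[OF K(1)] K(3) that] .
    have ceta: "continuous_on UNIV \<eta>" using eta(1) by (rule GDERIV_continuous_on)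
    define \<epsilon> where "\<epsilon> n = inverse (real (Suc n))" for n
    have \<epsilon>: "0 < \<epsilon> n" for n by (simp add: \<epsilon>_def)
    define p where "p n x = trunc (\<epsilon> n) (\<Psi> x) * \<eta> x" for n x
    define P where "P n x = trunc (\<epsilon> n) (\<Psi> x) *\<^sub>R D\<eta> x + \<eta> x *\<^sub>R (trunc' (\<epsilon> n) (\<Psi> x) *\<^sub>R D\<Psi> x)" for n x
    have Dp: "GDERIV (p n) x :> P n x" for n x
      unfolding p_def P_def
      by (intro GDERIV_mult GDERIV_DERIV_compose[OF D DERIV_trunc] eta \<epsilon>)
    have cP: "continuous_on UNIV (P n)" for n
    proof -
      have "continuous_on UNIV (\<lambda>x. trunc (\<epsilon> n) (\<Psi> x))"
        by (rule continuous_on_compose2[OF _ cPsi, of UNIV])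
          (auto intro!: DERIV_continuous_on[OF DERIV_subset[OF DERIV_trunc[OF \<epsilon>]]])
      moreover have "continuous_on UNIV (\<lambda>x. trunc' (\<epsilon> n) (\<Psi> x))"
        by (rule continuous_on_compose2[OF continuous_on_trunc'[OF \<epsilon>] cPsi]) auto
      ultimately show ?thesis
        unfolding P_def by (intro continuous_intros ceta eta cont)
    qed
    define f where "f n x = (if x \<in> C then p n x else 0)" for n x
    define F where "F n x = (if x \<in> C then P n x else 0)" for n x
    \<comment> \<open>Near every point the glued pair is either the full product or zero. This is
      critical only at boundary points of \<open>C\<close> inside \<open>U\<close>, where
      \<open>\<Psi>\<close> vanishes and the truncation removes a whole neighbourhood; the support
      of \<open>\<eta>\<close> stays away from the boundary of \<open>U\<close>.\<close>
    have loc: "\<exists>V. open V \<and> x \<in> V \<and> ((\<forall>y\<in>V. f n y = p n y \<and> F n y = P n y) \<or> (\<forall>y\<in>V. f n y = 0 \<and> F n y = 0))" for n x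
    proof -
      consider "x \<in> C" | "x \<notin> closure C" | "x \<notin> K" | "x \<in> U" "x \<in> closure C" "x \<notin> C"
        using K(2) by blast
      then show ?thesis
      proof cases
        case 1
        then show ?thesis using C(1) by (intro exI[of _ C]) (auto simp: f_def F_def)
      next
        case 2
        have "open (- closure C)" "- closure C \<inter> C = {}" using closure_subset by auto
        with 2 show ?thesis by (intro exI[of _ "- closure C"]) (auto simp: f_def F_def)
      next
        case 3
        have "open (- K)" using K(1) by (simp add: compact_imp_closed open_Compl)
        with 3 show ?thesis
          by (intro exI[of _ "- K"]) (auto simp: f_def F_def p_def P_def K(3) Deta0)
      next
        case 4
        then have "\<Psi> x = 0" by (rule bd)
        have "open {y. \<bar>\<Psi> y\<bar> < \<epsilon> n}"
          using cPsi by (intro open_Collect_less continuous_intros) auto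
        then show ?thesis
          using \<open>\<Psi> x = 0\<close> \<epsilon>[of n] trunc_eq_0[OF \<epsilon>[of n]]
          by (intro exI[of _ "{y. \<bar>\<Psi> y\<bar> < \<epsilon> n}"]) (auto simp: f_def F_def p_def P_def)
      qed
    qed
    have Df: "GDERIV (f n) x :> F n x" for n x
    proof -
      obtain V where V: "open V" "x \<in> V"
        "(\<forall>y\<in>V. f n y = p n y \<and> F n y = P n y) \<or> (\<forall>y\<in>V. f n y = 0 \<and> F n y = 0)"
        using loc by blast
      from V(3) show ?thesis
      proof
        assume *: "\<forall>y\<in>V. f n y = p n y \<and> F n y = P n y"
        have "GDERIV (p n) x :> F n x" using Dp * V(2) by simp
        then show ?thesis by (rule GDERIV_transform_within_open) (use V * in auto)
      next
        assume *: "\<forall>y\<in>V. f n y = 0 \<and> F n y = 0"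
        have "GDERIV (\<lambda>_. 0) x :> F n x" using GDERIV_const[of 0 x] * V(2) by simp
        then show ?thesis by (rule GDERIV_transform_within_open) (use V * in auto)
      qed
    qed
    have cF: "continuous_on UNIV (F n)" for n
    proof (rule continuous_at_imp_continuous_on, rule ballI)
      fix x
      obtain V where V: "open V" "x \<in> V"
        "(\<forall>y\<in>V. f n y = p n y \<and> F n y = P n y) \<or> (\<forall>y\<in>V. f n y = 0 \<and> F n y = 0)"
        using loc by blast
      have ev: "\<forall>\<^sub>F y in nhds x. y \<in> V" using V(1,2) by (rule eventually_nhds_in_open)
      from V(3) show "isCont (F n) x"
      proof
        assume *: "\<forall>y\<in>V. f n y = p n y \<and> F n y = P n y"
        have "isCont (P n) x" using cP[of n] by (simp add: continuous_on_eq_continuous_at)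
        moreover have "\<forall>\<^sub>F y in nhds x. P n y = F n y" using ev by eventually_elim (use * in auto)
        ultimately show ?thesis using isCont_cong by blast
      next
        assume *: "\<forall>y\<in>V. f n y = 0 \<and> F n y = 0"
        have "\<forall>\<^sub>F y in nhds x. 0 = F n y" using ev by eventually_elim (use * in auto)
        then show ?thesis using isCont_cong[of "\<lambda>_. 0" "F n" x] by simp
      qed
    qed
    have f0: "f n x = 0" if "x \<notin> K" for n x using that K(3) by (simp add: f_def p_def)
    have intF: "(LINT x|lborel. F n x) = 0" for n
      using integral_gradient_compact_support(2)[OF Df cF K(1) f0] .
    obtain B1 where B1: "0 \<le> B1" "\<And>x. x \<in> U \<Longrightarrow> norm (\<Psi> x) \<le> B1"
      using continuous_bounded_on_bounded[OF cPsi U(2)] by metis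
    obtain B2 where B2: "0 \<le> B2" "\<And>x. x \<in> U \<Longrightarrow> norm (D\<Psi> x) \<le> B2"
      using continuous_bounded_on_bounded[OF cont U(2)] by metis
    obtain B3 where B3: "0 \<le> B3" "\<And>x. x \<in> U \<Longrightarrow> norm (\<eta> x) \<le> B3"
      using continuous_bounded_on_bounded[OF ceta U(2)] by metis
    obtain B4 where B4: "0 \<le> B4" "\<And>x. x \<in> U \<Longrightarrow> norm (D\<eta> x) \<le> B4"
      using continuous_bounded_on_bounded[OF eta(2) U(2)] by metis
    define B where "B = B1 * B4 + B3 * (9 * B2)"
    define G where "G x = (if x \<in> C then \<Psi> x *\<^sub>R D\<eta> x + \<eta> x *\<^sub>R D\<Psi> x else 0)" for x
    have [measurable]: "D\<Psi> \<in> borel_measurable borel" "\<Psi> \<in> borel_measurable borel"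
      "\<eta> \<in> borel_measurable borel" "D\<eta> \<in> borel_measurable borel" "C \<in> sets borel"
      using cont cPsi ceta eta(2) C(1) by (auto intro: borel_measurable_continuous_onI)
    have "(\<lambda>n. LINT x|lborel. F n x) \<longlonglongrightarrow> (LINT x|lborel. G x)"
    proof (rule integral_dominated_convergence[where w = "\<lambda>x. indicator K x *\<^sub>R B"])
      show "integrable lborel (\<lambda>x. indicator K x *\<^sub>R B)"
        using K(1) by (intro borel_integrable_compact) auto
      show "AE x in lborel. norm (F n x) \<le> indicator K x *\<^sub>R B" for n
      proof (rule AE_I2)
        fix x
        show "norm (F n x) \<le> indicator K x *\<^sub>R B"
        proof (cases "x \<in> K \<and> x \<in> C")
          case True
          then have x: "x \<in> U" using C by blast
          have "norm (P n x) \<le> \<bar>trunc (\<epsilon> n) (\<Psi> x)\<bar> * norm (D\<eta> x) + \<bar>\<eta> x\<bar> * (\<bar>trunc' (\<epsilon> n) (\<Psi> x)\<bar> * norm (D\<Psi> x))"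
            unfolding P_def by (rule order_trans[OF norm_triangle_ineq]) (simp add: abs_mult mult.assoc)
          also have "\<dots> \<le> B"
            unfolding B_def
            using B1(2)[OF x] B2(2)[OF x] B3(2)[OF x] B4(2)[OF x] trunc_bound[of "\<epsilon> n" "\<Psi> x"]
              trunc'_bound[of "\<epsilon> n" "\<Psi> x"] B1(1) B2(1) B3(1) B4(1)
            by (intro add_mono mult_mono) auto
          finally show ?thesis using True by (simp add: F_def)
        next
          case False
          have "0 \<le> B" using B1(1) B2(1) B3(1) B4(1) by (simp add: B_def)
          with False show ?thesis
            by (auto simp: F_def P_def K(3) Deta0 indicator_def)
        qed
      qed
      \<comment> \<open>At a zero of \<open>\<Psi>\<close> all values of \<open>trunc'\<close> are
        \<open>0\<close>, so convergence to the untruncated gradient can fail there; hence the zero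
        set has to be a null set.\<close>
      have "AE x in lborel. x \<notin> {x. \<Psi> x = 0}" using null by (rule AE_not_in)
      then show "AE x in lborel. (\<lambda>n. F n x) \<longlonglongrightarrow> G x"
      proof eventually_elim
        fix x assume "x \<notin> {x. \<Psi> x = 0}"
        then have nz: "\<Psi> x \<noteq> 0" by simp
        have "(\<lambda>n. P n x) \<longlonglongrightarrow> \<Psi> x *\<^sub>R D\<eta> x + \<eta> x *\<^sub>R (1 *\<^sub>R D\<Psi> x)"
          unfolding P_def \<epsilon>_def
          by (intro tendsto_intros trunc_tendsto nz)
        then show "(\<lambda>n. F n x) \<longlonglongrightarrow> G x"
          by (simp add: F_def G_def)
      qed
      show "F n \<in> borel_measurable lborel" for n
        using cF[of n] by (simp add: borel_measurable_continuous_onI)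
      show "G \<in> borel_measurable lborel"
        unfolding G_def by measurable
    qed
    then have "(LINT x|lborel. G x) = 0" by (simp only: intF LIMSEQ_const_iff)
    moreover have "(LINT x|lborel. G x) = (LINT x:U|lborel. (if x \<in> C then \<Psi> x else 0) *\<^sub>R D\<eta> x +
      \<eta> x *\<^sub>R (if x \<in> C then D\<Psi> x else 0))"
      unfolding set_lebesgue_integral_def
      by (rule Bochner_Integration.integral_cong) (use C(2) in \<open>auto simp: G_def indicator_def\<close>)
    moreover have "\<dots> = (LINT x:U|lborel. (if x \<in> C then \<Psi> x else 0) *\<^sub>R D\<eta> x) +
      (LINT x:U|lborel. \<eta> x *\<^sub>R (if x \<in> C then D\<Psi> x else 0))"
      unfolding set_integral_restrict_space[OF meas(1)]
      by (intro Bochner_Integration.integral_add L2_on_scaleR L2_on_piecewise L2_on_test_function[OF test]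
          cPsi cont U meas)
    ultimately show ?thesis by (simp add: eq_neg_iff_add_eq_0)
  qed
  then show ?thesis
    unfolding sobolev_H1_def square_integrable_on_eq[OF meas(1)]
    by (auto intro!: L2_on_piecewise cPsi cont U meas)
qed

section \<open>Integration by parts in polytopes\<close>

text \<open>A pair consists of an inward normal of arbitrary length and an offset.\<close>

definition open_polytope :: "('a::euclidean_space \<times> real) set \<Rightarrow> 'a set" where
  "open_polytope H = {x. \<forall>h\<in>H. 0 < fst h \<bullet> x + snd h}"

lemma open_open_polytope:
  assumes "finite H"
  shows "open (open_polytope H)"
proof -
  have "open_polytope H = (\<Inter>h\<in>H. {x. 0 < fst h \<bullet> x + snd h})"
    by (auto simp: open_polytope_def)
  then show ?thesis
    using assms by (auto intro!: open_INT open_Collect_less continuous_intros)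
qed

text \<open>A summand is \<open>1\<close> where the affine function of its wall is at most
  \<open>\<epsilon>\<close> and \<open>0\<close> where it is at least \<open>2 * \<epsilon>\<close>.
  One near wall already lifts the sum to \<open>1\<close>, so one more step turns it into a cutoff,
  while its gradient remains a plain sum over the walls.\<close>

definition wall_sum :: "('a::euclidean_space \<times> real) set \<Rightarrow> real \<Rightarrow> 'a \<Rightarrow> real" where
  "wall_sum H \<epsilon> x = (\<Sum>h\<in>H. 1 - smooth_step ((fst h \<bullet> x + snd h) / \<epsilon> - 1))"

definition cutoff :: "('a::euclidean_space \<times> real) set \<Rightarrow> real \<Rightarrow> 'a \<Rightarrow> real" where
  "cutoff H \<epsilon> x = 1 - smooth_step (wall_sum H \<epsilon> x)"

definition cutoff' :: "('a::euclidean_space \<times> real) set \<Rightarrow> real \<Rightarrow> 'a \<Rightarrow> 'a" where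
  "cutoff' H \<epsilon> x = smooth_step' (wall_sum H \<epsilon> x) *\<^sub>R
     (\<Sum>h\<in>H. (smooth_step' ((fst h \<bullet> x + snd h) / \<epsilon> - 1) / \<epsilon>) *\<^sub>R fst h)"

lemma GDERIV_sum:
  assumes "\<And>i. i \<in> I \<Longrightarrow> GDERIV (f i) x :> D i"
  shows "GDERIV (\<lambda>x. \<Sum>i\<in>I. f i x) x :> (\<Sum>i\<in>I. D i)"
  using assms
  by (induction I rule: infinite_finite_induct) (auto intro: GDERIV_add GDERIV_const)

lemma GDERIV_inner_left: "GDERIV (\<lambda>x. a \<bullet> x) x :> a"
  unfolding gderiv_unfold inner_commute[of _ a]
  by (intro has_derivative_inner_right has_derivative_ident)

lemma GDERIV_wall_sum:
  assumes "0 < \<epsilon>"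
  shows "GDERIV (wall_sum H \<epsilon>) x :>
    - (\<Sum>h\<in>H. (smooth_step' ((fst h \<bullet> x + snd h) / \<epsilon> - 1) / \<epsilon>) *\<^sub>R fst h)"
proof -
  have "GDERIV (\<lambda>x. 1 - smooth_step ((fst h \<bullet> x + snd h) / \<epsilon> - 1)) x :>
      - ((smooth_step' ((fst h \<bullet> x + snd h) / \<epsilon> - 1) / \<epsilon>) *\<^sub>R fst h)" for h :: "'a \<times> real"
  proof -
    have "DERIV (\<lambda>t. 1 - smooth_step ((t + snd h) / \<epsilon> - 1)) t :>
        - (smooth_step' ((t + snd h) / \<epsilon> - 1) / \<epsilon>)" for t
    proof -
      have "DERIV (\<lambda>t. smooth_step ((t + snd h) / \<epsilon> - 1)) t :> smooth_step' ((t + snd h) / \<epsilon> - 1) * (1 / \<epsilon>)"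
        by (rule DERIV_chain'[OF _ DERIV_smooth_step]) (use assms in \<open>auto intro!: derivative_eq_intros\<close>)
      then show ?thesis by (auto intro!: derivative_eq_intros)
    qed
    from GDERIV_DERIV_compose[OF GDERIV_inner_left this] show ?thesis by simp
  qed
  then have "GDERIV (\<lambda>x. \<Sum>h\<in>H. 1 - smooth_step ((fst h \<bullet> x + snd h) / \<epsilon> - 1)) x :>
      (\<Sum>h\<in>H. - ((smooth_step' ((fst h \<bullet> x + snd h) / \<epsilon> - 1) / \<epsilon>) *\<^sub>R fst h))"
    by (rule GDERIV_sum)
  then show ?thesis
    unfolding wall_sum_def[abs_def] by (simp add: sum_negf)
qed

lemma GDERIV_cutoff:
  assumes "0 < \<epsilon>"
  shows "GDERIV (cutoff H \<epsilon>) x :> cutoff' H \<epsilon> x"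
proof -
  have "DERIV (\<lambda>t. 1 - smooth_step t) t :> - smooth_step' t" for t
    by (auto intro!: derivative_eq_intros DERIV_smooth_step)
  from GDERIV_DERIV_compose[OF GDERIV_wall_sum[OF assms] this]
  show ?thesis unfolding cutoff_def[abs_def] cutoff'_def by simp
qed

lemma continuous_on_cutoff':
  fixes H :: "('a::euclidean_space \<times> real) set"
  assumes "0 < \<epsilon>"
  shows "continuous_on UNIV (cutoff' H \<epsilon>)"
proof -
  have "continuous_on UNIV (wall_sum H \<epsilon>)"
    using GDERIV_wall_sum[OF assms] by (rule GDERIV_continuous_on)
  then have "continuous_on UNIV (\<lambda>x. smooth_step' (wall_sum H \<epsilon> x))"
    by (rule continuous_on_compose2[OF continuous_on_smooth_step']) auto
  moreover have "continuous_on UNIV (\<lambda>x::'a. smooth_step' ((fst h \<bullet> x + snd h) / \<epsilon> - 1))" for h :: "'a \<times> real"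
    by (rule continuous_on_compose2[OF continuous_on_smooth_step']) (use assms in \<open>auto intro!: continuous_intros\<close>)
  ultimately show ?thesis
    unfolding cutoff'_def[abs_def] using assms by (intro continuous_intros) auto
qed

lemma cutoff_bounds: "0 \<le> cutoff H \<epsilon> x" "cutoff H \<epsilon> x \<le> 1"
  using smooth_step_bounds by (auto simp: cutoff_def)

lemma cutoff_eq_0:
  assumes "finite H" "0 < \<epsilon>" "h \<in> H" "fst h \<bullet> x + snd h \<le> \<epsilon>"
  shows "cutoff H \<epsilon> x = 0"
proof -
  have "smooth_step ((fst h \<bullet> x + snd h) / \<epsilon> - 1) = 0"
    using assms(2,4) by (simp add: smooth_step_def field_simps)
  then have "1 = 1 - smooth_step ((fst h \<bullet> x + snd h) / \<epsilon> - 1)" by simp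
  also have "\<dots> \<le> wall_sum H \<epsilon> x"
    unfolding wall_sum_def using assms(1,3) smooth_step_bounds by (intro member_le_sum) auto
  finally show ?thesis by (simp add: cutoff_def smooth_step_def)
qed

lemma cutoff_eq_1:
  assumes "0 < \<epsilon>" "\<And>h. h \<in> H \<Longrightarrow> 2 * \<epsilon> \<le> fst h \<bullet> x + snd h"
  shows "cutoff H \<epsilon> x = 1" "cutoff' H \<epsilon> x = 0"
proof -
  have "smooth_step ((fst h \<bullet> x + snd h) / \<epsilon> - 1) = 1" if "h \<in> H" for h
    using assms(1) assms(2)[OF that] by (auto simp: smooth_step_def field_simps)
  then have "wall_sum H \<epsilon> x = 0" by (simp add: wall_sum_def)
  then show "cutoff H \<epsilon> x = 1" "cutoff' H \<epsilon> x = 0"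
    by (auto simp: cutoff_def cutoff'_def smooth_step_def smooth_step'_def)
qed

lemma cutoff_support:
  assumes H: "finite H" "bounded (open_polytope H)" and \<epsilon>: "0 < \<epsilon>"
  obtains K where "compact K" "K \<subseteq> open_polytope H" "\<And>x. x \<notin> K \<Longrightarrow> cutoff H \<epsilon> x = 0"
proof -
  define K where "K = {x. \<forall>h\<in>H. \<epsilon> \<le> fst h \<bullet> x + snd h}"
  have sub: "K \<subseteq> open_polytope H"
    using \<epsilon> by (force simp: K_def open_polytope_def)
  have "K = (\<Inter>h\<in>H. {x. \<epsilon> \<le> fst h \<bullet> x + snd h})" by (auto simp: K_def)
  then have "closed K" by (auto intro!: closed_INT closed_Collect_le continuous_intros)
  then have "compact K" using bounded_subset[OF H(2) sub] by (simp add: compact_eq_bounded_closed)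
  moreover have "cutoff H \<epsilon> x = 0" if "x \<notin> K" for x
    using that cutoff_eq_0[OF H(1) \<epsilon>] by (force simp: K_def)
  ultimately show thesis using that sub by blast
qed

lemma eventually_cutoff_eq_1:
  assumes "finite H" "x \<in> open_polytope H"
  shows "\<forall>\<^sub>F n in sequentially. cutoff H (inverse (real (Suc n))) x = 1 \<and> cutoff' H (inverse (real (Suc n))) x = 0"
proof -
  have "\<forall>\<^sub>F n in sequentially. \<forall>h\<in>H. 2 * inverse (real (Suc n)) \<le> fst h \<bullet> x + snd h"
    using assms by (intro eventually_ball_finite ballI eventually_inverse_Suc_le) (auto simp: open_polytope_def)
  then show ?thesis
    by (rule eventually_mono) (use cutoff_eq_1[of _ H x] in auto)
qed

text \<open>
  The field \<open>X\<close> is tangential to the walls to first order, which compensates the growth of the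
  gradient of the cutoff near the walls.
\<close>

lemma neumann_integration_by_parts:
  fixes H :: "('a::euclidean_space \<times> real) set" and X :: "'a \<Rightarrow> 'a"
  defines "U \<equiv> open_polytope H"
  assumes H: "finite H" "bounded U"
    and DX: "\<And>b x. b \<in> Basis \<Longrightarrow> GDERIV (\<lambda>x. X x \<bullet> b) x :> DX b x"
    and cDX: "\<And>b. b \<in> Basis \<Longrightarrow> continuous_on UNIV (DX b)"
    and tangential: "\<And>h. h \<in> H \<Longrightarrow> \<exists>C. \<forall>x\<in>U. \<bar>X x \<bullet> fst h\<bar> \<le> C * (fst h \<bullet> x + snd h)"
    and v: "sobolev_H1 U v Dv"
  shows "(LINT x:U|lborel. X x \<bullet> Dv x) = - (LINT x:U|lborel. v x * (\<Sum>b\<in>Basis. DX b x \<bullet> b))"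
proof -
  have oU: "open U" unfolding U_def using H(1) by (rule open_open_polytope)
  then have mU: "U \<in> sets lborel" by simp
  let ?M = "restrict_space lborel U"
  have spM: "space ?M = U" by (simp add: space_restrict_space)
  have L2v: "L2_on ?M v" "L2_on ?M Dv"
    using v by (auto simp: sobolev_H1_def square_integrable_on_eq[OF mU])
  interpret finite_measure ?M using H(2) mU by (rule finite_measure_restrict_lborel)
  have cXb: "continuous_on UNIV (\<lambda>x. X x \<bullet> b)" if "b \<in> Basis" for b
    using DX[OF that] by (rule GDERIV_continuous_on)
  have cX: "continuous_on UNIV X"
    using cXb by (subst continuous_on_componentwise) auto
  define dv where "dv x = (\<Sum>b\<in>Basis. DX b x \<bullet> b)" for x
  have cdv: "continuous_on UNIV dv"
    unfolding dv_def[abs_def] using cDX by (intro continuous_intros) auto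
  define \<epsilon> where "\<epsilon> n = inverse (real (Suc n))" for n
  have \<epsilon>: "0 < \<epsilon> n" for n by (simp add: \<epsilon>_def)
  have ccut: "continuous_on UNIV (cutoff H (\<epsilon> n))" for n
    using GDERIV_cutoff[OF \<epsilon>] by (rule GDERIV_continuous_on)
  \<comment> \<open>The weak gradient is tested with scalar functions, so each component of the
    field is cut off separately and the identity for the field is assembled by summing over
    \<open>Basis\<close>.\<close>
  define p where "p n b x = cutoff H (\<epsilon> n) x * (X x \<bullet> b)" for n b x
  define P where "P n b x = cutoff H (\<epsilon> n) x *\<^sub>R DX b x + (X x \<bullet> b) *\<^sub>R cutoff' H (\<epsilon> n) x" for n b x
  have test: "test_function_on U (p n b) (P n b)" if b: "b \<in> Basis" for n b
  proof -
    obtain K where K: "compact K" "K \<subseteq> U" "\<And>x. x \<notin> K \<Longrightarrow> cutoff H (\<epsilon> n) x = 0"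
      using cutoff_support[OF H(1) H(2)[unfolded U_def] \<epsilon>] unfolding U_def by metis
    have "GDERIV (p n b) x :> P n b x" for x
      unfolding p_def[abs_def] P_def
      by (intro GDERIV_mult GDERIV_cutoff \<epsilon> DX b)
    moreover have "continuous_on UNIV (P n b)"
      unfolding P_def[abs_def]
      by (intro continuous_intros ccut cDX cX b continuous_on_cutoff' \<epsilon>)
    ultimately show ?thesis
      unfolding test_function_on_def using K by (auto simp: p_def)
  qed
  have step: "(LINT x|?M. v x * (cutoff H (\<epsilon> n) x * dv x + X x \<bullet> cutoff' H (\<epsilon> n) x)) =
      - (LINT x|?M. cutoff H (\<epsilon> n) x * (X x \<bullet> Dv x))" for n
  proof -
    have eq: "(LINT x|?M. v x * (P n b x \<bullet> b)) = - (LINT x|?M. p n b x * (Dv x \<bullet> b))" if b: "b \<in> Basis" for b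
    proof -
      note t = test[OF b, of n]
      note l2 = L2_on_test_function[OF t H(2) mU]
      have "(LINT x|?M. v x *\<^sub>R P n b x) = - (LINT x|?M. p n b x *\<^sub>R Dv x)"
        using v t unfolding sobolev_H1_def set_integral_restrict_space[OF mU] by blast
      then have "(LINT x|?M. v x *\<^sub>R P n b x) \<bullet> b = - (LINT x|?M. p n b x *\<^sub>R Dv x) \<bullet> b" by simp
      then show ?thesis
        using L2_on_scaleR[OF L2v(1) l2(2)] L2_on_scaleR[OF l2(1) L2v(2)]
        by (simp flip: integral_inner_left)
    qed
    have int1: "integrable ?M (\<lambda>x. v x * (P n b x \<bullet> b))" if b: "b \<in> Basis" for b
      using L2_on_scaleR[OF L2v(1) L2_on_test_function(2)[OF test[OF b, of n] H(2) mU], THEN integrable_inner_left, of b]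
      by simp
    have int2: "integrable ?M (\<lambda>x. p n b x * (Dv x \<bullet> b))" if b: "b \<in> Basis" for b
      using L2_on_scaleR[OF L2_on_test_function(1)[OF test[OF b, of n] H(2) mU] L2v(2), THEN integrable_inner_left, of b]
      by simp
    have "(LINT x|?M. (\<Sum>b\<in>Basis. v x * (P n b x \<bullet> b))) = - (LINT x|?M. (\<Sum>b\<in>Basis. p n b x * (Dv x \<bullet> b)))"
      using eq int1 int2 by (simp add: Bochner_Integration.integral_sum sum_negf)
    moreover have "(\<Sum>b\<in>Basis. v x * (P n b x \<bullet> b)) = v x * (cutoff H (\<epsilon> n) x * dv x + X x \<bullet> cutoff' H (\<epsilon> n) x)" for x
      unfolding P_def dv_def euclidean_inner[of "X x" "cutoff' H (\<epsilon> n) x"]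
      by (simp add: inner_add_left sum.distrib sum_distrib_left algebra_simps)
    moreover have "(\<Sum>b\<in>Basis. p n b x * (Dv x \<bullet> b)) = cutoff H (\<epsilon> n) x * (X x \<bullet> Dv x)" for x
      unfolding p_def euclidean_inner[of "X x" "Dv x"] by (simp add: sum_distrib_left mult.assoc)
    ultimately show ?thesis by simp
  qed
  obtain C where C: "\<And>h x. h \<in> H \<Longrightarrow> x \<in> U \<Longrightarrow> \<bar>X x \<bullet> fst h\<bar> \<le> C h * (fst h \<bullet> x + snd h)"
    using tangential by metis
  define B where "B = (\<Sum>h\<in>H. 8 * \<bar>C h\<bar>)"
  have B: "\<bar>X x \<bullet> cutoff' H (\<epsilon> n) x\<bar> \<le> B" if x: "x \<in> U" for n x
  proof -
    let ?l = "\<lambda>h. fst h \<bullet> x + snd h"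
    \<comment> \<open>Apart from the normal itself, the gradient of a summand is at most
      \<open>2 / \<epsilon> n\<close> and lives in the strip up to \<open>2 * \<epsilon> n\<close>,
      where the normal component of \<open>X\<close> is at most
      \<open>\<bar>C h\<bar> * (2 * \<epsilon> n)\<close>. The product is bounded with constant
      \<open>4\<close>; the outer step contributes the remaining factor \<open>2\<close> of
      \<open>B\<close>.\<close>
    have wall: "\<bar>smooth_step' (?l h / \<epsilon> n - 1) / \<epsilon> n * (X x \<bullet> fst h)\<bar> \<le> 4 * \<bar>C h\<bar>" if h: "h \<in> H" for h
    proof (cases "?l h \<le> 2 * \<epsilon> n")
      case True
      have pos: "0 < ?l h" using h x by (auto simp: U_def open_polytope_def)
      have "\<bar>X x \<bullet> fst h\<bar> \<le> \<bar>C h\<bar> * ?l h"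
        using C[OF h x] pos by (smt (verit) mult_right_mono abs_ge_self)
      also have "\<dots> \<le> \<bar>C h\<bar> * (2 * \<epsilon> n)" using True by (intro mult_left_mono) auto
      finally have X: "\<bar>X x \<bullet> fst h\<bar> \<le> \<bar>C h\<bar> * (2 * \<epsilon> n)" .
      have "\<bar>smooth_step' (?l h / \<epsilon> n - 1) / \<epsilon> n * (X x \<bullet> fst h)\<bar>
          = \<bar>smooth_step' (?l h / \<epsilon> n - 1)\<bar> / \<epsilon> n * \<bar>X x \<bullet> fst h\<bar>"
        using \<epsilon>[of n] by (simp add: abs_mult)
      also have "\<dots> \<le> 2 / \<epsilon> n * (\<bar>C h\<bar> * (2 * \<epsilon> n))"
        using X \<epsilon>[of n] smooth_step_bounds(3,4)[of "?l h / \<epsilon> n - 1"]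
        by (intro mult_mono divide_right_mono) auto
      also have "\<dots> = 4 * \<bar>C h\<bar>" using \<epsilon>[of n] by simp
      finally show ?thesis .
    next
      case False
      then have "1 < ?l h / \<epsilon> n - 1" using \<epsilon>[of n] by (simp add: pos_less_divide_eq)
      then show ?thesis by (simp add: smooth_step'_def)
    qed
    have "\<bar>X x \<bullet> cutoff' H (\<epsilon> n) x\<bar> = \<bar>smooth_step' (wall_sum H (\<epsilon> n) x)\<bar> *
        \<bar>\<Sum>h\<in>H. smooth_step' (?l h / \<epsilon> n - 1) / \<epsilon> n * (X x \<bullet> fst h)\<bar>"
      unfolding cutoff'_def by (simp add: inner_sum_right abs_mult)
    also have "\<dots> \<le> 2 * (\<Sum>h\<in>H. 4 * \<bar>C h\<bar>)"
      using smooth_step_bounds(3,4)[of "wall_sum H (\<epsilon> n) x"]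
      by (intro mult_mono order_trans[OF sum_abs sum_mono] wall) (auto intro: sum_nonneg)
    also have "\<dots> = B" by (simp add: B_def sum_distrib_left)
    finally show ?thesis .
  qed
  have B0: "0 \<le> B" by (auto simp: B_def intro: sum_nonneg)
  have ev: "\<forall>\<^sub>F n in sequentially. cutoff H (\<epsilon> n) x = 1 \<and> cutoff' H (\<epsilon> n) x = 0" if "x \<in> U" for x
    unfolding \<epsilon>_def using eventually_cutoff_eq_1[OF H(1)] that by (simp add: U_def)
  have [measurable]: "v \<in> borel_measurable ?M" "Dv \<in> borel_measurable ?M"
    "dv \<in> borel_measurable ?M" "X \<in> borel_measurable ?M" "cutoff H (\<epsilon> n) \<in> borel_measurable ?M"
    "cutoff' H (\<epsilon> n) \<in> borel_measurable ?M" for n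
    using L2v cdv cX ccut continuous_on_cutoff'[OF \<epsilon>]
    by (auto simp: L2_on_def intro!: measurable_restrict_space1 borel_measurable_continuous_onI)
  obtain B1 where B1: "0 \<le> B1" "\<And>x. x \<in> U \<Longrightarrow> norm (dv x) \<le> B1"
    using continuous_bounded_on_bounded[OF cdv H(2)] by metis
  have l2const: "L2_on ?M (\<lambda>_. c)" for c :: real
    by (rule L2_on_bounded[where B = "\<bar>c\<bar>"]) auto
  have "(\<lambda>n. LINT x|?M. v x * (cutoff H (\<epsilon> n) x * dv x + X x \<bullet> cutoff' H (\<epsilon> n) x)) \<longlonglongrightarrow> (LINT x|?M. v x * dv x)"
  proof (rule integral_dominated_convergence[where w = "\<lambda>x. \<bar>v x\<bar> * (B1 + B)"])
    show "integrable ?M (\<lambda>x. \<bar>v x\<bar> * (B1 + B))"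
      using L2_on_mult[OF L2v(1) l2const[of 1]] by simp
    show "AE x in ?M. norm (v x * (cutoff H (\<epsilon> n) x * dv x + X x \<bullet> cutoff' H (\<epsilon> n) x)) \<le> \<bar>v x\<bar> * (B1 + B)" for n
    proof (rule AE_I2)
      fix x assume "x \<in> space ?M"
      then have x: "x \<in> U" by (simp add: spM)
      have "\<bar>cutoff H (\<epsilon> n) x * dv x\<bar> \<le> 1 * B1"
        unfolding abs_mult using cutoff_bounds[of H "\<epsilon> n" x] B1(2)[OF x] by (intro mult_mono) auto
      then have "\<bar>cutoff H (\<epsilon> n) x * dv x + X x \<bullet> cutoff' H (\<epsilon> n) x\<bar> \<le> B1 + B"
        using B[OF x, of n] by linarith
      then show "norm (v x * (cutoff H (\<epsilon> n) x * dv x + X x \<bullet> cutoff' H (\<epsilon> n) x)) \<le> \<bar>v x\<bar> * (B1 + B)"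
        by (simp add: abs_mult mult_left_mono)
    qed
    show "AE x in ?M. (\<lambda>n. v x * (cutoff H (\<epsilon> n) x * dv x + X x \<bullet> cutoff' H (\<epsilon> n) x)) \<longlonglongrightarrow> v x * dv x"
    proof (rule AE_I2)
      fix x assume "x \<in> space ?M"
      then have "x \<in> U" by (simp add: spM)
      from ev[OF this] show "(\<lambda>n. v x * (cutoff H (\<epsilon> n) x * dv x + X x \<bullet> cutoff' H (\<epsilon> n) x)) \<longlonglongrightarrow> v x * dv x"
        by (rule tendsto_eventually[OF eventually_mono]) simp
    qed
  qed measurable
  moreover have "(\<lambda>n. LINT x|?M. cutoff H (\<epsilon> n) x * (X x \<bullet> Dv x)) \<longlonglongrightarrow> (LINT x|?M. X x \<bullet> Dv x)"
  proof (rule integral_dominated_convergence[where w = "\<lambda>x. \<bar>X x \<bullet> Dv x\<bar>"])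
    show "integrable ?M (\<lambda>x. \<bar>X x \<bullet> Dv x\<bar>)"
      using L2_on_inner[OF L2_on_continuous[OF cX H(2) mU] L2v(2)] by simp
    show "AE x in ?M. norm (cutoff H (\<epsilon> n) x * (X x \<bullet> Dv x)) \<le> \<bar>X x \<bullet> Dv x\<bar>" for n
      using cutoff_bounds[of H "\<epsilon> n"] by (intro AE_I2) (simp add: abs_mult mult_left_le_one_le)
    show "AE x in ?M. (\<lambda>n. cutoff H (\<epsilon> n) x * (X x \<bullet> Dv x)) \<longlonglongrightarrow> X x \<bullet> Dv x"
    proof (rule AE_I2)
      fix x assume "x \<in> space ?M"
      then have "x \<in> U" by (simp add: spM)
      from ev[OF this] show "(\<lambda>n. cutoff H (\<epsilon> n) x * (X x \<bullet> Dv x)) \<longlonglongrightarrow> X x \<bullet> Dv x"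
        by (rule tendsto_eventually[OF eventually_mono]) simp
    qed
  qed measurable
  then have "(\<lambda>n. - (LINT x|?M. cutoff H (\<epsilon> n) x * (X x \<bullet> Dv x))) \<longlonglongrightarrow> - (LINT x|?M. X x \<bullet> Dv x)"
    by (rule tendsto_minus)
  ultimately have "(LINT x|?M. v x * dv x) = - (LINT x|?M. X x \<bullet> Dv x)"
    unfolding step by (rule LIMSEQ_unique)
  then show ?thesis by (simp add: set_integral_restrict_space[OF mU] dv_def)
qed

section \<open>Waves on reflection domains\<close>

text \<open>The sum runs over the group and not over the orbit as a set, so a vector with nontrivial
  stabilizer is counted repeatedly. In return, translation by a group element is a mere
  reindexing.\<close>

definition wave :: "('a \<Rightarrow> 'a) set \<Rightarrow> 'a \<Rightarrow> 'a::euclidean_space \<Rightarrow> real" where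
  "wave G v x = (\<Sum>g\<in>G. cos (g v \<bullet> x))"

definition wave' :: "('a \<Rightarrow> 'a) set \<Rightarrow> 'a \<Rightarrow> 'a::euclidean_space \<Rightarrow> 'a" where
  "wave' G v x = - (\<Sum>g\<in>G. sin (g v \<bullet> x) *\<^sub>R g v)"

definition closed_polytope :: "('a::euclidean_space \<times> real) set \<Rightarrow> 'a set" where
  "closed_polytope H = {x. \<forall>h\<in>H. 0 \<le> fst h \<bullet> x + snd h}"

lemma GDERIV_wave: "GDERIV (wave G v) x :> wave' G v x"
proof -
  have "GDERIV (\<lambda>x. cos (w \<bullet> x)) x :> - sin (w \<bullet> x) *\<^sub>R w" for w :: 'a
    by (rule GDERIV_DERIV_compose[OF GDERIV_inner_left DERIV_cos])
  then have "GDERIV (\<lambda>x. \<Sum>g\<in>G. cos (g v \<bullet> x)) x :> (\<Sum>g\<in>G. - sin (g v \<bullet> x) *\<^sub>R g v)"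
    by (intro GDERIV_sum)
  then show ?thesis by (simp add: wave_def[abs_def] wave'_def sum_negf)
qed

lemma continuous_on_wave': "continuous_on S (wave' G v)"
  unfolding wave'_def[abs_def] by (intro continuous_intros)

lemma continuous_on_wave: "continuous_on S (wave G v)"
  unfolding wave_def[abs_def] by (intro continuous_intros)

lemma entire_on_lines_wave: "entire_on_lines (wave G v)"
  unfolding wave_def[abs_def] by (intro entire_on_lines_sum entire_on_lines_cos_inner)

lemma abs_sin_diff_le: "\<bar>sin a - sin b\<bar> \<le> \<bar>a - b :: real\<bar>"
proof -
  have "\<bar>sin a - sin b\<bar> = 2 * \<bar>sin ((a - b) / 2)\<bar> * \<bar>cos ((a + b) / 2)\<bar>"
    by (simp add: sin_diff_sin abs_mult)
  also have "\<dots> \<le> 2 * \<bar>(a - b) / 2\<bar> * 1"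
    by (intro mult_mono mult_left_mono abs_sin_x_le_abs_x) auto
  finally show ?thesis by simp
qed

lemma sum_fun_apply: "(\<Sum>k\<in>A. f k) x = (\<Sum>k\<in>A. f k x)"
  by (induction A rule: infinite_finite_induct) auto

lemma interior_closed_polytope:
  assumes "finite H" "\<And>h. h \<in> H \<Longrightarrow> fst h \<noteq> 0"
  shows "interior (closed_polytope H) = open_polytope H"
  using assms
proof (induction H rule: finite_induct)
  case empty
  then show ?case by (simp add: closed_polytope_def open_polytope_def)
next
  case (insert h H)
  have "closed_polytope (insert h H) = {x. fst h \<bullet> x \<ge> - snd h} \<inter> closed_polytope H"
    by (auto simp: closed_polytope_def algebra_simps)
  moreover have "interior {x. fst h \<bullet> x \<ge> - snd h} = {x. fst h \<bullet> x > - snd h}"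
    using insert.prems by (intro interior_halfspace_ge) auto
  ultimately have "interior (closed_polytope (insert h H)) = {x. fst h \<bullet> x > - snd h} \<inter> open_polytope H"
    using insert by (simp add: interior_Int)
  also have "\<dots> = open_polytope (insert h H)"
    by (auto simp: open_polytope_def)
  finally show ?case .
qed

text \<open>Gram-Schmidt, one vector at a time: the new vector \<open>s\<close> is first made
  orthogonal to the old span, and the residual of \<open>f\<close> is then corrected along that
  component.\<close>

lemma orthogonal_projection_span:
  assumes "finite S" "\<And>s. s \<in> S \<Longrightarrow> L2_on M s" "L2_on M (f :: 'a \<Rightarrow> real)"
  shows "\<exists>w\<in>function_space.span S. L2_on M w \<and> (\<forall>s\<in>S. (LINT x|M. (f x - w x) * s x) = 0)"
  using assms
proof (induction S arbitrary: f rule: finite_induct)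
  case empty
  then show ?case by (intro bexI[of _ 0]) (auto simp: L2_on_zero zero_fun_def)
next
  case (insert s S)
  have L2diff: "L2_on M (\<lambda>x. a x - b x)" if "L2_on M a" "L2_on M b" for a b :: "'a \<Rightarrow> real"
    using L2_on_add[OF that(1) L2_on_cmult[OF that(2), of "-1"]] by simp
  have span: "(LINT x|M. a x * t x) = 0"
    if "L2_on M a" "\<forall>s\<in>S. (LINT x|M. a x * s x) = 0" "t \<in> function_space.span S" for a t
  proof -
    have "L2_on M t \<and> (LINT x|M. a x * t x) = 0"
      using that(3)
    proof (induction t rule: function_space.span_induct_alt)
      case base
      show ?case by (simp add: zero_fun_def L2_on_zero)
    next
      case (step c y z)
      have y: "L2_on M y" using step(1) insert.prems(1) by simp
      have "L2_on M (\<lambda>x. c * y x)" using L2_on_cmult[OF y, of c] by simp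
      then have "L2_on M (\<lambda>x. c * y x + z x)" using step by (intro L2_on_add) auto
      moreover have "(LINT x|M. a x * (c * y x + z x)) = c * (LINT x|M. a x * y x) + (LINT x|M. a x * z x)"
      proof -
        have "(LINT x|M. a x * (c * y x + z x)) = (LINT x|M. c * (a x * y x) + a x * z x)"
          by (simp add: algebra_simps)
        also have "\<dots> = (LINT x|M. c * (a x * y x)) + (LINT x|M. a x * z x)"
          using step y that(1) by (intro Bochner_Integration.integral_add integrable_mult_right L2_on_mult) auto
        finally show ?thesis by simp
      qed
      ultimately show ?case using step that(2) by (simp add: plus_fun_def)
    qed
    then show ?thesis by simp
  qed
  have sL: "L2_on M s" "\<And>t. t \<in> S \<Longrightarrow> L2_on M t" using insert.prems by auto
  obtain w where w: "w \<in> function_space.span S" "L2_on M w" "\<forall>t\<in>S. (LINT x|M. (f x - w x) * t x) = 0"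
    using insert.IH[of f] insert.prems by auto
  obtain q where q: "q \<in> function_space.span S" "L2_on M q" "\<forall>t\<in>S. (LINT x|M. (s x - q x) * t x) = 0"
    using insert.IH[of s] insert.prems by auto
  define s' where "s' x = s x - q x" for x
  define f' where "f' x = f x - w x" for x
  have s': "L2_on M s'" unfolding s'_def by (intro L2diff sL q)
  have f': "L2_on M f'" unfolding f'_def by (intro L2diff insert.prems w)
  define c where "c = (LINT x|M. f' x * s' x) / (LINT x|M. s' x * s' x)"
  \<comment> \<open>If \<open>s'\<close> vanishes almost everywhere, as may happen for dependent
    vectors, both integrals are \<open>0\<close> and any coefficient serves.\<close>
  have c: "(LINT x|M. f' x * s' x) = c * (LINT x|M. s' x * s' x)"
  proof (cases "(LINT x|M. s' x * s' x) = 0")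
    case True
    then have "AE x in M. s' x * s' x = 0"
      using integral_nonneg_eq_0_iff_AE[OF L2_on_mult[OF s' s']] by simp
    then have "(LINT x|M. f' x * s' x) = (LINT x|M. 0)"
      using L2_on_mult[OF f' s'] by (intro integral_cong_AE) auto
    with True show ?thesis by simp
  qed (simp add: c_def)
  define r where "r x = f' x - c * s' x" for x
  have cs': "L2_on M (\<lambda>x. c * s' x)" using L2_on_cmult[OF s', of c] by simp
  have r: "L2_on M r" unfolding r_def by (intro L2diff f' cs')
  have rint: "(LINT x|M. r x * t x) = (LINT x|M. f' x * t x) - c * (LINT x|M. s' x * t x)" if "L2_on M t" for t
  proof -
    have "(LINT x|M. r x * t x) = (LINT x|M. f' x * t x - c * (s' x * t x))"
      by (simp add: r_def algebra_simps)
    also have "\<dots> = (LINT x|M. f' x * t x) - (LINT x|M. c * (s' x * t x))"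
      using that f' s' by (intro Bochner_Integration.integral_diff integrable_mult_right L2_on_mult)
    finally show ?thesis by simp
  qed
  have rS: "\<forall>t\<in>S. (LINT x|M. r x * t x) = 0"
    using rint sL w(3) q(3) by (simp add: f'_def s'_def)
  have "(LINT x|M. r x * s x) = (LINT x|M. r x * s' x + r x * q x)"
    by (simp add: s'_def algebra_simps)
  also have "\<dots> = (LINT x|M. r x * s' x) + (LINT x|M. r x * q x)"
    using r s' q(2) by (intro Bochner_Integration.integral_add L2_on_mult)
  also have "\<dots> = 0" using span[OF r rS q(1)] rint[OF s'] c by simp
  finally have rs: "(LINT x|M. r x * s x) = 0" .
  define w' where "w' = (\<lambda>x. w x + c * (s x - q x))"
  have "w' \<in> function_space.span (insert s S)"
  proof -
    have sub: "function_space.span S \<subseteq> function_space.span (insert s S)"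
      by (intro function_space.span_mono) auto
    have "s \<in> function_space.span (insert s S)" by (intro function_space.span_base) simp
    with w(1) q(1) sub have "w + (\<lambda>x. c * (s - q) x) \<in> function_space.span (insert s S)"
      by (intro function_space.span_add function_space.span_scale function_space.span_diff) blast+
    then show ?thesis by (simp add: w'_def plus_fun_def fun_diff_def)
  qed
  moreover have "L2_on M w'"
    using L2_on_add[OF w(2) cs'] by (simp add: w'_def s'_def)
  moreover have "f x - w' x = r x" for x by (simp add: w'_def r_def f'_def s'_def)
  ultimately show ?case using rs rS by (intro bexI[of _ w']) auto
qed

text \<open>A choice function for the gradient lets \<open>H^1\<close> statements about eigenwaves
  name a gradient without carrying it as a second object; \<open>grad_eq\<close> identifies
  it.\<close>

definition grad :: "('a::real_inner \<Rightarrow> real) \<Rightarrow> 'a \<Rightarrow> 'a" where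
  "grad f x = (SOME D. GDERIV f x :> D)"

lemma GDERIV_unique: "GDERIV f x :> D \<Longrightarrow> GDERIV f x :> E \<Longrightarrow> D = E"
  unfolding gderiv_unfold by (metis has_derivative_unique inner_eq_zero_iff inner_diff_right right_minus_eq)

lemma grad_eq: "(\<And>x. GDERIV f x :> D x) \<Longrightarrow> grad f = D"
  unfolding grad_def by (auto simp: fun_eq_iff intro!: some_equality dest: GDERIV_unique)

text \<open>
  The domain is \<open>{x. 0 \<le> a \<bullet> x + c}\<close> for the walls \<open>(a, c) \<in> H\<close>. The waves are sums of plane waves over
  the orbits of the point group \<open>G\<close> in the lattice \<open>L\<close> of wave vectors; they satisfy the Neumann
  condition since \<open>G\<close> contains the linear parts of the reflections in the walls.
\<close>

locale reflection_domain =
  fixes H :: "('a::euclidean_space \<times> real) set" and G :: "('a \<Rightarrow> 'a) set" and L :: "'a set"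
  assumes finite_H: "finite H"
    and bounded_closed_polytope: "bounded (closed_polytope H)"
    and nonempty: "open_polytope H \<noteq> {}"
    and normal_nonzero: "h \<in> H \<Longrightarrow> fst h \<noteq> 0"
    and finite_G: "finite G"
    and id_G: "id \<in> G"
    and comp_G: "g \<in> G \<Longrightarrow> g' \<in> G \<Longrightarrow> g \<circ> g' \<in> G"
    and orthogonal_G: "g \<in> G \<Longrightarrow> orthogonal_transformation g"
    and reflection_G: "h \<in> H \<Longrightarrow> (\<lambda>w. w - (2 * (w \<bullet> fst h) / (fst h \<bullet> fst h)) *\<^sub>R fst h) \<in> G"
    and zero_L: "0 \<in> L"
    and add_L: "u \<in> L \<Longrightarrow> v \<in> L \<Longrightarrow> u + v \<in> L"
    and diff_L: "u \<in> L \<Longrightarrow> v \<in> L \<Longrightarrow> u - v \<in> L"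
    and G_L: "g \<in> G \<Longrightarrow> v \<in> L \<Longrightarrow> g v \<in> L"
    and discrete_L: "finite {v \<in> L. v \<bullet> v \<le> r}"
    and walls_L: "v \<in> L \<Longrightarrow> h \<in> H \<Longrightarrow> \<exists>k::int. (v \<bullet> fst h) * snd h / (fst h \<bullet> fst h) = pi * of_int k"
    and waves_separate: "x \<in> closed_polytope H \<Longrightarrow> y \<in> closed_polytope H \<Longrightarrow> x \<noteq> y \<Longrightarrow>
      \<exists>v\<in>L. wave G v x \<noteq> wave G v y"
begin

abbreviation U :: "'a set" where "U \<equiv> open_polytope H"
abbreviation \<Omega> :: "'a set" where "\<Omega> \<equiv> closed_polytope H"
abbreviation M :: "'a measure" where "M \<equiv> restrict_space lborel U"

lemma interior_\<Omega>: "interior \<Omega> = U"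
  using finite_H normal_nonzero by (rule interior_closed_polytope)

lemma U_subset: "U \<subseteq> \<Omega>"
  using interior_subset[of \<Omega>] by (simp add: interior_\<Omega>)

lemma open_U: "open U"
  using finite_H by (rule open_open_polytope)

lemma bounded_U: "bounded U"
  using bounded_closed_polytope U_subset by (rule bounded_subset)

lemma sets_U: "U \<in> sets lborel"
  using open_U by simp

lemma compact_\<Omega>: "compact \<Omega>"
proof -
  have "\<Omega> = (\<Inter>h\<in>H. {x. 0 \<le> fst h \<bullet> x + snd h})" by (auto simp: closed_polytope_def)
  then have "closed \<Omega>" by (auto intro!: closed_INT closed_Collect_le continuous_intros)
  then show ?thesis using bounded_closed_polytope by (simp add: compact_eq_bounded_closed)
qed

lemma space_M: "space M = U"
  by (simp add: space_restrict_space)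

lemmas lint_eq = set_integral_restrict_space[OF sets_U]
lemmas square_integrable_iff = square_integrable_on_eq[OF sets_U]

sublocale finite_measure M
  using bounded_U sets_U by (rule finite_measure_restrict_lborel)

lemma sum_G_reindex:
  assumes "g \<in> G"
  shows "(\<Sum>k\<in>G. f (g \<circ> k)) = (\<Sum>k\<in>G. f k)"
proof -
  have "inj g" using orthogonal_transformation_inj[OF orthogonal_G[OF assms]] .
  then have inj: "inj_on ((\<circ>) g) G" by (auto simp: inj_on_def fun_eq_iff)
  then have "(\<circ>) g ` G = G"
    using comp_G[OF assms] finite_G by (intro endo_inj_surj) auto
  then show ?thesis using sum.reindex[OF inj, of f] by simp
qed

text \<open>Product-to-sum formula. Replacing \<open>k\<close> by \<open>g \<circ> k\<close> in the
  inner sum lets \<open>g\<close> act on both vectors, so that the terms combine to waves with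
  vectors \<open>v + k u\<close> and \<open>v - k u\<close> of the lattice.\<close>

lemma wave_mult:
  "wave G v x * wave G u x = (\<Sum>k\<in>G. (wave G (v + k u) x + wave G (v - k u) x) / 2)"
proof -
  have "wave G v x * wave G u x = (\<Sum>g\<in>G. \<Sum>k\<in>G. cos (g v \<bullet> x) * cos (k u \<bullet> x))"
    by (simp add: wave_def sum_product)
  also have "\<dots> = (\<Sum>g\<in>G. \<Sum>k\<in>G. cos (g v \<bullet> x) * cos ((g \<circ> k) u \<bullet> x))"
    by (intro sum.cong refl sum_G_reindex[symmetric])
  also have "\<dots> = (\<Sum>g\<in>G. \<Sum>k\<in>G. (cos (g (v + k u) \<bullet> x) + cos (g (v - k u) \<bullet> x)) / 2)"
  proof (intro sum.cong refl)
    fix g k assume "g \<in> G"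
    then have "linear g" using orthogonal_G orthogonal_transformation_linear by blast
    then show "cos (g v \<bullet> x) * cos ((g \<circ> k) u \<bullet> x) = (cos (g (v + k u) \<bullet> x) + cos (g (v - k u) \<bullet> x)) / 2"
      by (simp add: linear_add linear_diff inner_add_left inner_diff_left cos_times_cos)
  qed
  also have "\<dots> = (\<Sum>k\<in>G. (wave G (v + k u) x + wave G (v - k u) x) / 2)"
    by (subst sum.swap) (simp add: wave_def sum.distrib flip: sum_divide_distrib)
  finally show ?thesis .
qed

section \<open>The algebra of waves and its density\<close>

definition waves :: "('a \<Rightarrow> real) set" where
  "waves = function_space.span (wave G ` L)"

lemma waves_mult:
  assumes "f \<in> waves" "g \<in> waves"
  shows "(\<lambda>x. f x * g x) \<in> waves"
proof -
  have ww: "(\<lambda>x. wave G v x * wave G u x) \<in> waves" if "v \<in> L" "u \<in> L" for u v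
  proof -
    have "(\<lambda>x. wave G v x * wave G u x) =
        (\<Sum>k\<in>G. (\<lambda>x. (1/2) * (wave G (v + k u) + wave G (v - k u)) x))"
      by (simp add: fun_eq_iff wave_mult sum_fun_apply)
    also have "\<dots> \<in> waves"
      unfolding waves_def
      using that G_L add_L diff_L
      by (intro function_space.span_sum function_space.span_scale function_space.span_add function_space.span_base) auto
    finally show ?thesis .
  qed
  have fw: "(\<lambda>x. f x * wave G u x) \<in> waves" if "u \<in> L" for u
    using assms(1)[unfolded waves_def]
  proof (induction f rule: function_space.span_induct_alt)
    case base
    show ?case by (simp add: waves_def function_space.span_zero flip: zero_fun_def)
  next
    case (step c y z)
    obtain v where v: "y = wave G v" "v \<in> L" using step(1) by blast
    have "(\<lambda>x. c * (wave G v x * wave G u x)) + (\<lambda>x. z x * wave G u x) \<in> waves"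
      using ww[OF v(2) that] step(2) unfolding waves_def
      by (intro function_space.span_add function_space.span_scale)
    moreover have "(\<lambda>x. ((\<lambda>x. c * y x) + z) x * wave G u x) =
        (\<lambda>x. c * (wave G v x * wave G u x)) + (\<lambda>x. z x * wave G u x)"
      by (simp add: v fun_eq_iff algebra_simps)
    ultimately show ?case by simp
  qed
  show ?thesis
    using assms(2)[unfolded waves_def]
  proof (induction g rule: function_space.span_induct_alt)
    case base
    show ?case by (simp add: waves_def function_space.span_zero flip: zero_fun_def)
  next
    case (step c y z)
    obtain u where u: "y = wave G u" "u \<in> L" using step(1) by blast
    have "(\<lambda>x. c * (f x * wave G u x)) + (\<lambda>x. f x * z x) \<in> waves"
      using fw[OF u(2)] step(2) unfolding waves_def
      by (intro function_space.span_add function_space.span_scale)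
    moreover have "(\<lambda>x. f x * ((\<lambda>x. c * y x) + z) x) =
        (\<lambda>x. c * (f x * wave G u x)) + (\<lambda>x. f x * z x)"
      by (simp add: u fun_eq_iff algebra_simps)
    ultimately show ?case by simp
  qed
qed

lemma continuous_on_waves: "f \<in> waves \<Longrightarrow> continuous_on S f"
  unfolding waves_def
proof (induction f rule: function_space.span_induct_alt)
  case base
  show ?case by (simp add: zero_fun_def)
next
  case (step c y z)
  then show ?case by (auto simp: plus_fun_def intro!: continuous_intros continuous_on_wave)
qed

lemma wave_0: "wave G 0 x = real (card G)"
proof -
  have z: "g 0 = 0" if "g \<in> G" for g
    using orthogonal_G[OF that] by (simp add: orthogonal_transformation_linear linear_0)
  then have "wave G 0 x = (\<Sum>g\<in>G. 1)" unfolding wave_def by (intro sum.cong) (auto simp: z)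
  then show ?thesis by simp
qed

lemma wave_at_0: "wave G v 0 = real (card G)"
  by (simp add: wave_def)

lemma card_G: "0 < card G"
  using finite_G id_G by (auto simp: card_gt_0_iff)

text \<open>Stone-Weierstrass: products stay in the span by \<open>waves_mult\<close>, the constants
  come from the wave of the vector \<open>0\<close>, and separation of points is a locale
  assumption.\<close>

lemma waves_dense:
  assumes "continuous_on \<Omega> f" "0 < e"
  obtains s where "s \<in> waves" "\<And>x. x \<in> \<Omega> \<Longrightarrow> \<bar>f x - s x\<bar> < e"
proof -
  interpret function_ring_on waves \<Omega>
  proof
    show "compact \<Omega>" by (rule compact_\<Omega>)
    show "continuous_on \<Omega> f" if "f \<in> waves" for f using that by (rule continuous_on_waves)
    show "(\<lambda>x. f x + g x) \<in> waves" if "f \<in> waves" "g \<in> waves" for f g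
      using function_space.span_add[of f "wave G ` L" g] that by (simp add: waves_def plus_fun_def)
    show "(\<lambda>x. f x * g x) \<in> waves" if "f \<in> waves" "g \<in> waves" for f g
      using that by (rule waves_mult)
    show "(\<lambda>_. c) \<in> waves" for c
    proof -
      have "(\<lambda>x. (c / card G) * wave G 0 x) \<in> waves"
        unfolding waves_def using zero_L by (intro function_space.span_scale function_space.span_base) auto
      then show ?thesis using card_G by (simp add: wave_0)
    qed
    show "\<exists>f\<in>waves. f x \<noteq> f y" if "x \<in> \<Omega>" "y \<in> \<Omega>" "x \<noteq> y" for x y
      using waves_separate[OF that] unfolding waves_def by (blast intro: function_space.span_base)
  qed
  show thesis using Stone_Weierstrass_basic[OF assms] that by blast
qed

text \<open>Composition with the wall reflection \<open>r\<close> reverses normal components and, on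
  the wall, changes phases only by multiples of \<open>2 * pi\<close>. Hence the normal derivative
  equals its own negative.\<close>

lemma wave'_normal_on_wall:
  assumes v: "v \<in> L" and h: "h \<in> H" and x: "fst h \<bullet> x + snd h = 0"
  shows "wave' G v x \<bullet> fst h = 0"
proof -
  define a where "a = fst h"
  define r where "r w = w - (2 * (w \<bullet> a) / (a \<bullet> a)) *\<^sub>R a" for w
  have a: "a \<noteq> 0" using normal_nonzero[OF h] by (simp add: a_def)
  have r: "r \<in> G" using reflection_G[OF h] by (simp add: r_def[abs_def] a_def)
  have ra: "r w \<bullet> a = - (w \<bullet> a)" for w using a by (simp add: r_def inner_diff_left)
  \<comment> \<open>The affine reflection fixes \<open>x\<close>; its linear part therefore changes
    the phase by a translation term, and \<open>walls_L\<close> says that this term is a multiple of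
    \<open>2 * pi\<close>.\<close>
  have sinr: "sin (r w \<bullet> x) = sin (w \<bullet> x)" if w: "w \<in> L" for w
  proof -
    obtain k :: int where k: "(w \<bullet> a) * snd h / (a \<bullet> a) = pi * of_int k"
      using walls_L[OF w h] a_def by blast
    have "a \<bullet> x = - snd h" using x by (simp add: a_def)
    then have "r w \<bullet> x = w \<bullet> x + 2 * ((w \<bullet> a) * snd h / (a \<bullet> a))"
      by (simp add: r_def inner_diff_left)
    also have "\<dots> = w \<bullet> x + 2 * pi * of_int k" using k by simp
    finally show ?thesis by (simp only: sin_add sin_int_2pin cos_int_2pin)
  qed
  define S where "S = (\<Sum>g\<in>G. sin (g v \<bullet> x) * (g v \<bullet> a))"
  have "S = (\<Sum>g\<in>G. sin ((r \<circ> g) v \<bullet> x) * ((r \<circ> g) v \<bullet> a))"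
    unfolding S_def by (rule sum_G_reindex[OF r, symmetric])
  also have "\<dots> = (\<Sum>g\<in>G. - (sin (g v \<bullet> x) * (g v \<bullet> a)))"
    using sinr G_L v by (intro sum.cong) (auto simp: ra)
  also have "\<dots> = - S" by (simp add: S_def sum_negf)
  finally have "S = 0" by simp
  then show ?thesis by (simp add: wave'_def S_def a_def inner_sum_left)
qed

text \<open>The normal derivative vanishes at the foot of the perpendicular on the wall and is
  Lipschitz, so it is bounded by a multiple of the distance.\<close>

lemma wave'_tangential:
  assumes v: "v \<in> L" and h: "h \<in> H"
  shows "\<exists>C. \<forall>x\<in>U. \<bar>wave' G v x \<bullet> fst h\<bar> \<le> C * (fst h \<bullet> x + snd h)"
proof -
  define a where "a = fst h"
  have a: "a \<noteq> 0" using normal_nonzero[OF h] by (simp add: a_def)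
  define C where "C = (\<Sum>g\<in>G. \<bar>g v \<bullet> a\<bar> * \<bar>g v \<bullet> a\<bar> / (a \<bullet> a))"
  have "\<bar>wave' G v x \<bullet> a\<bar> \<le> C * (a \<bullet> x + snd h)" if x: "x \<in> U" for x
  proof -
    define l where "l = a \<bullet> x + snd h"
    have l: "0 < l" using x h by (auto simp: l_def a_def open_polytope_def)
    \<comment> \<open>The foot of the perpendicular may lie outside the polytope. This does no harm:
      waves live on the whole space and the normal derivative vanishes on the entire
      hyperplane.\<close>
    define y where "y = x - (l / (a \<bullet> a)) *\<^sub>R a"
    have "a \<bullet> y + snd h = 0" using a by (simp add: y_def l_def inner_diff_right)
    then have y0: "wave' G v y \<bullet> a = 0" using wave'_normal_on_wall[OF v h] by (simp add: a_def)
    have "wave' G v x \<bullet> a = wave' G v x \<bullet> a - wave' G v y \<bullet> a" by (simp add: y0)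
    also have "\<dots> = (\<Sum>g\<in>G. (sin (g v \<bullet> y) - sin (g v \<bullet> x)) * (g v \<bullet> a))"
      by (simp add: wave'_def inner_sum_left sum_subtractf algebra_simps)
    finally have "\<bar>wave' G v x \<bullet> a\<bar> \<le> (\<Sum>g\<in>G. \<bar>sin (g v \<bullet> y) - sin (g v \<bullet> x)\<bar> * \<bar>g v \<bullet> a\<bar>)"
      by (simp add: sum_abs flip: abs_mult)
    also have "\<dots> \<le> (\<Sum>g\<in>G. (\<bar>g v \<bullet> a\<bar> * l / (a \<bullet> a)) * \<bar>g v \<bullet> a\<bar>)"
    proof (intro sum_mono mult_right_mono)
      fix g
      have "\<bar>sin (g v \<bullet> y) - sin (g v \<bullet> x)\<bar> \<le> \<bar>g v \<bullet> y - g v \<bullet> x\<bar>"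
        by (rule abs_sin_diff_le)
      also have "g v \<bullet> y - g v \<bullet> x = - ((g v \<bullet> a) * l / (a \<bullet> a))"
        by (simp add: y_def inner_diff_right)
      also have "\<bar>\<dots>\<bar> = \<bar>g v \<bullet> a\<bar> * l / (a \<bullet> a)"
        using l by (simp add: abs_mult)
      finally show "\<bar>sin (g v \<bullet> y) - sin (g v \<bullet> x)\<bar> \<le> \<bar>g v \<bullet> a\<bar> * l / (a \<bullet> a)" .
    qed auto
    also have "\<dots> = C * l" by (simp add: C_def sum_distrib_left mult_ac)
    finally show ?thesis by (simp add: l_def)
  qed
  then show ?thesis unfolding a_def by blast
qed

text \<open>Integration by parts with the gradient of the wave as the field; its divergence is the
  Laplacian of the wave, where all plane waves have the same factor because \<open>G\<close>
  preserves norms.\<close>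

lemma wave_weak_equation:
  assumes v: "v \<in> L" and u: "sobolev_H1 U u Du"
  shows "(LINT x:U|lborel. wave' G v x \<bullet> Du x) = (v \<bullet> v) * (LINT x:U|lborel. wave G v x * u x)"
proof -
  define D2 where "D2 b x = - (\<Sum>g\<in>G. (cos (g v \<bullet> x) * (g v \<bullet> b)) *\<^sub>R g v)" for b x
  have div: "(\<Sum>b\<in>Basis. D2 b x \<bullet> b) = - (v \<bullet> v) * wave G v x" for x
  proof -
    have "(\<Sum>b\<in>Basis. D2 b x \<bullet> b) = - (\<Sum>b\<in>Basis. \<Sum>g\<in>G. cos (g v \<bullet> x) * ((g v \<bullet> b) * (g v \<bullet> b)))"
      by (simp add: D2_def inner_sum_left sum_negf mult.assoc)
    also have "\<dots> = - (\<Sum>g\<in>G. cos (g v \<bullet> x) * (g v \<bullet> g v))"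
      by (subst sum.swap) (simp add: euclidean_inner[of "g v" "g v" for g] flip: sum_distrib_left)
    also have "\<dots> = - (v \<bullet> v) * wave G v x"
      using orthogonal_G by (simp add: orthogonal_transformation_def wave_def mult.commute sum_distrib_left)
    finally show ?thesis .
  qed
  have "GDERIV (\<lambda>x. wave' G v x \<bullet> b) x :> D2 b x" for b x
  proof -
    have "GDERIV (\<lambda>x. - (sin (w \<bullet> x) * (w \<bullet> b))) x :> - ((cos (w \<bullet> x) * (w \<bullet> b)) *\<^sub>R w)" for w
      unfolding scaleR_minus_left[symmetric]
      by (rule GDERIV_DERIV_compose[OF GDERIV_inner_left]) (auto intro!: derivative_eq_intros)
    then have "GDERIV (\<lambda>x. \<Sum>g\<in>G. - (sin (g v \<bullet> x) * (g v \<bullet> b))) x :>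
        (\<Sum>g\<in>G. - ((cos (g v \<bullet> x) * (g v \<bullet> b)) *\<^sub>R g v))"
      by (intro GDERIV_sum)
    then show ?thesis
      by (simp add: wave'_def D2_def inner_sum_left sum_negf)
  qed
  moreover have "continuous_on UNIV (D2 b)" for b
    unfolding D2_def[abs_def] by (intro continuous_intros)
  ultimately have "(LINT x:U|lborel. wave' G v x \<bullet> Du x) = - (LINT x:U|lborel. u x * (\<Sum>b\<in>Basis. D2 b x \<bullet> b))"
    using finite_H bounded_U wave'_tangential[OF v] u by (intro neumann_integration_by_parts) auto
  also have "\<dots> = - (LINT x:U|lborel. - (v \<bullet> v) * (wave G v x * u x))"
    unfolding div by (simp add: mult_ac)
  also have "\<dots> = - (- (v \<bullet> v) * (LINT x:U|lborel. wave G v x * u x))"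
    by (simp only: set_integral_mult_right)
  finally show ?thesis by simp
qed

text \<open>These are functions on the whole space, where analyticity and composition with the fold
  map are available. The weak eigenspaces are their images under \<open>restr\<close>.\<close>

definition eigenwaves :: "real \<Rightarrow> ('a \<Rightarrow> real) set" where
  "eigenwaves \<nu> = function_space.span (wave G ` {v \<in> L. v \<bullet> v = \<nu>})"

text \<open>One induction carries analyticity along lines, the gradient and the weak equation
  together, because the equation speaks of that very gradient. The next lemma exports the parts in
  terms of \<open>grad\<close>.\<close>

lemma eigenwaves_weak:
  assumes "\<Psi> \<in> eigenwaves \<nu>"
  shows "entire_on_lines \<Psi> \<and> (\<exists>D. (\<forall>x. GDERIV \<Psi> x :> D x) \<and> continuous_on UNIV D \<and>
    (\<forall>u Du. sobolev_H1 U u Du \<longrightarrow> (LINT x|M. D x \<bullet> Du x) = \<nu> * (LINT x|M. \<Psi> x * u x)))"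
  using assms unfolding eigenwaves_def
proof (induction \<Psi> rule: function_space.span_induct_alt)
  case base
  show ?case
    by (auto simp: zero_fun_def intro!: entire_on_lines_zero exI[of _ "\<lambda>_. 0"] GDERIV_const)
next
  case (step c y z)
  obtain v where v: "y = wave G v" "v \<in> L" "v \<bullet> v = \<nu>" using step(1) by blast
  obtain D where D: "\<And>x. GDERIV z x :> D x" "continuous_on UNIV D" "entire_on_lines z"
    "\<And>u Du. sobolev_H1 U u Du \<Longrightarrow> (LINT x|M. D x \<bullet> Du x) = \<nu> * (LINT x|M. z x * u x)"
    using step by blast
  have cz: "continuous_on UNIV z" using D(1) by (rule GDERIV_continuous_on)
  let ?D = "\<lambda>x. c *\<^sub>R wave' G v x + D x"
  have "GDERIV (\<lambda>x. c * y x + z x) x :> ?D x" for x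
    using GDERIV_add[OF GDERIV_mult[OF GDERIV_const GDERIV_wave] D(1), of c G v x] by (simp add: v(1))
  moreover have "continuous_on UNIV ?D"
    by (intro continuous_intros continuous_on_wave' D)
  moreover have "(LINT x|M. ?D x \<bullet> Du x) = \<nu> * (LINT x|M. (c * y x + z x) * u x)"
    if u: "sobolev_H1 U u Du" for u Du
  proof -
    have L2: "L2_on M u" "L2_on M Du" using u by (auto simp: sobolev_H1_def square_integrable_iff)
    have L2c: "L2_on M f" if "continuous_on UNIV f" for f :: "'a \<Rightarrow> 'b::euclidean_space"
      using that bounded_U sets_U by (rule L2_on_continuous)
    have "(LINT x|M. ?D x \<bullet> Du x) = (LINT x|M. c * (wave' G v x \<bullet> Du x) + D x \<bullet> Du x)"
      by (simp add: inner_add_left)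
    also have "\<dots> = (LINT x|M. c * (wave' G v x \<bullet> Du x)) + (LINT x|M. D x \<bullet> Du x)"
      by (intro Bochner_Integration.integral_add integrable_mult_right L2_on_inner L2 L2c continuous_on_wave' D)
    also have "\<dots> = \<nu> * (c * (LINT x|M. wave G v x * u x) + (LINT x|M. z x * u x))"
      using wave_weak_equation[OF v(2) u] D(4)[OF u] by (simp add: lint_eq v(3) algebra_simps)
    also have "c * (LINT x|M. wave G v x * u x) + (LINT x|M. z x * u x) =
        (LINT x|M. c * (wave G v x * u x) + z x * u x)"
      by (subst Bochner_Integration.integral_add)
        (auto intro!: integrable_mult_right L2_on_mult L2 L2c continuous_on_wave cz)
    finally show ?thesis by (simp add: v(1) algebra_simps)
  qed
  ultimately show ?case
    using entire_on_lines_add[OF entire_on_lines_cmult[OF entire_on_lines_wave] D(3)]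
    by (auto simp: v(1) plus_fun_def intro!: exI[of _ ?D])
qed

lemma
  assumes "\<Psi> \<in> eigenwaves \<nu>"
  shows eigenwaves_entire: "entire_on_lines \<Psi>"
    and eigenwaves_GDERIV: "GDERIV \<Psi> x :> grad \<Psi> x"
    and eigenwaves_continuous_grad: "continuous_on UNIV (grad \<Psi>)"
    and eigenwaves_equation: "sobolev_H1 U u Du \<Longrightarrow>
      (LINT x|M. grad \<Psi> x \<bullet> Du x) = \<nu> * (LINT x|M. \<Psi> x * u x)"
    and eigenwaves_continuous: "continuous_on UNIV \<Psi>"
proof -
  obtain D where D: "\<And>x. GDERIV \<Psi> x :> D x" "continuous_on UNIV D" "entire_on_lines \<Psi>"
    "\<And>u Du. sobolev_H1 U u Du \<Longrightarrow> (LINT x|M. D x \<bullet> Du x) = \<nu> * (LINT x|M. \<Psi> x * u x)"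
    using eigenwaves_weak[OF assms] by blast
  have grad: "grad \<Psi> = D" using D(1) by (rule grad_eq)
  show "entire_on_lines \<Psi>" "GDERIV \<Psi> x :> grad \<Psi> x" "continuous_on UNIV (grad \<Psi>)"
    "sobolev_H1 U u Du \<Longrightarrow> (LINT x|M. grad \<Psi> x \<bullet> Du x) = \<nu> * (LINT x|M. \<Psi> x * u x)"
    using D by (auto simp: grad)
  show "continuous_on UNIV \<Psi>" using D(1) by (rule GDERIV_continuous_on)
qed

lemma L2_on_M_continuous: "continuous_on UNIV f \<Longrightarrow> L2_on M (f :: 'a \<Rightarrow> 'b::euclidean_space)"
  using bounded_U sets_U by (rule L2_on_continuous[rotated 1])

lemma wave_eigenwave: "v \<in> L \<Longrightarrow> wave G v \<in> eigenwaves (v \<bullet> v)"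
  unfolding eigenwaves_def by (intro function_space.span_base) auto

lemma eigenwaves_null:
  assumes "\<Psi> \<in> eigenwaves \<nu>" "\<Psi> \<noteq> 0"
  shows "{x. \<Psi> x = 0} \<in> null_sets lborel"
proof -
  obtain p where "\<Psi> p \<noteq> 0" using assms(2) by (auto simp: fun_eq_iff)
  then show ?thesis
    using eigenwaves_entire[OF assms(1)] eigenwaves_continuous[OF assms(1)]
    by (intro entire_on_lines_zeros_null)
qed

text \<open>The zero set of a nonzero eigenwave is null, whereas a nonempty open set is not.\<close>

lemma eigenwaves_unique_continuation:
  assumes "\<Psi> \<in> eigenwaves \<nu>" "open C" "C \<noteq> {}" "\<And>x. x \<in> C \<Longrightarrow> \<Psi> x = 0"
  shows "\<Psi> = 0"
proof (rule ccontr)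
  assume "\<Psi> \<noteq> 0"
  then have "{x. \<Psi> x = 0} \<in> null_sets lborel" by (rule eigenwaves_null[OF assms(1)])
  then have "C \<in> null_sets lborel"
    using assms(2,4) by (intro null_sets_subset[of _ lborel C]) auto
  then have "negligible C"
    by (simp add: negligible_iff_null_sets null_sets_completionI)
  then show False using open_not_negligible[OF assms(2,3)] by simp
qed

text \<open>The zero eigenwave is treated separately, since its zero set is not null.\<close>

lemma sobolev_H1_eigenwave:
  assumes "\<Psi> \<in> eigenwaves \<nu>" "open C" "C \<subseteq> U"
    "\<And>x. x \<in> U \<Longrightarrow> x \<in> closure C \<Longrightarrow> x \<notin> C \<Longrightarrow> \<Psi> x = 0"
  shows "sobolev_H1 U (\<lambda>x. if x \<in> C then \<Psi> x else 0) (\<lambda>x. if x \<in> C then grad \<Psi> x else 0)"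
proof (cases "\<Psi> = 0")
  case True
  have "grad \<Psi> = (\<lambda>_. 0)" by (rule grad_eq) (simp add: True zero_fun_def GDERIV_const)
  then have "(\<lambda>x. if x \<in> C then \<Psi> x else 0) = (\<lambda>_. 0)" "(\<lambda>x. if x \<in> C then grad \<Psi> x else 0) = (\<lambda>_. 0)"
    by (auto simp: True)
  then show ?thesis
    using sobolev_H1_sum[of "{}" U] bounded_U sets_U by simp
next
  case False
  show ?thesis
    using open_U bounded_U assms eigenwaves_GDERIV[OF assms(1)] eigenwaves_continuous_grad[OF assms(1)]
      eigenwaves_null[OF assms(1) False]
    by (intro sobolev_H1_piecewise) auto
qed

lemma sobolev_H1_cong:
  assumes "sobolev_H1 U u Du" "\<And>x. x \<in> U \<Longrightarrow> u x = w x" "\<And>x. x \<in> U \<Longrightarrow> Du x = Dw x"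
  shows "sobolev_H1 U w Dw"
proof -
  have "indicator U x *\<^sub>R u x = indicator U x *\<^sub>R w x" "indicator U x *\<^sub>R Du x = indicator U x *\<^sub>R Dw x"
    "indicator U x *\<^sub>R (norm (u x))\<^sup>2 = indicator U x *\<^sub>R (norm (w x))\<^sup>2"
    "indicator U x *\<^sub>R (norm (Du x))\<^sup>2 = indicator U x *\<^sub>R (norm (Dw x))\<^sup>2"
    "indicator U x *\<^sub>R u x *\<^sub>R (D\<psi> x :: 'a) = indicator U x *\<^sub>R w x *\<^sub>R D\<psi> x"
    "indicator U x *\<^sub>R \<psi> x *\<^sub>R Du x = indicator U x *\<^sub>R \<psi> x *\<^sub>R Dw x" for x \<psi> D\<psi>
    using assms(2,3) by (auto simp: indicator_def)
  then show ?thesis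
    using assms(1)
    unfolding sobolev_H1_def square_integrable_on_def set_borel_measurable_def set_integrable_def
      set_lebesgue_integral_def
    by (simp only:) blast
qed

lemma sobolev_H1_eigenwave_global:
  assumes "\<Psi> \<in> eigenwaves \<nu>"
  shows "sobolev_H1 U \<Psi> (grad \<Psi>)"
  by (rule sobolev_H1_cong[OF sobolev_H1_eigenwave[OF assms open_U order.refl]]) auto

lemma sobolev_H1_L2: "sobolev_H1 U u Du \<Longrightarrow> L2_on M u" "sobolev_H1 U u Du \<Longrightarrow> L2_on M Du"
  by (auto simp: sobolev_H1_def square_integrable_iff)

section \<open>Weak eigenspaces are spanned by waves\<close>

lemma integral_M_cong: "(\<And>x. x \<in> U \<Longrightarrow> f x = g x) \<Longrightarrow> (LINT x|M. f x) = (LINT x|M. g x)"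
  by (intro Bochner_Integration.integral_cong) (auto simp: space_M)

definition restr :: "('a \<Rightarrow> real) \<Rightarrow> 'a \<Rightarrow> real" where
  "restr \<Psi> x = (if x \<in> U then \<Psi> x else 0)"

lemma restr_eigenwave:
  assumes \<Psi>: "\<Psi> \<in> eigenwaves \<nu>"
  shows "restr \<Psi> \<in> neumann_eigenspace \<Omega> \<nu>"
proof -
  let ?D = "\<lambda>x. if x \<in> U then grad \<Psi> x else 0"
  have "sobolev_H1 U (restr \<Psi>) ?D"
    by (rule sobolev_H1_cong[OF sobolev_H1_eigenwave_global[OF \<Psi>]]) (auto simp: restr_def)
  moreover have "(LINT x:U|lborel. ?D x \<bullet> Dv x) = \<nu> * (LINT x:U|lborel. restr \<Psi> x * v x)"
    if v: "sobolev_H1 U v Dv" for v Dv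
  proof -
    have "(LINT x|M. ?D x \<bullet> Dv x) = (LINT x|M. grad \<Psi> x \<bullet> Dv x)"
      "(LINT x|M. restr \<Psi> x * v x) = (LINT x|M. \<Psi> x * v x)"
      by (auto intro!: integral_M_cong simp: restr_def)
    then show ?thesis using eigenwaves_equation[OF \<Psi> v] by (simp add: lint_eq)
  qed
  moreover have "continuous_on U (restr \<Psi>)"
    using continuous_on_subset[OF eigenwaves_continuous[OF \<Psi>] subset_UNIV, of U]
    by (rule continuous_on_eq) (simp add: restr_def)
  ultimately show ?thesis
    unfolding neumann_eigenspace_def interior_\<Omega> by (auto simp: restr_def)
qed

text \<open>Completeness of the waves. Uniform approximation extends the orthogonality to every
  continuous function, and \<open>g\<close> is then tested with itself times a tent function around
  \<open>x0\<close>.\<close>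

lemma orthogonal_waves_eq_0:
  assumes g: "L2_on M g" "continuous_on U g" and orth: "\<And>v. v \<in> L \<Longrightarrow> (LINT x|M. g x * wave G v x) = 0"
    and x0: "x0 \<in> U"
  shows "g x0 = 0"
proof -
  have wL2: "L2_on M s" if "s \<in> waves" for s
    using continuous_on_waves[OF that] by (rule L2_on_M_continuous)
  have orth': "(LINT x|M. g x * s x) = 0" if "s \<in> waves" for s
  proof -
    have "L2_on M s \<and> (LINT x|M. g x * s x) = 0"
      using that unfolding waves_def
    proof (induction s rule: function_space.span_induct_alt)
      case base
      show ?case by (simp add: zero_fun_def L2_on_zero)
    next
      case (step c y z)
      have y: "L2_on M y" "(LINT x|M. g x * y x) = 0"
        using step(1) orth by (auto intro: L2_on_M_continuous continuous_on_wave)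
      have "(LINT x|M. c * (g x * y x) + g x * z x) = 0"
        using step y g(1)
        by (subst Bochner_Integration.integral_add) (auto intro!: integrable_mult_right L2_on_mult)
      moreover have "L2_on M (\<lambda>x. c * y x + z x)"
        using L2_on_add[OF L2_on_cmult[OF y(1), of c]] step by simp
      ultimately show ?case by (simp add: algebra_simps plus_fun_def)
    qed
    then show ?thesis by simp
  qed
  have orth_cont: "(LINT x|M. g x * f x) = 0" if f: "continuous_on UNIV f" for f
  proof (rule ccontr)
    assume nz: "(LINT x|M. g x * f x) \<noteq> 0"
    define I where "I = (LINT x|M. \<bar>g x\<bar>)"
    have one: "L2_on M (\<lambda>_. 1 :: real)" by (rule L2_on_M_continuous) simp
    have intg: "integrable M (\<lambda>x. \<bar>g x\<bar>)" using L2_on_mult[OF g(1) one] by simp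
    have "0 \<le> I" unfolding I_def by simp
    \<comment> \<open>Chosen so that the approximation error, at most \<open>I * e\<close>, stays
      below the integral that is assumed nonzero; the summand \<open>1\<close> covers
      \<open>I = 0\<close>.\<close>
    define e where "e = \<bar>LINT x|M. g x * f x\<bar> / (I + 1)"
    have "0 < e" using nz \<open>0 \<le> I\<close> by (simp add: e_def)
    obtain s where s: "s \<in> waves" "\<And>x. x \<in> \<Omega> \<Longrightarrow> \<bar>f x - s x\<bar> < e"
      using waves_dense[OF continuous_on_subset[OF f subset_UNIV] \<open>0 < e\<close>] by metis
    have fL2: "L2_on M f" using f by (rule L2_on_M_continuous)
    have "(LINT x|M. g x * f x) = (LINT x|M. g x * f x) - (LINT x|M. g x * s x)"
      using orth'[OF s(1)] by simp
    also have "\<dots> = (LINT x|M. g x * f x - g x * s x)"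
      using g(1) fL2 wL2[OF s(1)] by (intro Bochner_Integration.integral_diff[symmetric] L2_on_mult)
    finally have "\<bar>LINT x|M. g x * f x\<bar> \<le> (LINT x|M. \<bar>g x * f x - g x * s x\<bar>)"
      using integral_abs_bound by simp
    also have "\<dots> \<le> (LINT x|M. \<bar>g x\<bar> * e)"
    proof (rule integral_mono)
      show "integrable M (\<lambda>x. \<bar>g x * f x - g x * s x\<bar>)"
        using g(1) fL2 wL2[OF s(1)] by (intro integrable_abs Bochner_Integration.integrable_diff L2_on_mult)
      show "integrable M (\<lambda>x. \<bar>g x\<bar> * e)" using intg by simp
      fix x assume "x \<in> space M"
      then have "\<bar>f x - s x\<bar> < e" using U_subset by (intro s(2)) (auto simp: space_M)
      then show "\<bar>g x * f x - g x * s x\<bar> \<le> \<bar>g x\<bar> * e"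
        by (simp add: abs_mult mult_left_mono flip: right_diff_distrib)
    qed
    also have "\<dots> = I * e" using intg by (simp add: I_def)
    also have "\<dots> < (I + 1) * e" using \<open>0 < e\<close> by simp
    also have "\<dots> = \<bar>LINT x|M. g x * f x\<bar>" using \<open>0 \<le> I\<close> by (simp add: e_def)
    finally show False by simp
  qed
  obtain r where r: "0 < r" "cball x0 r \<subseteq> U"
    using open_U x0 by (meson open_contains_cball)
  \<comment> \<open>The tent vanishes outside a closed ball inside \<open>U\<close>, so its product
    with \<open>g\<close>, which is continuous only on \<open>U\<close>, extends continuously by
    zero.\<close>
  define c where "c x = max 0 (r - dist x x0)" for x
  have cc: "continuous_on UNIV c" unfolding c_def[abs_def] by (intro continuous_intros)
  define f where "f x = (if x \<in> U then g x * c x else 0)" for x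
  have "continuous_on UNIV f"
  proof -
    have "continuous_on (U \<union> - cball x0 r) f"
    proof (rule continuous_on_open_Un)
      have "continuous_on U (\<lambda>x. g x * c x)"
        using g(2) continuous_on_subset[OF cc] by (intro continuous_intros) auto
      then show "continuous_on U f" by (rule continuous_on_eq) (simp add: f_def)
      have "continuous_on (- cball x0 r) (\<lambda>_. 0 :: real)" by simp
      then show "continuous_on (- cball x0 r) f"
        by (rule continuous_on_eq) (auto simp: f_def c_def dist_commute)
    qed (use open_U in auto)
    moreover have "U \<union> - cball x0 r = UNIV" using r by auto
    ultimately show ?thesis by simp
  qed
  then have "(LINT x|M. g x * f x) = 0" by (rule orth_cont)
  moreover have "integrable M (\<lambda>x. g x * f x)"
    using \<open>continuous_on UNIV f\<close> by (intro L2_on_mult g L2_on_M_continuous)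
  moreover have "0 \<le> g x * f x" for x by (auto simp: f_def c_def mult.assoc[symmetric])
  ultimately have "AE x in M. g x * f x = 0"
    by (subst (asm) integral_nonneg_eq_0_iff_AE) auto
  then have ae: "AE x in lborel. x \<in> U \<longrightarrow> g x * f x = 0"
    by (subst (asm) AE_restrict_space_iff) (use open_U in auto)
  show ?thesis
  proof (rule ccontr)
    assume "g x0 \<noteq> 0"
    have "open {x \<in> U. g x \<noteq> 0}"
      using continuous_open_preimage[OF g(2) open_U, of "- {0}"] by (simp add: vimage_def Int_def open_Compl)
    then have "open ({x \<in> U. g x \<noteq> 0} \<inter> ball x0 r)" by auto
    moreover have "x0 \<in> {x \<in> U. g x \<noteq> 0} \<inter> ball x0 r" using x0 r \<open>g x0 \<noteq> 0\<close> by simp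
    ultimately have "\<not> negligible ({x \<in> U. g x \<noteq> 0} \<inter> ball x0 r)"
      using open_not_negligible by blast
    moreover have "AE x in lborel. x \<notin> {x \<in> U. g x \<noteq> 0} \<inter> ball x0 r"
      using ae by eventually_elim (auto simp: f_def c_def max_def dist_commute)
    then have "{x \<in> U. g x \<noteq> 0} \<inter> ball x0 r \<in> null_sets lborel"
      using \<open>open ({x \<in> U. g x \<noteq> 0} \<inter> ball x0 r)\<close> by (subst (asm) AE_iff_null_sets[symmetric]) auto
    then have "negligible ({x \<in> U. g x \<noteq> 0} \<inter> ball x0 r)"
      by (simp add: negligible_iff_null_sets null_sets_completionI)
    ultimately show False by simp
  qed
qed

text \<open>The Dirichlet form of two waves is evaluated with the weak equation of either one; its
  symmetry forces the integral to vanish when the norms differ.\<close>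

lemma waves_orthogonal:
  assumes "v \<in> L" "w \<in> L" "v \<bullet> v \<noteq> w \<bullet> w"
  shows "(LINT x|M. wave G v x * wave G w x) = 0"
proof -
  let ?I = "LINT x|M. wave G v x * wave G w x"
  have "(LINT x|M. grad (wave G v) x \<bullet> grad (wave G w) x) = (v \<bullet> v) * ?I"
    by (rule eigenwaves_equation[OF wave_eigenwave[OF assms(1)]
          sobolev_H1_eigenwave_global[OF wave_eigenwave[OF assms(2)]]])
  moreover have "(LINT x|M. grad (wave G w) x \<bullet> grad (wave G v) x) = (w \<bullet> w) * (LINT x|M. wave G w x * wave G v x)"
    by (rule eigenwaves_equation[OF wave_eigenwave[OF assms(2)]
          sobolev_H1_eigenwave_global[OF wave_eigenwave[OF assms(1)]]])
  ultimately have "(v \<bullet> v) * ?I = (w \<bullet> w) * ?I" by (simp add: inner_commute mult.commute)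
  with assms(3) show ?thesis by simp
qed

lemma finite_eigenlattice: "finite {v \<in> L. v \<bullet> v = \<nu>}"
  by (rule finite_subset[OF _ discrete_L[of \<nu>]]) auto

text \<open>The projection of an eigenfunction to the waves of the same eigenvalue leaves a
  remainder orthogonal to these waves, and to all others by symmetry of the form. By completeness
  the remainder is zero.\<close>

lemma neumann_eigenspace_eq: "neumann_eigenspace \<Omega> \<nu> = restr ` eigenwaves \<nu>"
proof (intro equalityI subsetI)
  fix \<phi> assume "\<phi> \<in> neumann_eigenspace \<Omega> \<nu>"
  then obtain D\<phi> where \<phi>: "continuous_on U \<phi>" "\<And>x. x \<notin> U \<Longrightarrow> \<phi> x = 0" "sobolev_H1 U \<phi> D\<phi>"
    "\<And>v Dv. sobolev_H1 U v Dv \<Longrightarrow> (LINT x|M. D\<phi> x \<bullet> Dv x) = \<nu> * (LINT x|M. \<phi> x * v x)"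
    unfolding neumann_eigenspace_def interior_\<Omega> lint_eq by blast
  have L2\<phi>: "L2_on M \<phi>" using \<phi>(3) by (rule sobolev_H1_L2)
  have L2w: "L2_on M (wave G v)" for v by (intro L2_on_M_continuous continuous_on_wave)
  obtain w where w: "w \<in> eigenwaves \<nu>"
    "\<And>v. v \<in> L \<Longrightarrow> v \<bullet> v = \<nu> \<Longrightarrow> (LINT x|M. (\<phi> x - w x) * wave G v x) = 0"
    using orthogonal_projection_span[of "wave G ` {v \<in> L. v \<bullet> v = \<nu>}" M \<phi>] finite_eigenlattice L2w L2\<phi>
    unfolding eigenwaves_def by auto
  have L2w': "L2_on M w" using eigenwaves_continuous[OF w(1)] by (rule L2_on_M_continuous)
  have "(LINT x|M. (\<phi> x - w x) * wave G v x) = 0" if v: "v \<in> L" for v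
  proof (cases "v \<bullet> v = \<nu>")
    case False
    have H1: "sobolev_H1 U (wave G v) (grad (wave G v))"
      using wave_eigenwave[OF v] by (rule sobolev_H1_eigenwave_global)
    \<comment> \<open>Stated for a general weak solution because it is applied both to the
      eigenfunction and to its projection.\<close>
    have *: "(LINT x|M. f x * wave G v x) = 0"
      if "sobolev_H1 U f Df"
        "\<And>u Du. sobolev_H1 U u Du \<Longrightarrow> (LINT x|M. Df x \<bullet> Du x) = \<nu> * (LINT x|M. f x * u x)" for f Df
    proof -
      have "\<nu> * (LINT x|M. f x * wave G v x) = (LINT x|M. Df x \<bullet> grad (wave G v) x)"
        using that(2)[OF H1] by simp
      also have "\<dots> = (LINT x|M. grad (wave G v) x \<bullet> Df x)" by (simp add: inner_commute)
      also have "\<dots> = (v \<bullet> v) * (LINT x|M. wave G v x * f x)"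
        using eigenwaves_equation[OF wave_eigenwave[OF v] that(1)] .
      finally show ?thesis using False by (simp add: mult.commute)
    qed
    have "(LINT x|M. (\<phi> x - w x) * wave G v x) = (LINT x|M. \<phi> x * wave G v x - w x * wave G v x)"
      by (simp add: algebra_simps)
    also have "\<dots> = (LINT x|M. \<phi> x * wave G v x) - (LINT x|M. w x * wave G v x)"
      by (intro Bochner_Integration.integral_diff L2_on_mult L2\<phi> L2w L2w')
    also have "\<dots> = 0"
      using *[OF \<phi>(3,4)] *[OF sobolev_H1_eigenwave_global[OF w(1)] eigenwaves_equation[OF w(1)]] by simp
    finally show ?thesis .
  qed (use w v in auto)
  moreover have "L2_on M (\<lambda>x. \<phi> x - w x)"
    using L2_on_add[OF L2\<phi> L2_on_cmult[OF L2w', of "-1"]] by simp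
  moreover have "continuous_on U (\<lambda>x. \<phi> x - w x)"
    using \<phi>(1) continuous_on_subset[OF eigenwaves_continuous[OF w(1)]] by (intro continuous_intros) auto
  ultimately have "\<phi> x - w x = 0" if "x \<in> U" for x
    using that by (intro orthogonal_waves_eq_0[of "\<lambda>x. \<phi> x - w x"]) auto
  then have "\<phi> = restr w" using \<phi>(2) by (auto simp: fun_eq_iff restr_def)
  then show "\<phi> \<in> restr ` eigenwaves \<nu>" using w(1) by blast
qed (auto intro: restr_eigenwave)

end

section \<open>Counting eigenvalues\<close>

text \<open>Gaussian elimination: \<open>F\<close> indexes the equations and \<open>T\<close> the
  unknowns. The first equation is solved for a pivot \<open>t0\<close> and substituted into the
  others.\<close>

lemma homogeneous_system_nontrivial_solution:
  fixes A :: "'f \<Rightarrow> 't \<Rightarrow> real"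
  assumes "finite F" "finite T" "card F < card T"
  shows "\<exists>c. (\<exists>t\<in>T. c t \<noteq> 0) \<and> (\<forall>f\<in>F. (\<Sum>t\<in>T. c t * A f t) = 0)"
  using assms
proof (induction F arbitrary: T A rule: finite_induct)
  case empty
  then obtain t where "t \<in> T" by fastforce
  then show ?case by (intro exI[of _ "\<lambda>_. 1"]) auto
next
  case (insert f F)
  show ?case
  proof (cases "\<forall>t\<in>T. A f t = 0")
    case True
    have "card F < card T" using insert by simp
    with insert.IH[OF insert.prems(1), of A] obtain c
      where "\<exists>t\<in>T. c t \<noteq> 0" "\<forall>g\<in>F. (\<Sum>t\<in>T. c t * A g t) = 0" by blast
    with True show ?thesis by (intro exI[of _ c]) auto
  next
    case False
    then obtain t0 where t0: "t0 \<in> T" "A f t0 \<noteq> 0" by blast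
    define T' where "T' = T - {t0}"
    have T: "T = insert t0 T'" "t0 \<notin> T'" "finite T'" using t0 insert.prems by (auto simp: T'_def)
    have "card F < card T'" using insert T by simp
    from insert.IH[OF T(3) this, of "\<lambda>g t. A g t - A g t0 * (A f t / A f t0)"] obtain c
      where c: "\<exists>t\<in>T'. c t \<noteq> 0"
        "\<forall>g\<in>F. (\<Sum>t\<in>T'. c t * (A g t - A g t0 * (A f t / A f t0))) = 0" by blast
    \<comment> \<open>Back substitution: the value of the pivot variable that the equation
      \<open>f\<close> dictates.\<close>
    define s where "s = - (\<Sum>t\<in>T'. c t * (A f t / A f t0))"
    define d where "d t = (if t = t0 then s else c t)" for t
    have sum: "(\<Sum>t\<in>T. d t * B t) = s * B t0 + (\<Sum>t\<in>T'. c t * B t)" for B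
    proof -
      have "(\<Sum>t\<in>T'. d t * B t) = (\<Sum>t\<in>T'. c t * B t)"
        using T(2) by (intro sum.cong) (auto simp: d_def)
      with T show ?thesis by (simp add: d_def)
    qed
    have "(\<Sum>t\<in>T. d t * A g t) = (\<Sum>t\<in>T'. c t * (A g t - A g t0 * (A f t / A f t0)))" for g
      unfolding sum s_def
      by (simp add: algebra_simps sum_subtractf sum_distrib_left)
    moreover have "(\<Sum>t\<in>T'. c t * (A f t - A f t0 * (A f t / A f t0))) = 0"
      using t0(2) by simp
    moreover have "\<exists>t\<in>T. d t \<noteq> 0" using c(1) T by (auto simp: d_def)
    ultimately show ?thesis using c(2) by (intro exI[of _ d]) auto
  qed
qed

section \<open>Finite linear combinations in \<open>L^2\<close>\<close>

lemma L2_integral_sum_mult: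
  assumes "\<And>i. i \<in> I \<Longrightarrow> L2_on M (f i)" "L2_on M g"
  shows "(LINT x|M. (\<Sum>i\<in>I. a i * f i x) * g x) = (\<Sum>i\<in>I. a i * (LINT x|M. f i x * g x :: real))"
proof -
  have "(LINT x|M. (\<Sum>i\<in>I. a i * f i x) * g x) = (LINT x|M. (\<Sum>i\<in>I. a i * (f i x * g x)))"
    by (simp add: sum_distrib_right mult.assoc)
  also have "\<dots> = (\<Sum>i\<in>I. (LINT x|M. a i * (f i x * g x)))"
    using assms by (intro Bochner_Integration.integral_sum integrable_mult_right L2_on_mult)
  finally show ?thesis by simp
qed

lemma L2_integral_sum_inner:
  assumes "\<And>i. i \<in> I \<Longrightarrow> L2_on M (f i)" "L2_on M g"
  shows "(LINT x|M. (\<Sum>i\<in>I. a i *\<^sub>R f i x) \<bullet> g x) = (\<Sum>i\<in>I. a i * (LINT x|M. f i x \<bullet> g x))"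
proof -
  have "(LINT x|M. (\<Sum>i\<in>I. a i *\<^sub>R f i x) \<bullet> g x) = (LINT x|M. (\<Sum>i\<in>I. a i * (f i x \<bullet> g x)))"
    by (simp add: inner_sum_left)
  also have "\<dots> = (\<Sum>i\<in>I. (LINT x|M. a i * (f i x \<bullet> g x)))"
    using assms by (intro Bochner_Integration.integral_sum integrable_mult_right L2_on_inner)
  finally show ?thesis by simp
qed

lemma L2_on_diff: "L2_on M f \<Longrightarrow> L2_on M g \<Longrightarrow> L2_on M (\<lambda>x. f x - g x)"
  using L2_on_add[of M f "\<lambda>x. -1 *\<^sub>R g x"] L2_on_cmult[of M g "-1"] by simp

lemma L2_integral_diff_mult:
  assumes "L2_on M f" "L2_on M g" "L2_on M h"
  shows "(LINT x|M. (f x - g x) * h x) = (LINT x|M. f x * h x) - (LINT x|M. g x * h x :: real)"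
  unfolding left_diff_distrib
  using assms by (intro Bochner_Integration.integral_diff L2_on_mult)

lemma span_finite_image_coefficients:
  assumes "finite J" "p \<in> function_space.span (f ` J)"
  obtains d where "p = (\<lambda>x. \<Sum>v\<in>J. d v * f v x)"
proof -
  have "\<exists>d. p = (\<lambda>x. \<Sum>v\<in>J. d v * f v x)"
    using assms(2)
  proof (induction p rule: function_space.span_induct_alt)
    case base
    show ?case by (intro exI[of _ "\<lambda>_. 0"]) (simp add: zero_fun_def)
  next
    case (step c y z)
    obtain w where w: "w \<in> J" "y = f w" using step(1) by blast
    obtain d where d: "z = (\<lambda>x. \<Sum>v\<in>J. d v * f v x)" using step(2) by blast
    have "c * f w x = (\<Sum>v\<in>J. (if v = w then c else 0) * f v x)" for x
      using w(1) assms(1) by (simp add: if_distrib[of "\<lambda>c. c * _"] cong: if_cong)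
    then show ?case
      by (intro exI[of _ "\<lambda>v. (if v = w then c else 0) + d v"])
        (simp add: d w(2) fun_eq_iff distrib_right sum.distrib)
  qed
  then show thesis using that by blast
qed

lemma span_image_finite_subset:
  assumes "s \<in> function_space.span (f ` L)"
  obtains J where "finite J" "J \<subseteq> L" "s \<in> function_space.span (f ` J)"
proof -
  have "\<exists>J. finite J \<and> J \<subseteq> L \<and> s \<in> function_space.span (f ` J)"
    using assms
  proof (induction s rule: function_space.span_induct_alt)
    case base
    show ?case by (intro exI[of _ "{}"]) (auto simp: function_space.span_zero)
  next
    case (step c y z)
    obtain w where w: "w \<in> L" "y = f w" using step(1) by blast
    obtain J where J: "finite J" "J \<subseteq> L" "z \<in> function_space.span (f ` J)" using step(2) by blast
    have "z \<in> function_space.span (f ` insert w J)"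
      using J(3) function_space.span_mono[of "f ` J" "f ` insert w J"] by blast
    moreover have "y \<in> function_space.span (f ` insert w J)"
      unfolding w(2) by (intro function_space.span_base) simp
    ultimately have "(\<lambda>x. c * y x) + z \<in> function_space.span (f ` insert w J)"
      by (intro function_space.span_add function_space.span_scale)
    then show ?case using J w by (intro exI[of _ "insert w J"]) (auto simp: plus_fun_def)
  qed
  then show thesis using that by blast
qed

section \<open>Energy of functions orthogonal to the low eigenwaves\<close>

context reflection_domain
begin

lemma spectral_gap: "\<exists>\<mu>'>\<mu>. \<forall>v\<in>L. \<mu> < v \<bullet> v \<longrightarrow> \<mu>' \<le> v \<bullet> v"
proof -
  define T where "T = {t \<in> (\<lambda>v. v \<bullet> v) ` {v \<in> L. v \<bullet> v \<le> \<mu> + 1}. \<mu> < t}"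
  have fin: "finite T" unfolding T_def using discrete_L[of "\<mu> + 1"] by simp
  show ?thesis
  proof (intro exI conjI ballI impI)
    show "\<mu> < Min (insert (\<mu> + 1) T)" using fin by (auto simp: T_def)
    fix v assume v: "v \<in> L" "\<mu> < v \<bullet> v"
    show "Min (insert (\<mu> + 1) T) \<le> v \<bullet> v"
    proof (cases "v \<bullet> v \<le> \<mu> + 1")
      case True
      then have "v \<bullet> v \<in> T" using v by (auto simp: T_def)
      then show ?thesis using fin by (intro Min_le) auto
    next
      case False
      have "Min (insert (\<mu> + 1) T) \<le> \<mu> + 1" using fin by (intro Min_le) auto
      with False show ?thesis by linarith
    qed
  qed
qed

text \<open>A function on the open set \<open>U\<close> need not extend continuously to
  \<open>\<Omega>\<close>, so uniform approximation does not apply directly. Multiplication by the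
  cutoffs gives such extensions with small \<open>L^2\<close> error.\<close>

lemma waves_L2_dense:
  assumes cont: "continuous_on U u" and bd: "\<And>x. x \<in> U \<Longrightarrow> \<bar>u x\<bar> \<le> B" and L2u: "L2_on M u" and "0 < \<delta>"
  obtains s where "s \<in> waves" "(LINT x|M. (u x - s x) * (u x - s x)) \<le> \<delta>"
proof -
  define c where "c n = cutoff H (inverse (real (Suc n)))" for n
  define w where "w n x = (if x \<in> U then u x * c n x else 0)" for n x
  have pos: "0 < inverse (real (Suc n))" for n by simp
  have cc: "continuous_on S (c n)" for S n
    unfolding c_def using GDERIV_cutoff[OF pos] by (rule GDERIV_continuous_on)
  have cw: "continuous_on UNIV (w n)" for n
  proof -
    obtain K where K: "compact K" "K \<subseteq> U" "\<And>x. x \<notin> K \<Longrightarrow> c n x = 0"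
      using cutoff_support[OF finite_H bounded_U pos[of n]] unfolding c_def by metis
    have "continuous_on (U \<union> - K) (w n)"
    proof (rule continuous_on_open_Un)
      have "continuous_on U (\<lambda>x. u x * c n x)" by (intro continuous_intros cont cc)
      then show "continuous_on U (w n)" by (rule continuous_on_eq) (simp add: w_def)
      have "continuous_on (- K) (\<lambda>_. 0 :: real)" by simp
      then show "continuous_on (- K) (w n)" by (rule continuous_on_eq) (auto simp: w_def K)
    qed (use open_U K(1) in \<open>auto simp: compact_imp_closed\<close>)
    moreover have "U \<union> - K = UNIV" using K by auto
    ultimately show ?thesis by simp
  qed
  have wL2: "L2_on M (w n)" for n using cw by (rule L2_on_M_continuous)
  have "(\<lambda>n. LINT x|M. (u x - w n x) * (u x - w n x)) \<longlonglongrightarrow> (LINT x|M. 0)"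
  proof (rule integral_dominated_convergence[where w = "\<lambda>_. B * B"])
    show "integrable M (\<lambda>_. B * B)" by simp
    show "(\<lambda>x. (u x - w n x) * (u x - w n x)) \<in> borel_measurable M" for n
      using L2_on_mult[OF L2_on_diff[OF L2u wL2] L2_on_diff[OF L2u wL2]] by simp
    show "AE x in M. norm ((u x - w n x) * (u x - w n x)) \<le> B * B" for n
    proof (rule AE_I2)
      fix x assume "x \<in> space M"
      then have x: "x \<in> U" by (simp add: space_M)
      have "\<bar>u x - w n x\<bar> = \<bar>u x\<bar> * (1 - c n x)"
        using x cutoff_bounds[of H "inverse (real (Suc n))" x]
        by (simp add: w_def c_def abs_mult flip: right_diff_distrib[of "u x" 1, simplified])
      also have "\<dots> \<le> B * 1"
        using bd[OF x] cutoff_bounds[of H "inverse (real (Suc n))" x] by (intro mult_mono) (auto simp: c_def)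
      finally have "\<bar>u x - w n x\<bar> \<le> B" by simp
      then show "norm ((u x - w n x) * (u x - w n x)) \<le> B * B"
        unfolding real_norm_def abs_mult by (intro mult_mono) auto
    qed
    show "AE x in M. (\<lambda>n. (u x - w n x) * (u x - w n x)) \<longlonglongrightarrow> 0"
    proof (rule AE_I2)
      fix x assume "x \<in> space M"
      then have x: "x \<in> U" by (simp add: space_M)
      show "(\<lambda>n. (u x - w n x) * (u x - w n x)) \<longlonglongrightarrow> 0"
        by (rule tendsto_eventually[OF eventually_mono[OF eventually_cutoff_eq_1[OF finite_H x]]])
          (simp add: w_def c_def x)
    qed
  qed simp
  then have "\<forall>\<^sub>F n in sequentially. (LINT x|M. (u x - w n x) * (u x - w n x)) < \<delta> / 4"
    using \<open>0 < \<delta>\<close> by (intro order_tendstoD(2)) auto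
  then obtain n where n: "(LINT x|M. (u x - w n x) * (u x - w n x)) < \<delta> / 4"
    by (auto simp: eventually_sequentially)
  define vol where "vol = measure M (space M)"
  \<comment> \<open>The inequality
    \<open>(a + b)\<^sup>2 \<le> 2 * a\<^sup>2 + 2 * b\<^sup>2\<close> allows
    \<open>\<delta> / 4\<close> for each of the cutoff error and the approximation error;
    \<open>vol + 1\<close> keeps the denominator positive.\<close>
  define \<eta> where "\<eta> = sqrt (\<delta> / (4 * (vol + 1)))"
  have vol: "0 \<le> vol" by (simp add: vol_def)
  have \<eta>: "0 < \<eta>" using \<open>0 < \<delta>\<close> vol by (simp add: \<eta>_def)
  have \<eta>2: "\<eta> * \<eta> * vol \<le> \<delta> / 4"
  proof -
    have "\<eta> * \<eta> = \<delta> / (4 * (vol + 1))" using \<open>0 < \<delta>\<close> vol by (simp add: \<eta>_def)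
    then have "\<eta> * \<eta> * vol = \<delta> / (4 * (vol + 1)) * vol" by simp
    also have "\<dots> = \<delta> / 4 * (vol / (vol + 1))" by simp
    also have "\<dots> \<le> \<delta> / 4 * 1" using \<open>0 < \<delta>\<close> vol by (intro mult_left_mono) auto
    finally show ?thesis by simp
  qed
  obtain s where s: "s \<in> waves" "\<And>x. x \<in> \<Omega> \<Longrightarrow> \<bar>w n x - s x\<bar> < \<eta>"
    using waves_dense[OF continuous_on_subset[OF cw subset_UNIV] \<eta>] by metis
  have sL2: "L2_on M s" using continuous_on_waves[OF s(1)] by (rule L2_on_M_continuous)
  have "(LINT x|M. (u x - s x) * (u x - s x)) \<le> (LINT x|M. 2 * ((u x - w n x) * (u x - w n x)) + 2 * (\<eta> * \<eta>))"
  proof (rule integral_mono)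
    show "integrable M (\<lambda>x. (u x - s x) * (u x - s x))"
      by (intro L2_on_mult L2_on_diff L2u sL2)
    show "integrable M (\<lambda>x. 2 * ((u x - w n x) * (u x - w n x)) + 2 * (\<eta> * \<eta>))"
      by (intro Bochner_Integration.integrable_add integrable_mult_right L2_on_mult L2_on_diff L2u wL2 integrable_const)
    fix x assume "x \<in> space M"
    then have "\<bar>w n x - s x\<bar> \<le> \<eta>" using s(2)[of x] U_subset by (force simp: space_M)
    then have 1: "(w n x - s x) * (w n x - s x) \<le> \<eta> * \<eta>"
      using mult_mono[of "\<bar>w n x - s x\<bar>" \<eta> "\<bar>w n x - s x\<bar>" \<eta>] \<eta> by (simp flip: abs_mult)
    have "0 \<le> ((u x - w n x) - (w n x - s x))\<^sup>2" by simp
    then have "(u x - s x) * (u x - s x) \<le> 2 * ((u x - w n x) * (u x - w n x)) + 2 * ((w n x - s x) * (w n x - s x))"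
      by (simp add: power2_eq_square algebra_simps)
    with 1 show "(u x - s x) * (u x - s x) \<le> 2 * ((u x - w n x) * (u x - w n x)) + 2 * (\<eta> * \<eta>)"
      by linarith
  qed
  also have "\<dots> = 2 * (LINT x|M. (u x - w n x) * (u x - w n x)) + 2 * (\<eta> * \<eta> * vol)"
    by (subst Bochner_Integration.integral_add)
      (auto intro!: integrable_mult_right L2_on_mult L2_on_diff L2u wL2 simp: vol_def)
  also have "\<dots> \<le> \<delta>" using n \<eta>2 by linarith
  finally show thesis using that s(1) by blast
qed

text \<open>
  The proof compares \<open>u\<close> with its projection to finitely many waves above \<open>\<mu>\<close>, where the energy form is
  explicit. By density of the waves the projection loses arbitrarily little of the norm of \<open>u\<close>, in
  particular less than the spectral gap above \<open>\<mu>\<close> compensates.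
\<close>

lemma energy_gt:
  assumes u: "sobolev_H1 U u Du" and cont: "continuous_on U u" and bd: "\<And>x. x \<in> U \<Longrightarrow> \<bar>u x\<bar> \<le> B"
    and "0 \<le> \<mu>" and orth: "\<And>v. v \<in> L \<Longrightarrow> v \<bullet> v \<le> \<mu> \<Longrightarrow> (LINT x|M. u x * wave G v x) = 0"
    and nz: "(LINT x|M. u x * u x) \<noteq> 0"
  shows "\<mu> * (LINT x|M. u x * u x) < (LINT x|M. Du x \<bullet> Du x)"
proof -
  obtain \<mu>' where \<mu>': "\<mu> < \<mu>'" "\<And>v. v \<in> L \<Longrightarrow> \<mu> < v \<bullet> v \<Longrightarrow> \<mu>' \<le> v \<bullet> v"
    using spectral_gap by blast
  define N where "N = (LINT x|M. u x * u x)"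
  have uL2: "L2_on M u" and DuL2: "L2_on M Du" using u by (auto dest: sobolev_H1_L2)
  have "0 \<le> N" unfolding N_def by simp
  with nz have N: "0 < N" unfolding N_def by linarith
  \<comment> \<open>Half of the gap: \<open>\<mu>' * (N - \<delta>)\<close> is the mean of
    \<open>\<mu> * N\<close> and \<open>\<mu>' * N\<close>, still above
    \<open>\<mu> * N\<close>.\<close>
  define \<delta> where "\<delta> = (\<mu>' - \<mu>) * N / (2 * \<mu>')"
  have \<delta>: "0 < \<delta>" using N \<mu>'(1) \<open>0 \<le> \<mu>\<close> by (simp add: \<delta>_def)
  obtain s where s: "s \<in> waves" "(LINT x|M. (u x - s x) * (u x - s x)) \<le> \<delta>"
    using waves_L2_dense[OF cont bd uL2 \<delta>] by blast
  have sL2: "L2_on M s" using continuous_on_waves[OF s(1)] by (rule L2_on_M_continuous)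
  have wL2: "L2_on M (wave G v)" for v by (intro L2_on_M_continuous continuous_on_wave)
  have w'L2: "L2_on M (wave' G v)" for v by (intro L2_on_M_continuous continuous_on_wave')
  obtain J where J: "finite J" "J \<subseteq> L" "s \<in> function_space.span (wave G ` J)"
    using span_image_finite_subset[OF s(1)[unfolded waves_def]] by metis
  obtain c where c: "s = (\<lambda>x. \<Sum>v\<in>J. c v * wave G v x)"
    using span_finite_image_coefficients[OF J(1,3)] by blast
  \<comment> \<open>The waves of \<open>s\<close> at or below \<open>\<mu>\<close> may be dropped:
    they are orthogonal to \<open>u\<close> by hypothesis and to \<open>p\<close> because
    \<open>p\<close> consists of waves of larger norm. So \<open>f\<close> is orthogonal to all of
    \<open>J\<close>.\<close>
  define J2 where "J2 = {v \<in> J. \<mu> < v \<bullet> v}"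
  have J2: "finite J2" "J2 \<subseteq> J" "J2 \<subseteq> L" "\<And>v. v \<in> J2 \<Longrightarrow> \<mu> < v \<bullet> v" using J by (auto simp: J2_def)
  obtain p where p: "p \<in> function_space.span (wave G ` J2)" "L2_on M p"
    "\<And>v. v \<in> J2 \<Longrightarrow> (LINT x|M. (u x - p x) * wave G v x) = 0"
    using orthogonal_projection_span[of "wave G ` J2" M u] J2(1) wL2 uL2 by auto
  obtain d where d: "p = (\<lambda>x. \<Sum>v\<in>J2. d v * wave G v x)"
    using span_finite_image_coefficients[OF J2(1) p(1)] by blast
  define f where "f x = u x - p x" for x
  have fL2: "L2_on M f" unfolding f_def by (intro L2_on_diff uL2 p)
  have forth: "(LINT x|M. f x * wave G v x) = 0" if v: "v \<in> J" for v
  proof (cases "v \<in> J2")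
    case False
    then have v': "v \<in> L" "v \<bullet> v \<le> \<mu>" using v J by (auto simp: J2_def)
    have "(LINT x|M. p x * wave G v x) = (\<Sum>w\<in>J2. d w * (LINT x|M. wave G w x * wave G v x))"
      unfolding d by (intro L2_integral_sum_mult wL2)
    also have "\<dots> = 0"
      using J2 v' waves_orthogonal by (intro sum.neutral) force
    finally show ?thesis
      unfolding f_def using orth[OF v'] by (simp add: L2_integral_diff_mult uL2 p(2) wL2)
  qed (use p(3) in \<open>simp add: f_def\<close>)
  have forth': "(LINT x|M. (\<Sum>v\<in>I. a v * wave G v x) * f x) = 0" if "I \<subseteq> J" for a I
    using that forth by (subst L2_integral_sum_mult) (auto intro!: sum.neutral wL2 fL2 simp: mult.commute)
  have fp: "(LINT x|M. p x * f x) = 0" unfolding d using J2(2) by (rule forth')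
  have fs: "(LINT x|M. s x * f x) = 0" unfolding c by (rule forth') simp
  \<comment> \<open>Pythagoras: \<open>u - s\<close> is the sum of \<open>f\<close> and
    \<open>p - s\<close>, which are orthogonal, so the projection is at least as close to
    \<open>u\<close> as \<open>s\<close> is.\<close>
  have ff: "(LINT x|M. f x * f x) \<le> \<delta>"
  proof -
    have psL2: "L2_on M (\<lambda>x. p x - s x)" by (intro L2_on_diff p sL2)
    have "(LINT x|M. (p x - s x) * f x) = 0"
      using fp fs by (simp add: L2_integral_diff_mult p(2) sL2 fL2)
    then have "(LINT x|M. f x * f x) = (LINT x|M. f x * f x) + 2 * (LINT x|M. (p x - s x) * f x)" by simp
    also have "\<dots> = (LINT x|M. f x * f x + 2 * ((p x - s x) * f x))"
      by (subst Bochner_Integration.integral_add) (auto intro!: L2_on_mult integrable_mult_right fL2 psL2)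
    also have "\<dots> \<le> (LINT x|M. (u x - s x) * (u x - s x))"
    proof (rule integral_mono)
      show "integrable M (\<lambda>x. f x * f x + 2 * ((p x - s x) * f x))"
        by (intro Bochner_Integration.integrable_add integrable_mult_right L2_on_mult fL2 psL2)
      show "integrable M (\<lambda>x. (u x - s x) * (u x - s x))"
        by (intro L2_on_mult L2_on_diff uL2 sL2)
      fix x
      have "0 \<le> (p x - s x)\<^sup>2" by simp
      then show "f x * f x + 2 * ((p x - s x) * f x) \<le> (u x - s x) * (u x - s x)"
        by (simp add: f_def power2_eq_square algebra_simps)
    qed
    finally show ?thesis using s(2) by simp
  qed
  have pp: "N - \<delta> \<le> (LINT x|M. p x * p x)"
  proof -
    have "N = (LINT x|M. (p x * p x + f x * f x) + 2 * (p x * f x))"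
      unfolding N_def by (intro integral_M_cong) (simp add: f_def algebra_simps)
    also have "\<dots> = (LINT x|M. p x * p x) + (LINT x|M. f x * f x) + 2 * (LINT x|M. p x * f x)"
      by (subst Bochner_Integration.integral_add,
          (intro Bochner_Integration.integrable_add integrable_mult_right L2_on_mult p fL2)+,
          subst Bochner_Integration.integral_add) (auto intro!: L2_on_mult p fL2)
    finally show ?thesis using fp ff by simp
  qed
  define Dp where "Dp x = (\<Sum>v\<in>J2. d v *\<^sub>R wave' G v x)" for x
  have pH1: "sobolev_H1 U p Dp"
  proof -
    have "sobolev_H1 U (wave G v) (wave' G v)" if "v \<in> J2" for v
      using sobolev_H1_eigenwave_global[OF wave_eigenwave, of v] that J2(3)
      by (auto simp: grad_eq[OF GDERIV_wave])
    then show ?thesis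
      unfolding d Dp_def[abs_def] using bounded_U sets_U J2(1) by (intro sobolev_H1_sum sobolev_H1_cmult) auto
  qed
  have DpL2: "L2_on M Dp" using pH1 by (rule sobolev_H1_L2)
  have Dp: "(LINT x|M. Dp x \<bullet> Dw x) = (\<Sum>v\<in>J2. d v * ((v \<bullet> v) * (LINT x|M. wave G v x * w x)))"
    if w: "sobolev_H1 U w Dw" for w Dw
  proof -
    have "(LINT x|M. Dp x \<bullet> Dw x) = (\<Sum>v\<in>J2. d v * (LINT x|M. wave' G v x \<bullet> Dw x))"
      unfolding Dp_def using sobolev_H1_L2[OF w] w'L2 by (intro L2_integral_sum_inner)
    also have "\<dots> = (\<Sum>v\<in>J2. d v * ((v \<bullet> v) * (LINT x|M. wave G v x * w x)))"
      using wave_weak_equation[OF _ w] J2(3) by (intro sum.cong) (auto simp: lint_eq)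
    finally show ?thesis .
  qed
  define Q where "Q = (\<Sum>v\<in>J2. d v * ((v \<bullet> v) * (LINT x|M. wave G v x * p x)))"
  have uw: "(LINT x|M. wave G v x * u x) = (LINT x|M. wave G v x * p x)" if "v \<in> J2" for v
    using p(3)[OF that, unfolded L2_integral_diff_mult[OF uL2 p(2) wL2]] by (simp add: mult.commute)
  have Q1: "(LINT x|M. Dp x \<bullet> Dp x) = Q" "(LINT x|M. Dp x \<bullet> Du x) = Q"
    unfolding Q_def using Dp[OF pH1] Dp[OF u] uw by auto
  \<comment> \<open>The weak equation makes the energy of \<open>p\<close> equal to its mixed energy
    with \<open>u\<close>; expanding the energy of \<open>u - p\<close> then gives the
    estimate.\<close>
  have EQ: "Q \<le> (LINT x|M. Du x \<bullet> Du x)"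
  proof -
    have "0 \<le> (LINT x|M. (Du x - Dp x) \<bullet> (Du x - Dp x))" by simp
    also have "\<dots> = (LINT x|M. (Du x \<bullet> Du x + Dp x \<bullet> Dp x) - 2 * (Dp x \<bullet> Du x))"
      by (intro integral_M_cong) (simp add: inner_diff_left inner_diff_right inner_commute)
    also have "\<dots> = (LINT x|M. Du x \<bullet> Du x) + (LINT x|M. Dp x \<bullet> Dp x) - 2 * (LINT x|M. Dp x \<bullet> Du x)"
      by (subst Bochner_Integration.integral_diff,
          (intro Bochner_Integration.integrable_add integrable_mult_right L2_on_inner DuL2 DpL2)+,
          subst Bochner_Integration.integral_add) (auto intro!: L2_on_inner DuL2 DpL2)
    finally show ?thesis using Q1 by simp
  qed
  \<comment> \<open>Waves of equal norm need not be orthogonal, so \<open>Q\<close> is not a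
    diagonal sum. Weighting each coefficient by the square root of its excess over
    \<open>\<mu>'\<close> exhibits the difference as the squared norm of \<open>q\<close>; terms of
    different norms vanish by orthogonality.\<close>
  have "0 \<le> Q - \<mu>' * (LINT x|M. p x * p x)"
  proof -
    define k where "k v = sqrt (v \<bullet> v - \<mu>')" for v :: 'a
    define q where "q x = (\<Sum>v\<in>J2. (d v * k v) * wave G v x)" for x
    have qL2: "L2_on M q"
      unfolding q_def using L2_on_cmult[OF wL2] by (intro L2_on_sum) simp
    have e1: "(LINT x|M. wave G v x * p x) = (\<Sum>w\<in>J2. d w * (LINT x|M. wave G w x * wave G v x))" for v
      unfolding mult.commute[of "wave G v _"] d by (intro L2_integral_sum_mult wL2)
    have e2: "(LINT x|M. wave G v x * q x) = (\<Sum>w\<in>J2. (d w * k w) * (LINT x|M. wave G w x * wave G v x))" for v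
      unfolding mult.commute[of "wave G v _"] q_def by (intro L2_integral_sum_mult wL2)
    have e3: "(LINT x|M. p x * p x) = (\<Sum>v\<in>J2. d v * (LINT x|M. wave G v x * p x))"
      by (subst (1) d, intro L2_integral_sum_mult wL2 p)
    have "0 \<le> (LINT x|M. q x * q x)" by simp
    also have "\<dots> = (\<Sum>v\<in>J2. (d v * k v) * (LINT x|M. wave G v x * q x))"
      by (subst (1) q_def, intro L2_integral_sum_mult wL2 qL2)
    also have "\<dots> = (\<Sum>v\<in>J2. d v * ((v \<bullet> v - \<mu>') * (LINT x|M. wave G v x * p x)))"
    proof (rule sum.cong[OF refl])
      fix v assume v: "v \<in> J2"
      have "k v * (LINT x|M. wave G v x * q x) = (\<Sum>w\<in>J2. (v \<bullet> v - \<mu>') * (d w * (LINT x|M. wave G w x * wave G v x)))"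
        unfolding e2 sum_distrib_left
      proof (rule sum.cong[OF refl])
        fix w assume w: "w \<in> J2"
        show "k v * (d w * k w * (LINT x|M. wave G w x * wave G v x)) =
            (v \<bullet> v - \<mu>') * (d w * (LINT x|M. wave G w x * wave G v x))"
        proof (cases "v \<bullet> v = w \<bullet> w")
          case True
          have "\<mu>' \<le> v \<bullet> v" using v J2 \<mu>'(2) by auto
          then have "k v * k w = v \<bullet> v - \<mu>'" by (simp add: k_def flip: True)
          then show ?thesis by (metis mult.assoc mult.left_commute)
        next
          case False
          then show ?thesis using waves_orthogonal[of w v] v w J2(3) by auto
        qed
      qed
      also have "\<dots> = (v \<bullet> v - \<mu>') * (LINT x|M. wave G v x * p x)"
        by (simp add: e1 sum_distrib_left)
      finally show "d v * k v * (LINT x|M. wave G v x * q x) = d v * ((v \<bullet> v - \<mu>') * (LINT x|M. wave G v x * p x))"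
        by simp
    qed
    also have "\<dots> = Q - \<mu>' * (LINT x|M. p x * p x)"
      unfolding e3 Q_def by (simp add: algebra_simps sum_subtractf sum_distrib_left)
    finally show ?thesis .
  qed
  then have "\<mu>' * (N - \<delta>) \<le> (LINT x|M. Du x \<bullet> Du x)"
    using EQ mult_left_mono[OF pp, of \<mu>'] \<mu>'(1) \<open>0 \<le> \<mu>\<close> by linarith
  moreover have "\<mu>' * (N - \<delta>) = \<mu>' * N - (\<mu>' - \<mu>) * N / 2"
    using \<mu>'(1) \<open>0 \<le> \<mu>\<close> by (simp add: \<delta>_def right_diff_distrib)
  moreover have "\<mu> * N < \<mu>' * N - (\<mu>' - \<mu>) * N / 2"
  proof -
    have "0 < (\<mu>' - \<mu>) * N" using \<mu>'(1) N by simp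
    moreover have "(\<mu>' - \<mu>) * N = \<mu>' * N - \<mu> * N" by (simp add: algebra_simps)
    ultimately show ?thesis by linarith
  qed
  ultimately show ?thesis unfolding N_def by linarith
qed

end

lemma dim_image_injective:
  fixes T :: "('a \<Rightarrow> real) \<Rightarrow> 'b \<Rightarrow> real"
  assumes T: "Vector_Spaces.linear (\<lambda>c f x. c * f x) (\<lambda>c f x. c * f x) T"
    and inj: "inj_on T (function_space.span S)"
  shows "function_space.dim (T ` S) = function_space.dim S"
proof -
  interpret T: Vector_Spaces.linear "\<lambda>c f x. c * f x" "\<lambda>c f x. c * f x" T by (rule T)
  obtain B where B: "B \<subseteq> S" "function_space.independent B" "S \<subseteq> function_space.span B"
    "card B = function_space.dim S"
    using function_space.basis_exists by blast
  have span: "function_space.span S = function_space.span B"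
    using B by (intro function_space.span_eq[THEN iffD2]) (auto intro: function_space.span_base)
  have "function_space.independent (T ` B)"
    using T.independent_injective_image[OF B(2)] inj by (simp add: span)
  moreover have "function_space.span (T ` S) = function_space.span (T ` B)"
    by (simp add: T.span_image span)
  moreover have "card (T ` B) = card B"
    using inj B(1) by (intro card_image inj_on_subset[OF inj]) (auto intro: function_space.span_base)
  ultimately show ?thesis
    using function_space.dim_eq_card[of "T ` B" "T ` S"] B(4) by simp
qed

text \<open>Components are relatively closed, so boundary points of a nodal domain or subdomain
  inside \<open>U\<close> lie in the removed set, where the functions vanish.\<close>

lemma component_boundary:
  assumes "C \<in> components W" "x \<in> W" "x \<in> closure C"
  shows "x \<in> C"
proof -
  obtain S where "closed S" "C = W \<inter> S"
    using closedin_component[OF assms(1)] by (auto simp: closedin_closed)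
  then show ?thesis using assms(2,3) closure_minimal[of C S] by auto
qed

section \<open>Multiplicities, the variational bound and nodal domains\<close>

context reflection_domain
begin

lemma subspace_eigenwaves: "function_space.subspace (eigenwaves \<nu>)"
  by (simp add: eigenwaves_def)

lemma linear_restr: "Vector_Spaces.linear (\<lambda>c f x. c * f x) (\<lambda>c f x. c * f x) restr"
  by unfold_locales (auto simp: restr_def fun_eq_iff algebra_simps)

lemma inj_on_restr: "inj_on restr (eigenwaves \<nu>)"
proof (rule inj_onI)
  fix f g assume f: "f \<in> eigenwaves \<nu>" and g: "g \<in> eigenwaves \<nu>" and eq: "restr f = restr g"
  have "f - g = 0"
  proof (rule eigenwaves_unique_continuation[OF _ open_U nonempty])
    show "f - g \<in> eigenwaves \<nu>"
      using f g unfolding eigenwaves_def by (rule function_space.span_diff)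
    show "(f - g) x = 0" if "x \<in> U" for x
      using fun_cong[OF eq, of x] that by (simp add: restr_def)
  qed
  then show "f = g" by simp
qed

lemma multiplicity_eq: "multiplicity_of \<Omega> \<nu> = function_space.dim (eigenwaves \<nu>)"
  unfolding multiplicity_of_def neumann_eigenspace_eq
  by (rule dim_image_injective[OF linear_restr])
    (simp only: function_space.span_eq_iff[THEN iffD2, OF subspace_eigenwaves] inj_on_restr)

lemma neumann_eigenvalue_iff: "neumann_eigenvalue \<Omega> \<nu> \<longleftrightarrow> (\<exists>v\<in>L. v \<bullet> v = \<nu>)"
proof
  assume "neumann_eigenvalue \<Omega> \<nu>"
  then obtain \<Psi> where \<Psi>: "\<Psi> \<in> eigenwaves \<nu>" "restr \<Psi> \<noteq> 0"
    unfolding neumann_eigenvalue_def neumann_eigenfunction_def neumann_eigenspace_eq by blast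
  have nonzero: "\<Psi> \<noteq> 0"
  proof
    assume "\<Psi> = 0"
    then have "restr \<Psi> = 0" by (simp add: restr_def fun_eq_iff)
    with \<Psi>(2) show False ..
  qed
  show "\<exists>v\<in>L. v \<bullet> v = \<nu>"
  proof (rule ccontr)
    assume "\<not> ?thesis"
    then have "{v \<in> L. v \<bullet> v = \<nu>} = {}" by auto
    with nonzero \<Psi>(1) show False by (simp add: eigenwaves_def)
  qed
next
  assume "\<exists>v\<in>L. v \<bullet> v = \<nu>"
  then obtain v where v: "v \<in> L" "v \<bullet> v = \<nu>" by blast
  have "wave G v \<noteq> 0" using wave_at_0[of v] card_G by (auto simp: fun_eq_iff intro!: exI[of _ 0])
  then have "restr (wave G v) \<noteq> restr 0"
    using inj_on_restr[of \<nu>] wave_eigenwave[OF v(1)] v(2) function_space.subspace_0[OF subspace_eigenwaves]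
    by (metis inj_on_def)
  moreover have "restr 0 = 0" by (simp add: restr_def fun_eq_iff)
  ultimately show "neumann_eigenvalue \<Omega> \<nu>"
    using wave_eigenwave[OF v(1)] v(2)
    unfolding neumann_eigenvalue_def neumann_eigenfunction_def neumann_eigenspace_eq by auto
qed

lemma finite_eigenvalues: "finite {\<nu>. neumann_eigenvalue \<Omega> \<nu> \<and> \<nu> \<le> \<mu>}"
  by (rule finite_subset[OF _ finite_imageI[OF discrete_L[of \<mu>], of "\<lambda>v. v \<bullet> v"]])
    (auto simp: neumann_eigenvalue_iff)

lemma eigenwaves_basis:
  obtains B where "B \<subseteq> eigenwaves \<nu>" "function_space.independent B" "eigenwaves \<nu> = function_space.span B"
    "finite B" "card B = multiplicity_of \<Omega> \<nu>"
proof -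
  obtain B where B: "B \<subseteq> eigenwaves \<nu>" "function_space.independent B" "eigenwaves \<nu> \<subseteq> function_space.span B"
    "card B = function_space.dim (eigenwaves \<nu>)"
    using function_space.basis_exists by blast
  have fin: "finite B"
    using function_space.independent_span_bound[OF finite_imageI[OF finite_eigenlattice[of \<nu>], of "wave G"] B(2)] B(1)
    by (auto simp: eigenwaves_def)
  have "function_space.span B \<subseteq> eigenwaves \<nu>"
    using B(1) subspace_eigenwaves by (rule function_space.span_minimal)
  with B(3) have "eigenwaves \<nu> = function_space.span B" by (rule equalityI)
  from that[OF B(1,2) this fin] show thesis by (simp only: B(4) multiplicity_eq)
qed

lemma L2_eigenwave: "\<Psi> \<in> eigenwaves \<nu> \<Longrightarrow> L2_on M \<Psi>"
  by (intro L2_on_M_continuous eigenwaves_continuous)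

text \<open>Variational principle: with more functions than eigenvalues up to \<open>\<mu>\<close>,
  a nontrivial combination is orthogonal to all the corresponding eigenfunctions. Its energy equals
  \<open>\<mu>\<close> times its squared norm, against the strict inequality of
  \<open>energy_gt\<close>.\<close>

lemma card_le_eigenvalue_count:
  assumes "finite T" and "0 \<le> \<mu>"
    and H1: "\<And>t. t \<in> T \<Longrightarrow> sobolev_H1 U (f t) (Df t)"
    and cont: "\<And>t. t \<in> T \<Longrightarrow> continuous_on U (f t)"
    and bd: "\<And>t x. t \<in> T \<Longrightarrow> x \<in> U \<Longrightarrow> \<bar>f t x\<bar> \<le> B t"
    and form: "\<And>s t. s \<in> T \<Longrightarrow> t \<in> T \<Longrightarrow> (LINT x|M. Df s x \<bullet> Df t x) = \<mu> * (LINT x|M. f s x * f t x)"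
    and indep: "\<And>c. (\<And>x. x \<in> U \<Longrightarrow> (\<Sum>t\<in>T. c t * f t x) = 0) \<Longrightarrow> (\<forall>t\<in>T. c t = 0)"
  shows "card T \<le> (\<Sum>\<nu> | neumann_eigenvalue \<Omega> \<nu> \<and> \<nu> \<le> \<mu>. multiplicity_of \<Omega> \<nu>)"
proof (rule ccontr)
  assume less: "\<not> ?thesis"
  have "\<forall>\<nu>. \<exists>B. B \<subseteq> eigenwaves \<nu> \<and> eigenwaves \<nu> = function_space.span B \<and> finite B \<and> card B = multiplicity_of \<Omega> \<nu>"
  proof
    fix \<nu>
    show "\<exists>B. B \<subseteq> eigenwaves \<nu> \<and> eigenwaves \<nu> = function_space.span B \<and> finite B \<and> card B = multiplicity_of \<Omega> \<nu>"
      by (rule eigenwaves_basis[of \<nu>]) (rule exI, intro conjI)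
  qed
  from choice[OF this] obtain b where b: "\<And>\<nu>. b \<nu> \<subseteq> eigenwaves \<nu>" "\<And>\<nu>. eigenwaves \<nu> = function_space.span (b \<nu>)"
    "\<And>\<nu>. finite (b \<nu>)" "\<And>\<nu>. card (b \<nu>) = multiplicity_of \<Omega> \<nu>"
    by blast
  define F where "F = (\<Union>\<nu>\<in>{\<nu>. neumann_eigenvalue \<Omega> \<nu> \<and> \<nu> \<le> \<mu>}. b \<nu>)"
  have "finite F" unfolding F_def using finite_eigenvalues b(3) by blast
  have "card F \<le> (\<Sum>\<nu> | neumann_eigenvalue \<Omega> \<nu> \<and> \<nu> \<le> \<mu>. card (b \<nu>))"
    unfolding F_def using finite_eigenvalues by (rule card_UN_le)
  with less have "card F < card T" by (simp add: b(4))
  \<comment> \<open>One orthogonality condition for each basis eigenwave in \<open>F\<close>, one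
    unknown coefficient for each function in \<open>T\<close>.\<close>
  from homogeneous_system_nontrivial_solution[OF \<open>finite F\<close> \<open>finite T\<close> this, of "\<lambda>w t. LINT x|M. f t x * w x"]
  obtain c where c: "\<exists>t\<in>T. c t \<noteq> 0" "\<And>w. w \<in> F \<Longrightarrow> (\<Sum>t\<in>T. c t * (LINT x|M. f t x * w x)) = 0"
    by blast
  have fL2: "L2_on M (f t)" "L2_on M (Df t)" if "t \<in> T" for t using H1[OF that] by (auto dest: sobolev_H1_L2)
  define u where "u x = (\<Sum>t\<in>T. c t * f t x)" for x
  define Du where "Du x = (\<Sum>t\<in>T. c t *\<^sub>R Df t x)" for x
  have u: "sobolev_H1 U u Du"
    unfolding u_def[abs_def] Du_def[abs_def]
    using \<open>finite T\<close> bounded_U sets_U H1 by (intro sobolev_H1_sum sobolev_H1_cmult) auto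
  have uL2: "L2_on M u" "L2_on M Du" using u by (auto dest: sobolev_H1_L2)
  have cu: "continuous_on U u" unfolding u_def[abs_def] using cont by (intro continuous_intros) auto
  have orthF: "(LINT x|M. u x * w x) = 0" if w: "w \<in> F" for w
  proof -
    have "L2_on M w" using w b(1) L2_eigenwave by (auto simp: F_def)
    then show ?thesis unfolding u_def using fL2 c(2)[OF w] by (subst L2_integral_sum_mult) auto
  qed
  have orth: "(LINT x|M. u x * wave G v x) = 0" if v: "v \<in> L" "v \<bullet> v \<le> \<mu>" for v
  proof -
    have ev: "neumann_eigenvalue \<Omega> (v \<bullet> v)" using v by (auto simp: neumann_eigenvalue_iff)
    have "wave G v \<in> function_space.span (id ` b (v \<bullet> v))"
      using wave_eigenwave[OF v(1)] b(2)[of "v \<bullet> v"] by simp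
    then obtain d where d: "wave G v = (\<lambda>x. \<Sum>w\<in>b (v \<bullet> v). d w * id w x)"
      using span_finite_image_coefficients[OF b(3)] by blast
    have "(LINT x|M. (\<Sum>w\<in>b (v \<bullet> v). d w * id w x) * u x) = (\<Sum>w\<in>b (v \<bullet> v). d w * (LINT x|M. id w x * u x))"
      using b(1) L2_eigenwave uL2 by (intro L2_integral_sum_mult) auto
    also have "\<dots> = 0"
      using orthF ev v by (intro sum.neutral) (auto simp: F_def mult.commute)
    finally show ?thesis unfolding d by (simp only: mult.commute)
  qed
  have bdu: "\<bar>u x\<bar> \<le> (\<Sum>t\<in>T. \<bar>c t\<bar> * B t)" if "x \<in> U" for x
    unfolding u_def
    by (rule order_trans[OF sum_abs sum_mono]) (use bd that in \<open>auto simp: abs_mult intro: mult_left_mono\<close>)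
  have nz: "(LINT x|M. u x * u x) \<noteq> 0"
  proof
    assume "(LINT x|M. u x * u x) = 0"
    then have ae: "AE x in M. u x * u x = 0"
      using integral_nonneg_eq_0_iff_AE[OF L2_on_mult[OF uL2(1) uL2(1)]] by simp
    have "(LINT x|M. u x * wave G v x) = 0" for v
    proof -
      have wL2: "L2_on M (wave G v)" by (intro L2_on_M_continuous continuous_on_wave)
      have "(LINT x|M. u x * wave G v x) = (LINT x|M. 0)"
        using ae L2_on_mult[OF uL2(1) wL2] by (intro integral_cong_AE) auto
      then show ?thesis by simp
    qed
    then have "u x = 0" if "x \<in> U" for x
      using orthogonal_waves_eq_0[OF uL2(1) cu _ that] by blast
    then show False using indep[of c] c(1) by (auto simp: u_def)
  qed
  have "(LINT x|M. Du x \<bullet> Du x) = (\<Sum>s\<in>T. c s * (LINT x|M. Df s x \<bullet> Du x))"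
    by (subst (1) Du_def, intro L2_integral_sum_inner fL2 uL2)
  also have "\<dots> = (\<Sum>s\<in>T. c s * (\<Sum>t\<in>T. c t * (LINT x|M. Df t x \<bullet> Df s x)))"
  proof (rule sum.cong[OF refl])
    fix s assume s: "s \<in> T"
    have "(LINT x|M. Du x \<bullet> Df s x) = (\<Sum>t\<in>T. c t * (LINT x|M. Df t x \<bullet> Df s x))"
      unfolding Du_def using s by (intro L2_integral_sum_inner fL2)
    then show "c s * (LINT x|M. Df s x \<bullet> Du x) = c s * (\<Sum>t\<in>T. c t * (LINT x|M. Df t x \<bullet> Df s x))"
      by (simp add: inner_commute)
  qed
  also have "\<dots> = (\<Sum>s\<in>T. c s * (\<mu> * (\<Sum>t\<in>T. c t * (LINT x|M. f t x * f s x))))"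
    using form by (intro sum.cong refl) (simp add: sum_distrib_left mult.left_commute)
  also have "\<dots> = (\<Sum>s\<in>T. c s * (\<mu> * (LINT x|M. u x * f s x)))"
  proof (rule sum.cong[OF refl])
    fix s assume s: "s \<in> T"
    have "(LINT x|M. u x * f s x) = (\<Sum>t\<in>T. c t * (LINT x|M. f t x * f s x))"
      unfolding u_def using s by (intro L2_integral_sum_mult fL2)
    then show "c s * (\<mu> * (\<Sum>t\<in>T. c t * (LINT x|M. f t x * f s x))) = c s * (\<mu> * (LINT x|M. u x * f s x))"
      by simp
  qed
  also have "\<dots> = \<mu> * (\<Sum>s\<in>T. c s * (LINT x|M. f s x * u x))"
    by (simp add: sum_distrib_left mult_ac)
  also have "(\<Sum>s\<in>T. c s * (LINT x|M. f s x * u x)) = (LINT x|M. u x * u x)"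
    by (subst (2) u_def, rule L2_integral_sum_mult[symmetric]) (auto intro: fL2 uL2)
  finally have "(LINT x|M. Du x \<bullet> Du x) = \<mu> * (LINT x|M. u x * u x)" .
  then show False
    using energy_gt[OF u cu bdu \<open>0 \<le> \<mu>\<close> orth nz] by simp
qed

text \<open>Finite subfamilies come first, since finiteness of the component counts is still
  unknown. The nodal domain required inside each chosen subdomain is the open set on which the
  coefficients of that subdomain are isolated.\<close>

lemma nodal_count_bound_finite:
  fixes S :: "'a set"
  assumes \<Psi>: "\<Psi> \<in> eigenwaves \<mu>" "\<Psi> \<noteq> 0" and "0 \<le> \<mu>"
    and S: "closed S" "\<And>\<Phi> x. \<Phi> \<in> eigenwaves \<mu> \<Longrightarrow> x \<in> S \<Longrightarrow> x \<in> U \<Longrightarrow> \<Phi> x = 0"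
    and CC: "finite CC" "CC \<subseteq> components (U - {x. \<Psi> x = 0})"
    and DD: "finite DD" "DD \<subseteq> components (U - S)" "\<And>D. D \<in> DD \<Longrightarrow> \<exists>C\<in>CC. C \<subseteq> D"
  shows "card CC + card DD * (multiplicity_of \<Omega> \<mu> - 1)
    \<le> (\<Sum>\<nu> | neumann_eigenvalue \<Omega> \<nu> \<and> \<nu> \<le> \<mu>. multiplicity_of \<Omega> \<nu>)"
proof -
  have "function_space.independent {\<Psi>}"
    using \<Psi>(2) by (simp add: function_space.dependent_single)
  then obtain B where B: "{\<Psi>} \<subseteq> B" "B \<subseteq> eigenwaves \<mu>" "function_space.independent B"
    "eigenwaves \<mu> \<subseteq> function_space.span B"
    using function_space.maximal_independent_subset_extend[of "{\<Psi>}" "eigenwaves \<mu>"] \<Psi>(1) by auto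
  have finB: "finite B"
    using function_space.independent_span_bound[OF finite_imageI[OF finite_eigenlattice[of \<mu>], of "wave G"] B(3)] B(2)
    by (auto simp: eigenwaves_def)
  have cardB: "card B = multiplicity_of \<Omega> \<mu>"
    unfolding multiplicity_eq using B by (intro function_space.basis_card_eq_dim)
  define B' where "B' = B - {\<Psi>}"
  have B': "B = insert \<Psi> B'" "\<Psi> \<notin> B'" "finite B'" "card B' = multiplicity_of \<Omega> \<mu> - 1"
    using B(1) finB cardB by (auto simp: B'_def)
  define T where "T = (\<lambda>C. (C, \<Psi>)) ` CC \<union> DD \<times> B'"
  have disj: "(\<lambda>C. (C, \<Psi>)) ` CC \<inter> DD \<times> B' = {}" using B'(2) by auto
  have inj: "inj_on (\<lambda>C. (C, \<Psi>)) CC" by (auto simp: inj_on_def)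
  have finT: "finite T" using CC DD B' by (simp add: T_def)
  have "card T = card CC + card DD * card B'"
    unfolding T_def using CC DD B' disj inj by (subst card_Un_disjoint) (auto simp: card_image card_cartesian_product)
  then have cardT: "card T = card CC + card DD * (multiplicity_of \<Omega> \<mu> - 1)" by (simp add: B'(4))
  define f where "f t x = (if x \<in> fst t then snd t x else (0::real))" for t :: "'a set \<times> ('a \<Rightarrow> real)" and x
  define Df where "Df t x = (if x \<in> fst t then grad (snd t) x else 0)" for t :: "'a set \<times> ('a \<Rightarrow> real)" and x
  have op1: "open (U - {x. \<Psi> x = 0})"
    using eigenwaves_continuous[OF \<Psi>(1)] open_U by (intro open_Diff closed_Collect_eq continuous_intros) auto
  have op2: "open (U - S)" using open_U S(1) by (rule open_Diff)
  have sub1: "C \<subseteq> U - {x. \<Psi> x = 0}" "C \<noteq> {}" "open C" "C \<subseteq> U" if "C \<in> CC" for C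
    using that CC(2) op1 in_components_subset[of C "U - {x. \<Psi> x = 0}"]
    by (auto dest: in_components_nonempty intro: open_components)
  have sub2: "D \<subseteq> U - S" "D \<noteq> {}" "open D" "D \<subseteq> U" if "D \<in> DD" for D
    using that DD(2) op2 in_components_subset[of D "U - S"]
    by (auto dest: in_components_nonempty intro: open_components)
  have T_E: "snd t \<in> eigenwaves \<mu>" if "t \<in> T" for t
    using that \<Psi>(1) B(2) by (auto simp: T_def B'_def)
  have T_open: "open (fst t)" "fst t \<subseteq> U" if "t \<in> T" for t
  proof -
    show "open (fst t)" using that sub1(3) sub2(3) by (auto simp: T_def)
    show "fst t \<subseteq> U" using that by (auto simp: T_def dest!: sub1(4) sub2(4))
  qed
  have T_bd: "snd t x = 0" if t: "t \<in> T" and x: "x \<in> U" "x \<in> closure (fst t)" "x \<notin> fst t" for t x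
  proof (cases "t \<in> (\<lambda>C. (C, \<Psi>)) ` CC")
    case True
    then have "fst t \<in> components (U - {x. \<Psi> x = 0})" "snd t = \<Psi>" using CC(2) by auto
    then show ?thesis using component_boundary[of "fst t" _ x] x by auto
  next
    case False
    then have "fst t \<in> components (U - S)" using t DD(2) by (auto simp: T_def)
    then have "x \<in> S" using component_boundary[of "fst t" _ x] x by auto
    then show ?thesis using S(2)[OF T_E[OF t]] x by auto
  qed
  \<comment> \<open>Since \<open>\<Psi>\<close> vanishes on \<open>S\<close> inside
    \<open>U\<close>, a nodal domain is a connected part of the complement of \<open>S\<close>; so
    it lies in a single subdomain.\<close>
  have C_sub: "C \<subseteq> U - S" if "C \<in> CC" for C
    using sub1[OF that] S(2)[OF \<Psi>(1)] by blast
  have CD: "C \<subseteq> D \<or> C \<inter> D = {}" if "C \<in> CC" "D \<in> DD" for C D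
  proof -
    have "connected C" using that CC(2) in_components_connected by blast
    then show ?thesis using components_maximal[of D "U - S" C] C_sub that DD(2) by blast
  qed
  have CC': "C = C' \<or> C \<inter> C' = {}" if "C \<in> CC" "C' \<in> CC" for C C'
    using that CC(2) components_nonoverlap[of C _ C'] by blast
  have DD': "D = D' \<or> D \<inter> D' = {}" if "D \<in> DD" "D' \<in> DD" for D D'
    using that DD(2) components_nonoverlap[of D _ D'] by blast
  have nested: "fst s \<subseteq> fst t \<or> fst t \<subseteq> fst s \<or> fst s \<inter> fst t = {}" if "s \<in> T" "t \<in> T" for s t
    using that CD CC' DD' unfolding T_def by (auto; blast)
  have H1: "sobolev_H1 U (f t) (Df t)" if "t \<in> T" for t
    unfolding f_def[abs_def] Df_def[abs_def]
    by (intro sobolev_H1_eigenwave[OF T_E[OF that]] T_open[OF that] T_bd[OF that])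
  \<comment> \<open>The function with the smaller support is an admissible \<open>H^1\<close> test
    function for the untruncated eigenwave of the other, and on that support the truncation of the
    latter is invisible.\<close>
  have form_sub: "(LINT x|M. Df s x \<bullet> Df t x) = \<mu> * (LINT x|M. f s x * f t x)"
    if "s \<in> T" "t \<in> T" "fst s \<subseteq> fst t" for s t
  proof -
    have "(LINT x|M. Df s x \<bullet> Df t x) = (LINT x|M. grad (snd t) x \<bullet> Df s x)"
      using that(3) by (intro integral_M_cong) (auto simp: Df_def inner_commute)
    also have "\<dots> = \<mu> * (LINT x|M. snd t x * f s x)"
      by (rule eigenwaves_equation[OF T_E[OF that(2)] H1[OF that(1)]])
    also have "(LINT x|M. snd t x * f s x) = (LINT x|M. f s x * f t x)"
      using that(3) by (intro integral_M_cong) (auto simp: f_def)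
    finally show ?thesis .
  qed
  show ?thesis
    unfolding cardT[symmetric]
  proof (rule card_le_eigenvalue_count[OF finT \<open>0 \<le> \<mu>\<close> H1])
    fix t assume t: "t \<in> T"
    show "continuous_on U (f t)"
    proof -
      have "continuous_on ((U \<inter> closure (fst t)) \<union> (U - fst t)) (\<lambda>x. if x \<in> fst t then snd t x else 0)"
      proof (rule continuous_on_cases_local)
        have "(U \<inter> closure (fst t)) \<union> (U - fst t) = U" using closure_subset[of "fst t"] by auto
        then show "closedin (top_of_set (U \<inter> closure (fst t) \<union> (U - fst t))) (U \<inter> closure (fst t))"
          "closedin (top_of_set (U \<inter> closure (fst t) \<union> (U - fst t))) (U - fst t)"
          using closedin_closed_Int[of "closure (fst t)" U] closedin_closed_Int[of "- fst t" U] T_open[OF t]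
          by (auto simp: Diff_eq)
        show "continuous_on (U \<inter> closure (fst t)) (snd t)"
          using eigenwaves_continuous[OF T_E[OF t]] by (rule continuous_on_subset) simp
        show "snd t x = 0" if "x \<in> U \<inter> closure (fst t) \<and> x \<notin> fst t \<or> x \<in> U - fst t \<and> x \<in> fst t" for x
          using that T_bd[OF t] by auto
      qed simp
      moreover have "(U \<inter> closure (fst t)) \<union> (U - fst t) = U" using closure_subset[of "fst t"] by auto
      ultimately show ?thesis by (simp add: f_def[abs_def])
    qed
  next
    fix t x assume t: "t \<in> T" and x: "x \<in> U"
    define b where "b t = (SOME b. 0 \<le> b \<and> (\<forall>x\<in>U. norm (snd t x) \<le> b))" for t :: "'a set \<times> ('a \<Rightarrow> real)"
    \<comment> \<open>The bound has to depend on the index alone, so it is chosen uniformly in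
      \<open>x\<close>.\<close>
    have "\<exists>b. 0 \<le> b \<and> (\<forall>x\<in>U. norm (snd t x) \<le> b)"
      using continuous_bounded_on_bounded[OF eigenwaves_continuous[OF T_E[OF t]] bounded_U] by metis
    from someI_ex[OF this] show "\<bar>f t x\<bar> \<le> (SOME b. 0 \<le> b \<and> (\<forall>x\<in>U. norm (snd t x) \<le> b))"
      using x by (auto simp: f_def)
  next
    fix s t assume st: "s \<in> T" "t \<in> T"
    consider "fst s \<subseteq> fst t" | "fst t \<subseteq> fst s" | "fst s \<inter> fst t = {}" using nested[OF st] by blast
    then show "(LINT x|M. Df s x \<bullet> Df t x) = \<mu> * (LINT x|M. f s x * f t x)"
    proof cases
      case 1
      then show ?thesis using form_sub st by blast
    next
      case 2
      then show ?thesis using form_sub[OF st(2,1)] by (simp add: inner_commute mult.commute)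
    next
      case 3
      then have "Df s x \<bullet> Df t x = 0" "f s x * f t x = 0" for x by (auto simp: Df_def f_def)
      then show ?thesis by (simp only: Bochner_Integration.integral_zero mult_zero_right)
    qed
  next
    fix c assume zero: "\<And>x. x \<in> U \<Longrightarrow> (\<Sum>t\<in>T. c t * f t x) = 0"
    \<comment> \<open>On a nodal domain \<open>C\<close> the combination reduces to
      \<open>\<Psi>\<close> with its coefficient for \<open>C\<close> plus the other basis elements
      with coefficients from the subdomains around \<open>C\<close>. It is one eigenwave vanishing
      on an open set, so unique continuation and independence of \<open>B\<close> force the
      coefficients to vanish.\<close>
    have key: "c (C, \<Psi>) = 0 \<and> (\<forall>\<psi>\<in>B'. (\<Sum>D\<in>{D\<in>DD. C \<subseteq> D}. c (D, \<psi>)) = 0)" if C: "C \<in> CC" for C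
    proof -
      define a where "a \<psi> = (if \<psi> = \<Psi> then c (C, \<Psi>) else (\<Sum>D\<in>{D\<in>DD. C \<subseteq> D}. c (D, \<psi>)))" for \<psi>
      have sumT: "(\<Sum>t\<in>T. c t * f t x) = (\<Sum>\<psi>\<in>B. a \<psi> * \<psi> x)" if x: "x \<in> C" for x
      proof -
        have "(\<Sum>t\<in>T. c t * f t x) = (\<Sum>C'\<in>CC. c (C', \<Psi>) * f (C', \<Psi>) x) + (\<Sum>t\<in>DD \<times> B'. c t * f t x)"
          unfolding T_def using CC DD B' disj
          by (subst sum.union_disjoint) (auto simp: sum.reindex[OF inj])
        also have "(\<Sum>C'\<in>CC. c (C', \<Psi>) * f (C', \<Psi>) x) = (\<Sum>C'\<in>CC. if C' = C then c (C, \<Psi>) * \<Psi> x else 0)"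
          using CC'[OF C] x by (intro sum.cong refl) (auto simp: f_def)
        also have "\<dots> = c (C, \<Psi>) * \<Psi> x" using CC(1) C by simp
        also have "(\<Sum>t\<in>DD \<times> B'. c t * f t x) = (\<Sum>\<psi>\<in>B'. \<Sum>D\<in>DD. c (D, \<psi>) * f (D, \<psi>) x)"
          by (subst sum.swap) (simp add: sum.cartesian_product split_def)
        also have "\<dots> = (\<Sum>\<psi>\<in>B'. (\<Sum>D\<in>{D\<in>DD. C \<subseteq> D}. c (D, \<psi>)) * \<psi> x)"
        proof (rule sum.cong[OF refl])
          fix \<psi>
          have "(\<Sum>D\<in>DD. c (D, \<psi>) * f (D, \<psi>) x) = (\<Sum>D\<in>{D\<in>DD. C \<subseteq> D}. c (D, \<psi>) * f (D, \<psi>) x)"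
            using DD(1) CD[OF C] x by (intro sum.mono_neutral_right) (auto simp: f_def)
          also have "\<dots> = (\<Sum>D\<in>{D\<in>DD. C \<subseteq> D}. c (D, \<psi>)) * \<psi> x"
            unfolding sum_distrib_right using x by (intro sum.cong) (auto simp: f_def)
          finally show "(\<Sum>D\<in>DD. c (D, \<psi>) * f (D, \<psi>) x) = (\<Sum>D\<in>{D\<in>DD. C \<subseteq> D}. c (D, \<psi>)) * \<psi> x" .
        qed
        also have "\<dots> = (\<Sum>\<psi>\<in>B'. a \<psi> * \<psi> x)"
          using B'(2) by (intro sum.cong) (auto simp: a_def)
        finally show ?thesis using B' by (simp add: a_def)
      qed
      define g where "g = (\<Sum>\<psi>\<in>B. (\<lambda>x. a \<psi> * \<psi> x))"
      have "g \<in> eigenwaves \<mu>"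
        unfolding g_def
        using B(2)
        by (intro function_space.subspace_sum[OF subspace_eigenwaves]
            function_space.subspace_scale[OF subspace_eigenwaves]) auto
      moreover have "g x = 0" if x: "x \<in> C" for x
      proof -
        have "g x = (\<Sum>\<psi>\<in>B. a \<psi> * \<psi> x)" by (simp add: g_def sum_fun_apply)
        also have "\<dots> = 0" using sumT[OF x] zero[of x] sub1(1)[OF C] x by auto
        finally show ?thesis .
      qed
      ultimately have "g = 0"
        using eigenwaves_unique_continuation[of g \<mu> C] sub1[OF C] by blast
      then have a0: "a \<psi> = 0" if "\<psi> \<in> B" for \<psi>
        using function_space.independentD[OF B(3) finB order.refl, of a] that by (auto simp: g_def)
      show ?thesis
      proof (intro conjI ballI)
        show "c (C, \<Psi>) = 0" using a0[of \<Psi>] B'(1) by (simp add: a_def)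
        fix \<psi> assume \<psi>: "\<psi> \<in> B'"
        then have "\<psi> \<noteq> \<Psi>" using B'(2) by blast
        then show "(\<Sum>D\<in>{D\<in>DD. C \<subseteq> D}. c (D, \<psi>)) = 0"
          using a0[of \<psi>] B'(1) \<psi> by (simp add: a_def)
      qed
    qed
    show "\<forall>t\<in>T. c t = 0"
    proof
      fix t assume "t \<in> T"
      then consider C where "C \<in> CC" "t = (C, \<Psi>)" | D \<psi> where "D \<in> DD" "\<psi> \<in> B'" "t = (D, \<psi>)"
        by (auto simp: T_def)
      then show "c t = 0"
      proof cases
        case 1
        then show ?thesis using key by blast
      next
        case 2
        obtain C where C: "C \<in> CC" "C \<subseteq> D" using DD(3)[OF 2(1)] by blast
        have "{D'\<in>DD. C \<subseteq> D'} = {D}"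
          using C 2(1) DD'[OF 2(1)] sub1(2)[OF C(1)] by blast
        then show ?thesis using key[OF C(1)] 2 by auto
      qed
    qed
  qed
qed

text \<open>The finite bound itself yields finiteness: too many nodal domains violate it even with
  no subdomain chosen. Each subdomain contains a nodal domain, and disjointness makes this choice
  injective, so the subdomains are finitely many too.\<close>

lemma nodal_count_bound:
  assumes \<Psi>: "\<Psi> \<in> eigenwaves \<mu>" "\<Psi> \<noteq> 0" and "0 \<le> \<mu>"
    and "closed S" and vanish: "\<forall>\<Phi>\<in>eigenwaves \<mu>. \<forall>x\<in>S. \<Phi> x = 0"
  shows "finite (components (U - {x. \<Psi> x = 0}))" "finite (components (U - S))" "components (U - S) \<noteq> {}"
    "card (components (U - {x. \<Psi> x = 0})) + card (components (U - S)) * (multiplicity_of \<Omega> \<mu> - 1)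
      \<le> (\<Sum>\<nu> | neumann_eigenvalue \<Omega> \<nu> \<and> \<nu> \<le> \<mu>. multiplicity_of \<Omega> \<nu>)" (is "_ \<le> ?K")
proof -
  let ?C = "components (U - {x. \<Psi> x = 0})"
  let ?D = "components (U - S)"
  have S: "closed S" "\<And>\<Phi> x. \<Phi> \<in> eigenwaves \<mu> \<Longrightarrow> x \<in> S \<Longrightarrow> x \<in> U \<Longrightarrow> \<Phi> x = 0"
    using \<open>closed S\<close> vanish by auto
  have bound: "card CC + card DD * (multiplicity_of \<Omega> \<mu> - 1) \<le> ?K"
    if "finite CC" "CC \<subseteq> ?C" "finite DD" "DD \<subseteq> ?D" "\<And>D. D \<in> DD \<Longrightarrow> \<exists>C\<in>CC. C \<subseteq> D" for CC DD
    by (rule nodal_count_bound_finite[where S = S]) (fact \<Psi> assms(3) S that)+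
  show finC: "finite ?C"
  proof (rule ccontr)
    assume "infinite ?C"
    then obtain X where X: "finite X" "card X = Suc ?K" "X \<subseteq> ?C"
      using infinite_arbitrarily_large by blast
    show False using bound[OF X(1,3), of "{}"] X(2) by simp
  qed
  have ex: "\<exists>C\<in>?C. C \<subseteq> D" if D: "D \<in> ?D" for D
  proof -
    have "open D" using open_components[OF open_Diff[OF open_U S(1)] D] .
    then obtain x where x: "x \<in> D" "\<Psi> x \<noteq> 0"
      using eigenwaves_unique_continuation[OF \<Psi>(1), of D] \<Psi>(2) in_components_nonempty[OF D] by blast
    have xU: "x \<in> U" using x in_components_subset[OF D] by blast
    then obtain C where C: "C \<in> ?C" "x \<in> C"
      using x Union_components[of "U - {x. \<Psi> x = 0}"] by blast
    have "C \<subseteq> U - S" using in_components_subset[OF C(1)] S(2)[OF \<Psi>(1)] by blast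
    then have "C \<subseteq> D"
      using components_maximal[OF D in_components_connected[OF C(1)]] C x by blast
    then show ?thesis using C by blast
  qed
  obtain h where h: "\<And>D. D \<in> ?D \<Longrightarrow> h D \<in> ?C \<and> h D \<subseteq> D"
    using ex by metis
  have "inj_on h ?D"
  proof (rule inj_onI)
    fix D D' assume D: "D \<in> ?D" "D' \<in> ?D" "h D = h D'"
    have "h D \<noteq> {}" using h D(1) in_components_nonempty by blast
    then have "D \<inter> D' \<noteq> {}" using h[OF D(1)] h[OF D(2)] D(3) by auto
    then show "D = D'" using components_eq[OF D(1,2)] by blast
  qed
  then show finD: "finite ?D"
    using h finC by (intro inj_on_finite[of h ?D ?C]) auto
  show "?D \<noteq> {}"
  proof
    assume "?D = {}"
    then have "U - S = {}" using Union_components[of "U - S"] by auto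
    then have "\<Psi> x = 0" if "x \<in> U" for x using S(2)[OF \<Psi>(1)] that by blast
    then show False using eigenwaves_unique_continuation[OF \<Psi>(1) open_U nonempty] \<Psi>(2) by blast
  qed
  show "card ?C + card ?D * (multiplicity_of \<Omega> \<mu> - 1) \<le> ?K"
    by (rule bound[OF finC order.refl finD order.refl ex])
qed

end

section \<open>Folding\<close>

text \<open>
  \<open>K\<close> is the adjoint of the fold map, so that composing a wave with the fold map applies \<open>K\<close> to its wave
  vector. The odd vectors are those whose waves change sign under the reflection of the domain.
\<close>

locale folding_reflection_domain = reflection_domain H G L
  for H :: "('a::euclidean_space \<times> real) set" and G L +
  fixes D :: "'a folding_domain" and K :: "'a \<Rightarrow> 'a" and odd_vec :: "'a \<Rightarrow> bool"
  assumes domain_set_eq: "domain_set D = closed_polytope H"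
    and closed_half: "closed (half_set D)"
    and closed_mid: "closed (mid_set D)"
    and mid_fixed: "x \<in> mid_set D \<Longrightarrow> reflection D x = x"
    and half_boundary_fixed: "x \<in> half_set D \<Longrightarrow> x \<in> closure (domain_set D - half_set D) \<Longrightarrow> reflection D x = x"
    and continuous_fold: "continuous_on UNIV (fold_map D)"
    and continuous_reflection: "continuous_on UNIV (reflection D)"
    and surj_fold: "surj (fold_map D)"
    and fold_adjoint: "v \<bullet> fold_map D x = K v \<bullet> x"
    and K_L: "v \<in> L \<Longrightarrow> K v \<in> L"
    and bij_K: "bij K"
    and K_normalizes: "g \<in> G \<Longrightarrow> \<exists>g'\<in>G. \<forall>v. K (g v) = g' (K v)"
    and K_norm: "K v \<bullet> K v = (ratio D)\<^sup>2 * (v \<bullet> v)"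
    and ratio_pos: "0 < ratio D"
    and reflection_parity: "v \<in> L \<Longrightarrow>
      wave G v (reflection D x) = (if odd_vec v then - wave G v x else wave G v x)"
    and parity_norm: "u \<in> L \<Longrightarrow> v \<in> L \<Longrightarrow> u \<bullet> u = v \<bullet> v \<Longrightarrow> odd_vec u \<longleftrightarrow> odd_vec v"
    and even_iff: "v \<in> L \<Longrightarrow> \<not> odd_vec v \<longleftrightarrow> v \<in> K ` L"
    and odd_spectrum_eq: "odd_spectrum D = {v \<bullet> v | v. v \<in> L \<and> odd_vec v}"
begin

text \<open>Moving \<open>K\<close> past the elements of \<open>G\<close> permutes them: the induced
  map \<open>\<sigma>\<close> is injective because \<open>K\<close> is bijective, and
  \<open>G\<close> is finite.\<close>

lemma wave_fold: "wave G v (fold_map D x) = wave G (K v) x"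
proof -
  obtain \<sigma> where \<sigma>: "\<And>g. g \<in> G \<Longrightarrow> \<sigma> g \<in> G" "\<And>g v. g \<in> G \<Longrightarrow> K (g v) = \<sigma> g (K v)"
    using K_normalizes by metis
  have inj: "inj_on \<sigma> G"
  proof (rule inj_onI)
    fix g h assume "g \<in> G" "h \<in> G" "\<sigma> g = \<sigma> h"
    then have "K (g v) = K (h v)" for v by (simp add: \<sigma>(2))
    then show "g = h" using bij_is_inj[OF bij_K] by (auto simp: fun_eq_iff dest: injD)
  qed
  moreover have "\<sigma> ` G = G" using \<sigma>(1) finite_G inj by (intro endo_inj_surj) auto
  ultimately have bij: "bij_betw \<sigma> G G" by (simp add: bij_betw_def)
  have "wave G v (fold_map D x) = (\<Sum>g\<in>G. cos (\<sigma> g (K v) \<bullet> x))"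
    unfolding wave_def by (intro sum.cong) (simp_all add: fold_adjoint \<sigma>(2))
  also have "\<dots> = wave G (K v) x"
    unfolding wave_def using bij by (rule sum.reindex_bij_betw)
  finally show ?thesis .
qed

lemma K_power: "v \<in> L \<Longrightarrow> (K ^^ k) v \<in> L"
  "(K ^^ k) v \<bullet> (K ^^ k) v = ratio D ^ (2 * k) * (v \<bullet> v)"
  by (induction k) (auto simp: K_L K_norm power_add power2_eq_square)

lemma frame_Suc: "frame D (Suc k) = unfold_set D (frame D k)"
  by (simp add: frame_def)

text \<open>The second branch of \<open>unfold_set\<close> lives on a set that is not closed.
  Passing to its closure adds only points of the half set that the reflection fixes, where both
  branches impose the same condition.\<close>

lemma closed_frame: "closed (frame D k)"
proof (induction k)
  case 0
  show ?case by (simp add: frame_def closed_mid)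
next
  case (Suc k)
  have closed_dom: "closed (domain_set D)"
    unfolding domain_set_eq using compact_\<Omega> by (rule compact_imp_closed)
  have sub: "closure (domain_set D - half_set D) \<subseteq> domain_set D"
    using closed_dom by (intro closure_minimal) auto
  have "frame D (Suc k) = (half_set D \<inter> fold_map D -` frame D k) \<union>
      (closure (domain_set D - half_set D) \<inter> (fold_map D \<circ> reflection D) -` frame D k)"
    unfolding frame_Suc unfold_set_def
    using half_boundary_fixed sub closure_subset[of "domain_set D - half_set D"] by auto
  moreover have "closed (fold_map D -` frame D k)" "closed ((fold_map D \<circ> reflection D) -` frame D k)"
    using Suc continuous_fold continuous_reflection continuous_on_compose[OF continuous_reflection, of "fold_map D"]
      continuous_on_subset[OF continuous_fold, of "range (reflection D)"]
    by (auto intro!: closed_vimage)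
  ultimately show ?case using closed_half by auto
qed

text \<open>The induction unfolds one level at a time: at level \<open>0\<close> an odd wave changes
  sign under a reflection that fixes the point; at a higher level the wave is even and equals a wave
  of the previous level composed with the fold map.\<close>

lemma wave_vanishes_on_frame:
  assumes "v0 \<in> L" "odd_vec v0"
  shows "v \<in> L \<Longrightarrow> v \<bullet> v = ratio D ^ (2 * k) * (v0 \<bullet> v0) \<Longrightarrow> x \<in> frame D k \<Longrightarrow> wave G v x = 0"
proof (induction k arbitrary: v x)
  case 0
  then have "odd_vec v" using parity_norm[of v v0] assms by simp
  moreover have "reflection D x = x" using 0 by (intro mid_fixed) (simp add: frame_def)
  ultimately show ?case using reflection_parity[OF 0(1), of x] by simp
next
  case (Suc k)
  \<comment> \<open>A reference vector of the same norm as \<open>v\<close> whose parity is known: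
    it lies in the image of \<open>K\<close>, so it is even, and parity depends on the norm
    alone.\<close>
  let ?w = "(K ^^ Suc k) v0"
  have "?w \<in> L" using assms(1) by (rule K_power)
  have "v \<bullet> v = ?w \<bullet> ?w" unfolding K_power(2) by (rule Suc.prems(2))
  have "\<not> odd_vec ?w" using even_iff[OF \<open>?w \<in> L\<close>] K_power(1)[OF assms(1), of k] by auto
  then have ev: "\<not> odd_vec v"
    using parity_norm[OF Suc.prems(1) \<open>?w \<in> L\<close> \<open>v \<bullet> v = ?w \<bullet> ?w\<close>] by blast
  then obtain u where u: "u \<in> L" "v = K u" using even_iff[OF Suc.prems(1)] by blast
  have "(ratio D)\<^sup>2 * (u \<bullet> u) = (ratio D)\<^sup>2 * (ratio D ^ (2 * k) * (v0 \<bullet> v0))"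
    using Suc.prems(2) K_norm[of u] u(2) by (simp add: power2_eq_square)
  then have "u \<bullet> u = ratio D ^ (2 * k) * (v0 \<bullet> v0)" using ratio_pos by simp
  note IH = Suc.IH[OF u(1) this]
  have refl: "wave G v (reflection D x) = wave G v x" using reflection_parity[OF Suc.prems(1)] ev by simp
  show ?case
    using Suc.prems(3) IH wave_fold[of u x] wave_fold[of u "reflection D x"] refl
    unfolding frame_Suc unfold_set_def u(2) by auto
qed

lemma eigenwaves_vanish_on_frame:
  assumes "v0 \<in> L" "odd_vec v0" "\<Phi> \<in> eigenwaves (ratio D ^ (2 * k) * (v0 \<bullet> v0))" "x \<in> frame D k"
  shows "\<Phi> x = 0"
  using assms(3) unfolding eigenwaves_def
proof (induction \<Phi> rule: function_space.span_induct_alt)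
  case base
  show ?case by simp
next
  case (step c y z)
  then show ?case using wave_vanishes_on_frame[OF assms(1,2) _ _ assms(4)] by auto
qed

text \<open>Composition with the fold map is injective because the fold map is surjective, and it
  sends waves to waves of the scaled eigenvalue.\<close>

lemma multiplicity_fold: "multiplicity_of \<Omega> \<nu> \<le> multiplicity_of \<Omega> ((ratio D)\<^sup>2 * \<nu>)"
proof -
  define T where "T f x = f (fold_map D x)" for f :: "'a \<Rightarrow> real" and x
  have lin: "Vector_Spaces.linear (\<lambda>c f x. c * f x) (\<lambda>c f x. c * f x) T"
    by unfold_locales (auto simp: T_def fun_eq_iff algebra_simps)
  then interpret T: Vector_Spaces.linear "\<lambda>c f x. c * f x" "\<lambda>c f x. c * f x" T .
  have injT: "inj T"
  proof (rule injI)
    fix f g assume "T f = T g"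
    then have "f (fold_map D x) = g (fold_map D x)" for x by (simp add: T_def fun_eq_iff)
    then show "f = g" using surj_fold by (metis ext surjD)
  qed
  have T: "T f \<in> eigenwaves ((ratio D)\<^sup>2 * \<nu>)" if "f \<in> eigenwaves \<nu>" for f
  proof -
    have "T ` (wave G ` {v \<in> L. v \<bullet> v = \<nu>}) \<subseteq> wave G ` {v \<in> L. v \<bullet> v = (ratio D)\<^sup>2 * \<nu>}"
    proof (clarify)
      fix v assume v: "v \<in> L" "\<nu> = v \<bullet> v"
      have "T (wave G v) = wave G (K v)" by (simp add: T_def fun_eq_iff wave_fold)
      then show "T (wave G v) \<in> wave G ` {u \<in> L. u \<bullet> u = (ratio D)\<^sup>2 * (v \<bullet> v)}"
        using K_L[OF v(1)] K_norm[of v] by auto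
    qed
    then have "T ` eigenwaves \<nu> \<subseteq> eigenwaves ((ratio D)\<^sup>2 * \<nu>)"
      unfolding eigenwaves_def T.span_image[symmetric] by (rule function_space.span_mono)
    then show ?thesis using that by blast
  qed
  obtain B where B: "B \<subseteq> eigenwaves \<nu>" "function_space.independent B" "card B = multiplicity_of \<Omega> \<nu>"
    using eigenwaves_basis by metis
  obtain B' where B': "eigenwaves ((ratio D)\<^sup>2 * \<nu>) = function_space.span B'" "finite B'"
    "card B' = multiplicity_of \<Omega> ((ratio D)\<^sup>2 * \<nu>)"
    using eigenwaves_basis by metis
  have "function_space.independent (T ` B)"
    using T.independent_injective_image[OF B(2)] injT by (simp add: inj_on_subset)
  then have "card (T ` B) \<le> card B'"
    using function_space.independent_span_bound[OF B'(2)] T B(1) B'(1) by blast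
  then show ?thesis using B(3) B'(3) injT by (simp add: card_image inj_on_subset)
qed

lemma multiplicity_fold_power: "multiplicity_of \<Omega> \<nu> \<le> multiplicity_of \<Omega> (ratio D ^ (2 * k) * \<nu>)"
proof (induction k)
  case (Suc k)
  also have "multiplicity_of \<Omega> (ratio D ^ (2 * k) * \<nu>) \<le> multiplicity_of \<Omega> ((ratio D)\<^sup>2 * (ratio D ^ (2 * k) * \<nu>))"
    by (rule multiplicity_fold)
  finally show ?case by (simp add: power2_eq_square mult_ac)
qed simp

text \<open>The first claim ensures that the infimum in the second is taken over a nonempty set of
  eigenfunctions.\<close>

lemma nodal_deficiency_bound:
  assumes "\<mu>\<^sub>0 \<in> odd_spectrum D"
  shows "neumann_eigenvalue (domain_set D) (ratio D ^ (2 * k) * \<mu>\<^sub>0)"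
    "nodal_deficiency (domain_set D) (ratio D ^ (2 * k) * \<mu>\<^sub>0)
      \<ge> (ereal (real (multiplicity_of (domain_set D) \<mu>\<^sub>0)) - 1) * (ereal_of_enat (num_subdomains D k) - 1)"
proof -
  obtain v0 where v0: "v0 \<in> L" "odd_vec v0" "\<mu>\<^sub>0 = v0 \<bullet> v0"
    using assms by (auto simp: odd_spectrum_eq)
  define \<mu> where "\<mu> = ratio D ^ (2 * k) * \<mu>\<^sub>0"
  have "0 \<le> \<mu>" using ratio_pos by (simp add: \<mu>_def v0(3))
  show ev: "neumann_eigenvalue (domain_set D) (ratio D ^ (2 * k) * \<mu>\<^sub>0)"
    unfolding domain_set_eq neumann_eigenvalue_iff v0(3)
    using K_power(1)[OF v0(1), of k] K_power(2)[where v = v0 and k = k] by blast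
  let ?e = "multiplicity_of \<Omega> \<mu>\<^sub>0" and ?d = "multiplicity_of \<Omega> \<mu>"
  have d0: "?e \<le> ?d" unfolding \<mu>_def by (rule multiplicity_fold_power)
  have "(ereal (real ?e) - 1) * (ereal_of_enat (num_subdomains D k) - 1) \<le> deficiency_fun \<Omega> \<mu> \<phi>"
    if ef: "neumann_eigenfunction \<Omega> \<mu> \<phi>" for \<phi>
  proof -
    obtain \<Psi> where \<Psi>: "\<Psi> \<in> eigenwaves \<mu>" "\<phi> = restr \<Psi>" "\<phi> \<noteq> 0"
      using ef unfolding neumann_eigenfunction_def neumann_eigenspace_eq by blast
    have "\<Psi> \<noteq> 0"
    proof
      assume "\<Psi> = 0"
      then have "\<phi> = 0" by (simp add: \<Psi>(2) restr_def fun_eq_iff)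
      with \<Psi>(3) show False ..
    qed
    let ?C = "components (U - {x. \<Psi> x = 0})" and ?D = "components (U - frame D k)"
    have "\<forall>\<Phi>\<in>eigenwaves \<mu>. \<forall>x\<in>frame D k. \<Phi> x = 0"
      using eigenwaves_vanish_on_frame[OF v0(1,2), where k = k] by (simp add: \<mu>_def v0(3))
    note bound = nodal_count_bound[OF \<Psi>(1) \<open>\<Psi> \<noteq> 0\<close> \<open>0 \<le> \<mu>\<close> closed_frame[of k] this]
    \<comment> \<open>Needed to read the truncated difference \<open>?d - 1\<close> of natural
      numbers as a real difference.\<close>
    have "0 < ?d"
    proof (rule ccontr)
      assume "\<not> 0 < ?d"
      then obtain B where "eigenwaves \<mu> = function_space.span B" "finite B" "card B = 0"
        using eigenwaves_basis[of \<mu>] by (metis gr0I)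
      then have "eigenwaves \<mu> = {0}" by simp
      with \<Psi>(1) \<open>\<Psi> \<noteq> 0\<close> show False by simp
    qed
    have "card ?D \<noteq> 0" using bound(2,3) by simp
    have set_eq: "U - {x. \<phi> x = 0} = U - {x. \<Psi> x = 0}" by (auto simp: \<Psi>(2) restr_def)
    have nodal: "nodal_count \<Omega> \<phi> = enat (card ?C)"
      unfolding nodal_count_def interior_\<Omega> set_eq num_components_def using bound(1) by simp
    have sub: "num_subdomains D k = enat (card ?D)"
      unfolding num_subdomains_def domain_set_eq interior_\<Omega> num_components_def using bound(2) by simp
    have fin: "finite {\<nu>. neumann_eigenvalue \<Omega> \<nu> \<and> \<nu> < \<mu>}"
      by (rule finite_subset[OF _ finite_eigenvalues[of \<mu>]]) auto
    have "{\<nu>. neumann_eigenvalue \<Omega> \<nu> \<and> \<nu> \<le> \<mu>} = insert \<mu> {\<nu>. neumann_eigenvalue \<Omega> \<nu> \<and> \<nu> < \<mu>}"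
      using ev by (auto simp: domain_set_eq \<mu>_def)
    then have "(\<Sum>\<nu> | neumann_eigenvalue \<Omega> \<nu> \<and> \<nu> \<le> \<mu>. multiplicity_of \<Omega> \<nu>) + 1 = spectral_position \<Omega> \<mu> + ?d"
      using fin by (simp add: spectral_position_def)
    with bound(4) have "card ?C + card ?D * (?d - 1) + 1 \<le> spectral_position \<Omega> \<mu> + ?d" by linarith
    then have "real (card ?C + card ?D * (?d - 1) + 1) \<le> real (spectral_position \<Omega> \<mu> + ?d)"
      by (rule of_nat_mono)
    then have "real (card ?C) + real (card ?D) * (real ?d - 1) + 1 \<le> real (spectral_position \<Omega> \<mu>) + real ?d"
      using \<open>0 < ?d\<close> by (simp add: of_nat_diff)
    \<comment> \<open>There is at least one subdomain, so the second factor is nonnegative and the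
      multiplicity of \<open>\<mu>\<close> may be replaced by the smaller one of
      \<open>\<mu>\<^sub>0\<close>.\<close>
    moreover have "(real ?e - 1) * (real (card ?D) - 1) \<le> (real ?d - 1) * (real (card ?D) - 1)"
      using d0 \<open>card ?D \<noteq> 0\<close> by (intro mult_right_mono) auto
    ultimately have "(real ?e - 1) * (real (card ?D) - 1) \<le> real (spectral_position \<Omega> \<mu>) - real (card ?C)"
      by (simp add: algebra_simps)
    then show ?thesis
      unfolding deficiency_fun_def nodal sub by (simp add: one_ereal_def)
  qed
  then show "nodal_deficiency (domain_set D) (ratio D ^ (2 * k) * \<mu>\<^sub>0)
      \<ge> (ereal (real (multiplicity_of (domain_set D) \<mu>\<^sub>0)) - 1) * (ereal_of_enat (num_subdomains D k) - 1)"
    unfolding nodal_deficiency_def domain_set_eq \<mu>_def[symmetric] by (intro INF_greatest) simp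
qed

end

section \<open>The triangle\<close>

definition signed_swap :: "real \<Rightarrow> real \<Rightarrow> bool \<Rightarrow> real \<times> real \<Rightarrow> real \<times> real" where
  "signed_swap a b s = (\<lambda>(x, y). if s then (a * y, b * x) else (a * x, b * y))"

text \<open>The fold matrix is symmetric, so the adjoint acting on wave vectors has the same formula
  as the fold map itself.\<close>

definition sum_diff :: "real \<times> real \<Rightarrow> real \<times> real" where
  "sum_diff = (\<lambda>(x, y). (x + y, x - y))"

text \<open>The symmetry group of the square, of order eight, generated by the linear parts of the
  reflections in the three sides.\<close>

definition dihedral :: "(real \<times> real \<Rightarrow> real \<times> real) set" where
  "dihedral = (\<lambda>(a, b, s). signed_swap a b s) ` ({1, -1} \<times> {1, -1} \<times> UNIV)"

definition triangle_walls :: "((real \<times> real) \<times> real) set" where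
  "triangle_walls = {((0, 1), 0), ((1, -1), 0), ((-1, 0), pi)}"

definition integer_lattice :: "(real \<times> real) set" where
  "integer_lattice = {(of_int m, of_int n) | m n. True}"

definition odd_pair :: "real \<times> real \<Rightarrow> bool" where
  "odd_pair v \<longleftrightarrow> (\<exists>m n. v = (of_int m, of_int n) \<and> odd (m + n))"

lemma odd_pair_iff: "odd_pair (of_int m, of_int n) \<longleftrightarrow> odd (m + n)"
  by (auto simp: odd_pair_def)

lemma inj_on_signed_swap: "inj_on (\<lambda>(a, b, s). signed_swap a b s) ({1, -1} \<times> {1, -1} \<times> UNIV)"
proof (rule inj_onI)
  fix p q assume p: "p \<in> {1, -1} \<times> {1, -1} \<times> UNIV" and q: "q \<in> {1, -1} \<times> {1, -1} \<times> UNIV"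
    and eq: "(case p of (a, b, s) \<Rightarrow> signed_swap a b s) = (case q of (a, b, s) \<Rightarrow> signed_swap a b s)"
  \<comment> \<open>A point whose coordinates have distinct nonzero absolute values reveals both
    signs and the exchange.\<close>
  from fun_cong[OF eq, of "(1, 2)"] p q show "p = q"
    by (auto simp: signed_swap_def split: if_splits)
qed

text \<open>Summation over the signs turns plane waves into products of cosines; the result is four
  times the classical eigenfunction of the triangle.\<close>

lemma dihedral_wave:
  "wave dihedral (m, n) (x, y) = 4 * (cos (m * x) * cos (n * y) + cos (n * x) * cos (m * y))"
proof -
  have "wave dihedral (m, n) (x, y) =
      (\<Sum>(a, b, s)\<in>{1, -1} \<times> {1, -1} \<times> UNIV. cos (signed_swap a b s (m, n) \<bullet> (x, y)))"
    unfolding wave_def dihedral_def by (subst sum.reindex[OF inj_on_signed_swap]) (simp add: split_def)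
  also have "\<dots> = (\<Sum>a\<in>{1, -1}. \<Sum>b\<in>{1, -1}. \<Sum>s\<in>UNIV. cos (signed_swap a b s (m, n) \<bullet> (x, y)))"
    by (simp add: sum.cartesian_product)
  also have "\<dots> = 4 * (cos (m * x) * cos (n * y) + cos (n * x) * cos (m * y))"
    by (simp add: UNIV_bool signed_swap_def cos_add cos_diff)
  finally show ?thesis .
qed

lemma dihedral_cases:
  assumes "g \<in> dihedral"
  obtains a b s where "a \<in> {1, -1}" "b \<in> {1, -1}" "g = signed_swap a b s"
  using assms by (auto simp: dihedral_def)

lemma signed_swap_dihedral: "a \<in> {1, -1} \<Longrightarrow> b \<in> {1, -1} \<Longrightarrow> signed_swap a b s \<in> dihedral"
  unfolding dihedral_def by (rule image_eqI[of _ _ "(a, b, s)"]) auto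

lemma closed_polytope_triangle: "closed_polytope triangle_walls = triangle_set"
  by (auto simp: closed_polytope_def triangle_walls_def triangle_set_def)

lemma cos_of_int_mult_pi_minus:
  "cos (of_int m * (pi - t)) = (if even m then cos (of_int m * t) else - cos (of_int m * t))"
  by (simp add: right_diff_distrib cos_diff mult.commute[of _ pi])

section \<open>The triangle as a folding reflection domain\<close>

lemma finite_walls: "finite triangle_walls"
  by (simp add: triangle_walls_def)

lemma bounded_triangle: "bounded (closed_polytope triangle_walls)"
proof -
  have "triangle_set \<subseteq> cbox (0, 0) (pi, pi)"
    by (auto simp: triangle_set_def cbox_Pair_eq)
  then show ?thesis
    unfolding closed_polytope_triangle by (rule bounded_subset[OF bounded_cbox])
qed

lemma triangle_nonempty: "open_polytope triangle_walls \<noteq> {}"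
proof -
  have "(2, 1) \<in> open_polytope triangle_walls"
    using pi_gt3 by (simp add: open_polytope_def triangle_walls_def)
  then show ?thesis by blast
qed

lemma walls_nonzero:
  assumes "h \<in> triangle_walls"
  shows "fst h \<noteq> 0"
  using assms by (auto simp: triangle_walls_def zero_prod_def)

lemma finite_dihedral: "finite dihedral"
  by (simp add: dihedral_def)

lemma id_signed_swap: "id = signed_swap 1 1 False"
  by (auto simp: signed_swap_def)

lemma id_dihedral: "id \<in> dihedral"
  unfolding id_signed_swap by (rule signed_swap_dihedral) auto

lemma dihedral_comp:
  assumes "g \<in> dihedral" "g' \<in> dihedral"
  shows "g \<circ> g' \<in> dihedral"
proof -
  obtain a b s where g: "a \<in> {1, -1}" "b \<in> {1, -1}" "g = signed_swap a b s"
    using assms(1) by (rule dihedral_cases)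
  obtain a' b' s' where g': "a' \<in> {1, -1}" "b' \<in> {1, -1}" "g' = signed_swap a' b' s'"
    using assms(2) by (rule dihedral_cases)
  have "g \<circ> g' = (if s then signed_swap (a * b') (b * a') (\<not> s') else signed_swap (a * a') (b * b') s')"
    by (auto simp: g(3) g'(3) signed_swap_def fun_eq_iff)
  also have "\<dots> \<in> dihedral" using g(1,2) g'(1,2) by (auto intro!: signed_swap_dihedral)
  finally show ?thesis .
qed

lemma dihedral_orthogonal:
  assumes "g \<in> dihedral"
  shows "orthogonal_transformation g"
  using assms
proof (rule dihedral_cases)
  fix a b s assume *: "a \<in> {1, -1}" "b \<in> {1, -1}" "g = signed_swap a b s"
  have "linear g" unfolding *(3) by (rule linearI) (auto simp: signed_swap_def algebra_simps)
  then show ?thesis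
    using *(1,2) by (auto simp: orthogonal_transformation_def *(3) signed_swap_def)
qed

lemma dihedral_reflections:
  assumes "h \<in> triangle_walls"
  shows "(\<lambda>w. w - (2 * (w \<bullet> fst h) / (fst h \<bullet> fst h)) *\<^sub>R fst h) \<in> dihedral"
proof -
  have "(\<lambda>w. w - (2 * (w \<bullet> (0, 1)) / ((0, 1) \<bullet> ((0, 1) :: real \<times> real))) *\<^sub>R (0, 1)) = signed_swap 1 (-1) False"
    "(\<lambda>w. w - (2 * (w \<bullet> (1, -1)) / ((1, -1) \<bullet> ((1, -1) :: real \<times> real))) *\<^sub>R (1, -1)) = signed_swap 1 1 True"
    "(\<lambda>w. w - (2 * (w \<bullet> (-1, 0)) / ((-1, 0) \<bullet> ((-1, 0) :: real \<times> real))) *\<^sub>R (-1, 0)) = signed_swap (-1) 1 False"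
    by (auto simp: signed_swap_def fun_eq_iff algebra_simps inner_real_def)
  then show ?thesis
    using assms by (auto simp: triangle_walls_def intro: signed_swap_dihedral)
qed

lemma lattice_int: "(0, 0) \<in> integer_lattice" "\<And>m n. (of_int m, of_int n) \<in> integer_lattice"
  unfolding integer_lattice_def by (auto intro: exI[of _ 0])

lemma zero_lattice: "0 \<in> integer_lattice"
  using lattice_int(1) by (simp add: zero_prod_def)

lemma lattice_add:
  assumes "u \<in> integer_lattice" "v \<in> integer_lattice"
  shows "u + v \<in> integer_lattice"
  using assms lattice_int(2) by (auto simp: integer_lattice_def simp flip: of_int_add)

lemma lattice_diff:
  assumes "u \<in> integer_lattice" "v \<in> integer_lattice"
  shows "u - v \<in> integer_lattice"
  using assms lattice_int(2) by (auto simp: integer_lattice_def simp flip: of_int_diff)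

lemma lattice_dihedral:
  assumes "g \<in> dihedral" "v \<in> integer_lattice"
  shows "g v \<in> integer_lattice"
  using assms(1)
proof (rule dihedral_cases)
  fix a b s assume *: "a \<in> {1, -1}" "b \<in> {1, -1}" "g = signed_swap a b s"
  obtain m n where v: "v = (of_int m, of_int n)" using assms(2) by (auto simp: integer_lattice_def)
  show ?thesis
    using *(1,2) lattice_int(2)[of m n] lattice_int(2)[of m "-n"] lattice_int(2)[of "-m" n] lattice_int(2)[of "-m" "-n"]
      lattice_int(2)[of n m] lattice_int(2)[of n "-m"] lattice_int(2)[of "-n" m] lattice_int(2)[of "-n" "-m"]
    by (cases s) (auto simp: *(3) v signed_swap_def)
qed

lemma abs_le_ceiling_of_square_le:
  fixes m :: int
  assumes "real_of_int m * real_of_int m \<le> r"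
  shows "\<bar>m\<bar> \<le> \<lceil>r\<rceil>"
proof -
  have "\<bar>m\<bar> * 1 \<le> \<bar>m\<bar> * \<bar>m\<bar>"
  proof (cases "m = 0")
    case False
    then show ?thesis by (intro mult_left_mono) auto
  qed simp
  then have "\<bar>m\<bar> \<le> m * m" by simp
  then have "real_of_int \<bar>m\<bar> \<le> real_of_int (m * m)" by (simp only: of_int_le_iff)
  also have "\<dots> \<le> r" using assms by simp
  also have "r \<le> of_int \<lceil>r\<rceil>" by (rule le_of_int_ceiling)
  finally show ?thesis by (simp only: of_int_le_iff)
qed

lemma lattice_discrete: "finite {v \<in> integer_lattice. v \<bullet> v \<le> r}"
proof (rule finite_subset)
  show "{v \<in> integer_lattice. v \<bullet> v \<le> r} \<subseteq>
      (\<lambda>(m, n). (of_int m, of_int n)) ` ({-\<lceil>r\<rceil>..\<lceil>r\<rceil>} \<times> {-\<lceil>r\<rceil>..\<lceil>r\<rceil>})"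
  proof
    fix v assume "v \<in> {v \<in> integer_lattice. v \<bullet> v \<le> r}"
    then obtain m n where v: "v = (of_int m, of_int n)" "of_int m * of_int m + of_int n * of_int n \<le> r"
      by (auto simp: integer_lattice_def)
    have "of_int m * of_int m \<le> r" "of_int n * of_int n \<le> r"
      using v(2) zero_le_square[of "real_of_int m"] zero_le_square[of "real_of_int n"] by linarith+
    then have "\<bar>m\<bar> \<le> \<lceil>r\<rceil>" "\<bar>n\<bar> \<le> \<lceil>r\<rceil>" by (auto intro!: abs_le_ceiling_of_square_le)
    then show "v \<in> (\<lambda>(m, n). (of_int m, of_int n)) ` ({-\<lceil>r\<rceil>..\<lceil>r\<rceil>} \<times> {-\<lceil>r\<rceil>..\<lceil>r\<rceil>})"
      unfolding v(1) by (intro image_eqI[of _ _ "(m, n)"]) auto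
  qed
qed simp

lemma lattice_walls:
  assumes "v \<in> integer_lattice" "h \<in> triangle_walls"
  shows "\<exists>k. (v \<bullet> fst h) * snd h / (fst h \<bullet> fst h) = pi * of_int k"
proof -
  obtain m n where "v = (of_int m, of_int n)" using assms(1) by (auto simp: integer_lattice_def)
  then show ?thesis
    using assms(2) by (auto simp: triangle_walls_def intro: exI[of _ 0] exI[of _ "- m"])
qed

text \<open>The waves of \<open>(1, 0)\<close> and \<open>(1, 1)\<close> give the sum and the
  product of the two cosines, hence the unordered pair. The ordering of coordinates in the triangle
  and injectivity of the cosine on \<open>{0..pi}\<close> recover the point.\<close>

lemma lattice_separates: "\<exists>v\<in>integer_lattice. wave dihedral v x \<noteq> wave dihedral v y"
  if x: "x \<in> closed_polytope triangle_walls" and y: "y \<in> closed_polytope triangle_walls" and "x \<noteq> y" for x y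
proof (rule ccontr)
  assume neg: "\<not> ?thesis"
  obtain x1 x2 where x12: "x = (x1, x2)" by (cases x)
  obtain y1 y2 where y12: "y = (y1, y2)" by (cases y)
  have xs: "0 \<le> x2" "x2 \<le> x1" "x1 \<le> pi" and ys: "0 \<le> y2" "y2 \<le> y1" "y1 \<le> pi"
    using x y unfolding closed_polytope_triangle by (auto simp: triangle_set_def x12 y12)
  have "wave dihedral (1, 0) x = wave dihedral (1, 0) y" "wave dihedral (1, 1) x = wave dihedral (1, 1) y"
    using neg lattice_int(2)[of 1 0] lattice_int(2)[of 1 1] by auto
  then have s: "cos x1 + cos x2 = cos y1 + cos y2" and p: "cos x1 * cos x2 = cos y1 * cos y2"
    by (auto simp: x12 y12 dihedral_wave)
  have ord: "cos x1 \<le> cos x2" "cos y1 \<le> cos y2"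
    using xs ys by (auto intro: cos_monotone_0_pi_le)
  have "(cos x1 - cos y1) * (cos x1 - cos y2) = cos x1 * cos x1 - cos x1 * (cos y1 + cos y2) + cos y1 * cos y2"
    by (simp add: algebra_simps)
  also have "\<dots> = 0" unfolding s[symmetric] p[symmetric] by (simp add: algebra_simps)
  finally have "cos x1 = cos y1 \<or> cos x1 = cos y2" by simp
  then have "cos x1 = cos y1 \<and> cos x2 = cos y2" using s ord by auto
  then have "x1 = y1" "x2 = y2" using xs ys cos_inj_pi by auto
  then show False using \<open>x \<noteq> y\<close> by (simp add: x12 y12)
qed

lemma triangle_domain: "domain_set triangle = closed_polytope triangle_walls"
  by (simp add: closed_polytope_triangle triangle_def)

lemma closed_triangle_set: "closed triangle_set"
proof -
  have eq: "triangle_set = {z. 0 \<le> fst z} \<inter> {z. fst z \<le> pi} \<inter> {z. 0 \<le> snd z} \<inter> {z. snd z \<le> pi} \<inter> {z. snd z \<le> fst z}"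
    by (auto simp: triangle_set_def)
  show ?thesis unfolding eq by (intro closed_Int closed_Collect_le continuous_intros)
qed

lemma half_triangle: "half_set triangle = triangle_set \<inter> {z. fst z + snd z \<le> pi}"
  by (auto simp: triangle_def triangle_set_def)

lemma closed_half_triangle: "closed (half_set triangle)"
  unfolding half_triangle using closed_triangle_set by (intro closed_Int closed_Collect_le continuous_intros)

lemma closed_mid_triangle: "closed (mid_set triangle)"
proof -
  have "mid_set triangle = triangle_set \<inter> {z. fst z + snd z = pi}"
    by (auto simp: triangle_def)
  then show ?thesis
    using closed_triangle_set by (auto intro!: closed_Int closed_Collect_eq continuous_intros)
qed

lemma mid_fixed_triangle:
  assumes "x \<in> mid_set triangle"
  shows "reflection triangle x = x"
  using assms by (auto simp: triangle_def)

lemma half_fixed_triangle: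
  assumes "x \<in> half_set triangle" "x \<in> closure (domain_set triangle - half_set triangle)"
  shows "reflection triangle x = x"
proof -
  have "closure (domain_set triangle - half_set triangle) \<subseteq> {z. pi \<le> fst z + snd z}"
    by (intro closure_minimal closed_Collect_le continuous_intros) (auto simp: half_triangle, auto simp: triangle_def)
  then have "fst x + snd x = pi" using assms by (auto simp: half_triangle)
  then show ?thesis by (auto simp: triangle_def split_def prod_eq_iff)
qed

lemma continuous_triangle: "continuous_on UNIV (fold_map triangle)" "continuous_on UNIV (reflection triangle)"
  by (auto simp: triangle_def split_def intro!: continuous_intros)

lemma surj_fold_triangle: "surj (fold_map triangle)"
  unfolding surj_def
proof
  fix z :: "real \<times> real"
  show "\<exists>w. z = fold_map triangle w"
    by (intro exI[of _ "((fst z + snd z) / 2, (fst z - snd z) / 2)"])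
      (simp add: triangle_def prod_eq_iff field_simps)
qed

lemma fold_adjoint_triangle: "v \<bullet> fold_map triangle x = sum_diff v \<bullet> x"
  by (auto simp: triangle_def sum_diff_def split_def inner_prod_def algebra_simps)

lemma sum_diff_lattice:
  assumes "v \<in> integer_lattice"
  shows "sum_diff v \<in> integer_lattice"
  using assms lattice_int(2) by (auto simp: sum_diff_def integer_lattice_def simp flip: of_int_add of_int_diff)

lemma bij_sum_diff: "bij sum_diff"
proof (rule bij_betw_byWitness[of _ "\<lambda>(x, y). ((x + y) / 2, (x - y) / 2)"])
qed (auto simp: sum_diff_def field_simps)

text \<open>Up to the factor \<open>sqrt 2\<close>, \<open>sum_diff\<close> is the reflection in a
  line at an angle of 22.5 degrees, and this reflection normalizes the symmetry group of the
  square.\<close>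

lemma sum_diff_dihedral:
  assumes "g \<in> dihedral"
  shows "\<exists>g'\<in>dihedral. \<forall>v. sum_diff (g v) = g' (sum_diff v)"
  using assms
proof (rule dihedral_cases)
  fix a b s assume *: "a \<in> {1, -1}" "b \<in> {1, -1}" "g = signed_swap a b s"
  \<comment> \<open>The conjugate exchanges the coordinates exactly when the two signs of
    \<open>g\<close> differ.\<close>
  define h where "h = (if s then signed_swap (if a = b then a else - a) (if a = b then - a else a) (a \<noteq> b)
    else signed_swap a a (a \<noteq> b))"
  have "sum_diff (g v) = h (sum_diff v)" for v
    using *(1,2) by (auto simp: *(3) h_def sum_diff_def signed_swap_def split_def algebra_simps)
  moreover have "h \<in> dihedral" using *(1,2) by (auto simp: h_def intro!: signed_swap_dihedral)
  ultimately show ?thesis by blast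
qed

lemma sum_diff_norm: "sum_diff v \<bullet> sum_diff v = (ratio triangle)\<^sup>2 * (v \<bullet> v)"
  by (auto simp: triangle_def sum_diff_def split_def inner_prod_def algebra_simps)

lemma ratio_triangle: "0 < ratio triangle"
  by (simp add: triangle_def)

lemma parity_reflection_triangle:
  assumes "v \<in> integer_lattice"
  shows "wave dihedral v (reflection triangle x) = (if odd_pair v then - wave dihedral v x else wave dihedral v x)"
proof -
  obtain m n where v: "v = (of_int m, of_int n)" using assms by (auto simp: integer_lattice_def)
  obtain x1 x2 where x: "x = (x1, x2)" by (cases x)
  show ?thesis
    unfolding v x
    by (auto simp: triangle_def dihedral_wave odd_pair_iff cos_of_int_mult_pi_minus)
qed

text \<open>Squaring preserves parity, so the parity of a lattice vector can be read off from its
  squared norm.\<close>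

lemma norm_parity: "odd_pair (of_int m, of_int n) \<longleftrightarrow> odd (m\<^sup>2 + n\<^sup>2)"
  by (simp add: odd_pair_iff)

lemma parity_norm_triangle:
  assumes "u \<in> integer_lattice" "v \<in> integer_lattice" "u \<bullet> u = v \<bullet> v"
  shows "odd_pair u \<longleftrightarrow> odd_pair v"
proof -
  obtain m n where u: "u = (of_int m, of_int n)" using assms(1) by (auto simp: integer_lattice_def)
  obtain m' n' where v: "v = (of_int m', of_int n')" using assms(2) by (auto simp: integer_lattice_def)
  have "real_of_int (m\<^sup>2 + n\<^sup>2) = real_of_int (m'\<^sup>2 + n'\<^sup>2)"
    using assms(3) by (simp add: u v power2_eq_square)
  then have "m\<^sup>2 + n\<^sup>2 = m'\<^sup>2 + n'\<^sup>2" by (simp only: of_int_eq_iff)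
  then show ?thesis unfolding u v norm_parity by simp
qed

lemma even_iff_triangle:
  assumes "v \<in> integer_lattice"
  shows "\<not> odd_pair v \<longleftrightarrow> v \<in> sum_diff ` integer_lattice"
proof -
  obtain m n where v: "v = (of_int m, of_int n)" using assms by (auto simp: integer_lattice_def)
  show ?thesis
  proof
    assume "\<not> odd_pair v"
    then have "even (m + n)" by (simp add: v odd_pair_iff)
    then obtain p where p: "m + n = 2 * p" by blast
    then have m: "m = 2 * p - n" by simp
    show "v \<in> sum_diff ` integer_lattice"
      by (rule image_eqI[OF _ lattice_int(2)[of p "p - n"]]) (simp add: v m sum_diff_def)
  next
    assume "v \<in> sum_diff ` integer_lattice"
    then obtain p q where "v = (of_int (p + q), of_int (p - q))"
      by (auto simp: sum_diff_def integer_lattice_def)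
    then show "\<not> odd_pair v" by (simp only: odd_pair_iff) simp
  qed
qed

text \<open>The lattice contains all signs and both orders, while the spectrum is indexed by ordered
  pairs of naturals; absolute values and a swap preserve both norm and parity.\<close>

lemma odd_spectrum_triangle: "odd_spectrum triangle = {v \<bullet> v |v. v \<in> integer_lattice \<and> odd_pair v}"
proof (intro equalityI subsetI)
  fix t assume "t \<in> odd_spectrum triangle"
  then obtain m n :: nat where mn: "t = (real m)\<^sup>2 + (real n)\<^sup>2" "m mod 2 \<noteq> n mod 2"
    by (auto simp: triangle_def)
  let ?v = "(of_int (int m), of_int (int n)) :: real \<times> real"
  have "odd_pair ?v" using mn(2) unfolding odd_pair_iff by presburger
  moreover have "t = ?v \<bullet> ?v" by (simp add: mn(1) power2_eq_square)
  ultimately show "t \<in> {v \<bullet> v |v. v \<in> integer_lattice \<and> odd_pair v}" using lattice_int(2) by blast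
next
  fix t assume "t \<in> {v \<bullet> v |v. v \<in> integer_lattice \<and> odd_pair v}"
  then obtain m n where mn: "t = (of_int m)\<^sup>2 + (of_int n)\<^sup>2" "odd (m + n)"
    by (auto simp: integer_lattice_def odd_pair_iff power2_eq_square)
  define p where "p = nat \<bar>m\<bar>"
  define q where "q = nat \<bar>n\<bar>"
  have t: "t = (real p)\<^sup>2 + (real q)\<^sup>2" by (simp add: mn(1) p_def q_def)
  have "odd (p + q)" using mn(2) by (simp add: p_def q_def even_nat_iff)
  then have pq: "p mod 2 \<noteq> q mod 2" by presburger
  show "t \<in> odd_spectrum triangle"
  proof (cases "q \<le> p")
    case True
    then show ?thesis using t pq by (auto simp: triangle_def)
  next
    case False
    then have "p \<le> q" "q mod 2 \<noteq> p mod 2" "t = (real q)\<^sup>2 + (real p)\<^sup>2" using t pq by auto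
    then show ?thesis by (auto simp: triangle_def)
  qed
qed

interpretation triangle: folding_reflection_domain triangle_walls dihedral integer_lattice triangle
  sum_diff odd_pair
  by unfold_locales (fact finite_walls bounded_triangle triangle_nonempty walls_nonzero
      finite_dihedral id_dihedral dihedral_comp dihedral_orthogonal dihedral_reflections
      zero_lattice lattice_add lattice_diff lattice_dihedral lattice_discrete lattice_walls
      lattice_separates triangle_domain closed_half_triangle closed_mid_triangle
      mid_fixed_triangle half_fixed_triangle continuous_triangle surj_fold_triangle
      fold_adjoint_triangle sum_diff_lattice bij_sum_diff sum_diff_dihedral sum_diff_norm
      ratio_triangle parity_reflection_triangle parity_norm_triangle even_iff_triangle
      odd_spectrum_triangle)+

section \<open>Parity of the wave vectors of the boxes\<close>

text \<open>Integer coefficients are kept while evaluating at a real point, because content and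
  parity of the coefficients carry the argument.\<close>

definition int_poly_eval :: "int poly \<Rightarrow> real \<Rightarrow> real" where
  "int_poly_eval p x = poly (map_poly of_int p) x"

lemma int_poly_eval_0: "int_poly_eval 0 x = 0"
  by (simp add: int_poly_eval_def)

lemma int_poly_eval_pCons: "int_poly_eval (pCons a p) x = of_int a + x * int_poly_eval p x"
  by (simp add: int_poly_eval_def map_poly_pCons)

lemma int_poly_eval_add: "int_poly_eval (p + q) x = int_poly_eval p x + int_poly_eval q x"
  by (induction p q rule: poly_induct2)
    (simp_all add: int_poly_eval_0 int_poly_eval_pCons algebra_simps)

lemma int_poly_eval_smult: "int_poly_eval (smult c p) x = of_int c * int_poly_eval p x"
  by (induction p) (simp_all add: int_poly_eval_0 int_poly_eval_pCons algebra_simps)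

lemma int_poly_eval_mult: "int_poly_eval (p * q) x = int_poly_eval p x * int_poly_eval q x"
  by (induction p)
    (simp_all add: int_poly_eval_0 int_poly_eval_pCons int_poly_eval_add int_poly_eval_smult
      mult_pCons_left algebra_simps)

lemma int_poly_eval_monom: "int_poly_eval (monom c n) x = of_int c * x ^ n"
  by (simp add: int_poly_eval_def map_poly_monom poly_monom)

lemma int_poly_eval_sum: "int_poly_eval (\<Sum>i\<in>I. p i) x = (\<Sum>i\<in>I. int_poly_eval (p i) x)"
  by (induction I rule: infinite_finite_induct) (simp_all add: int_poly_eval_0 int_poly_eval_add)

text \<open>Modulo \<open>2\<close> the lowest nonzero terms multiply, so the vanishing orders at
  the origin add up.\<close>

lemma odd_coeff_mult:
  fixes p q :: "int poly"
  assumes "\<exists>i. odd (coeff p i)" "\<exists>j. odd (coeff q j)"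
  shows "odd (coeff (p * q) ((LEAST i. odd (coeff p i)) + (LEAST j. odd (coeff q j))))"
proof -
  let ?i = "LEAST i. odd (coeff p i)" and ?j = "LEAST j. odd (coeff q j)"
  have ij: "odd (coeff p ?i)" "odd (coeff q ?j)" using LeastI_ex[OF assms(1)] LeastI_ex[OF assms(2)] .
  have "even (coeff p k * coeff q (?i + ?j - k))" if "k \<in> {..?i + ?j} - {?i}" for k
  proof (cases "k < ?i")
    case True
    then show ?thesis using not_less_Least[of k "\<lambda>i. odd (coeff p i)"] by simp
  next
    case False
    then have "?i + ?j - k < ?j" using that by auto
    then show ?thesis using not_less_Least[of "?i + ?j - k" "\<lambda>j. odd (coeff q j)"] by simp
  qed
  then have "even (\<Sum>k\<in>{..?i + ?j} - {?i}. coeff p k * coeff q (?i + ?j - k))"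
    by (intro dvd_sum) auto
  moreover have "coeff (p * q) (?i + ?j) =
      coeff p ?i * coeff q ?j + (\<Sum>k\<in>{..?i + ?j} - {?i}. coeff p k * coeff q (?i + ?j - k))"
    unfolding coeff_mult by (subst sum.remove[of _ ?i]) auto
  ultimately show ?thesis using ij by simp
qed

text \<open>
  Eisenstein's argument: the primitive minimal polynomial \<open>q\<close> of \<open>x\<close> divides \<open>X\<^sup>n - 2\<close>, which is
  \<open>X\<^sup>n\<close> modulo \<open>2\<close>, so all coefficients of \<open>q\<close> but the leading one are even, and \<open>q\<close> divides every
  other integer polynomial that vanishes at \<open>x\<close>.
\<close>

lemma even_constant_coeff_of_root:
  fixes p :: "int poly"
  assumes x: "x ^ n = 2" and n: "0 < n" and root: "int_poly_eval p x = 0"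
  shows "even (coeff p 0)"
proof -
  let ?X = "monom 1 n - [:2:] :: int poly"
  have coeffX: "coeff ?X k = (if k = n then 1 else 0) - (if k = 0 then 2 else 0)" for k
    by (simp add: coeff_monom coeff_pCons split: nat.split)
  have X0: "?X \<noteq> 0"
  proof
    assume "?X = 0"
    then have "coeff ?X n = 0" by (simp only: coeff_0)
    then show False using n unfolding coeffX by simp
  qed
  have "int_poly_eval (?X + [:2:]) x = 2" by (simp add: int_poly_eval_monom x)
  then have Xroot: "int_poly_eval ?X x = 0"
    unfolding int_poly_eval_add by (simp add: int_poly_eval_pCons int_poly_eval_0)
  define d where "d = (LEAST d. \<exists>q. q \<noteq> 0 \<and> int_poly_eval q x = 0 \<and> degree q = d)"
  have "\<exists>q. q \<noteq> 0 \<and> int_poly_eval q x = 0 \<and> degree q = d"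
    unfolding d_def by (rule LeastI[of _ "degree ?X"]) (use X0 Xroot in blast)
  then obtain q0 where q0: "q0 \<noteq> 0" "int_poly_eval q0 x = 0" "degree q0 = d" by blast
  define q where "q = primitive_part q0"
  have c0: "content q0 \<noteq> 0" using q0(1) by simp
  have "of_int (content q0) * int_poly_eval q x = 0"
    unfolding q_def int_poly_eval_smult[symmetric] by (simp add: q0(2))
  then have qroot: "int_poly_eval q x = 0" using c0 by simp
  have q: "q \<noteq> 0" "degree q = d" "content q = 1"
    using q0 by (auto simp: q_def content_primitive_part)
  have min: "r = 0 \<or> d \<le> degree r" if "int_poly_eval r x = 0" for r
    unfolding d_def using that by (auto intro: Least_le)
  have dvd: "q dvd f" if f: "int_poly_eval f x = 0" for f
  proof -
    \<comment> \<open>Pseudo-division stays over the integers at the price of the factor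
      \<open>c\<close>. The remainder vanishes by minimality of the degree; primitivity of
      \<open>q\<close> and multiplicativity of contents then allow \<open>c\<close> to be
      cancelled.\<close>
    obtain r s where rs: "pseudo_divmod f q = (r, s)" by (cases "pseudo_divmod f q")
    define c where "c = coeff q (degree q) ^ (Suc (degree f) - degree q)"
    have eq: "smult c f = q * r + s" and deg: "s = 0 \<or> degree s < degree q"
      using pseudo_divmod[OF q(1) rs] by (auto simp: c_def)
    have "int_poly_eval (q * r + s) x = 0"
      unfolding eq[symmetric] int_poly_eval_smult f by simp
    then have "int_poly_eval s x = 0" by (simp add: int_poly_eval_add int_poly_eval_mult qroot)
    then have "s = 0" using min[of s] deg q(2) by auto
    then have eq: "smult c f = q * r" using eq by simp
    have "c \<noteq> 0" using q(1) by (simp add: c_def)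
    have "content r = content (q * r)" by (simp add: content_mult q(3))
    also have "\<dots> = normalize c * content f" by (simp add: content_smult flip: eq)
    finally have "c dvd content r" by simp
    then have "[:c:] dvd r" by (simp only: const_poly_dvd_iff_dvd_content)
    then obtain r' where "r = [:c:] * r'" by (rule dvdE)
    then have r': "r = smult c r'" by simp
    have "smult c f = smult c (q * r')" using eq by (simp add: r')
    then have "smult c (f - q * r') = 0" by (simp only: smult_diff_right diff_self)
    then have "f = q * r'" using \<open>c \<noteq> 0\<close> by (simp only: smult_eq_0_iff right_minus_eq) simp
    then show ?thesis by simp
  qed
  obtain r where r: "?X = q * r" using dvd[OF Xroot] by blast
  have r0: "r \<noteq> 0" using X0 r by auto
  have lead: "degree ?X = n"
  proof (rule antisym)
    show "degree ?X \<le> n" by (rule degree_le, unfold coeffX) simp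
    show "n \<le> degree ?X" by (rule le_degree, unfold coeffX) (use n in simp)
  qed
  have n_sum: "degree q + degree r = n" using degree_mult_eq[OF q(1) r0] lead r by simp
  have lc: "coeff q (degree q) * coeff r (degree r) = 1"
    using coeff_mult_degree_sum[of q r] coeffX[of n] n n_sum r by simp
  have odds: "odd (coeff q (degree q))" "odd (coeff r (degree r))"
  proof -
    have "odd (coeff q (degree q) * coeff r (degree r))" unfolding lc by simp
    then show "odd (coeff q (degree q))" "odd (coeff r (degree r))" by auto
  qed
  let ?i = "LEAST i. odd (coeff q i)" and ?j = "LEAST j. odd (coeff r j)"
  have "odd (coeff ?X (?i + ?j))" unfolding r using odds by (intro odd_coeff_mult) blast+
  \<comment> \<open>The only odd coefficient of the product is the leading one. Both lowest odd
    positions are at most the degrees, whose sum is also \<open>n\<close>, so each equals its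
    degree.\<close>
  then have "?i + ?j = n" unfolding coeffX by (auto split: if_splits)
  moreover have "?i \<le> degree q" "?j \<le> degree r" using odds by (auto intro: Least_le)
  ultimately have i: "?i = degree q" using n_sum by linarith
  have "degree q \<noteq> 0"
  proof
    assume "degree q = 0"
    then obtain a where "q = [:a:]" by (rule degree_eq_zeroE)
    then show False using qroot q(1) by (simp add: int_poly_eval_pCons int_poly_eval_0)
  qed
  then have "even (coeff q 0)" using not_less_Least[of 0 "\<lambda>i. odd (coeff q i)"] i by simp
  moreover obtain s where "p = q * s" using dvd[OF root] by blast
  ultimately show ?thesis by (simp add: coeff_mult_0)
qed

section \<open>The boxes\<close>

lemma position_le: "1 \<le> position i" "position i \<le> CARD('n)" for i :: "'n::{finite,linorder}"
proof -
  have "i \<in> {..i}" by simp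
  then have "0 < card {..i}" by (auto simp: card_gt_0_iff)
  then show "1 \<le> position i" by (simp add: position_def)
  show "position i \<le> CARD('n)" unfolding position_def by (intro card_mono) auto
qed

lemma bij_betw_position: "bij_betw (position :: 'n::{finite,linorder} \<Rightarrow> nat) UNIV {1..CARD('n)}"
proof -
  have inj: "inj (position :: 'n \<Rightarrow> nat)" by (metis axis_of_position injI)
  have "range (position :: 'n \<Rightarrow> nat) \<subseteq> {1..CARD('n)}" using position_le by auto
  then have "range (position :: 'n \<Rightarrow> nat) = {1..CARD('n)}"
    using inj by (intro card_subset_eq) (auto simp: card_image)
  with inj show ?thesis by (simp add: bij_betw_def)
qed

lemma position_axis_of:
  assumes "j \<in> {1..CARD('n)}"
  shows "position (axis_of j :: 'n::{finite,linorder}) = j"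
proof -
  obtain i :: 'n where "j = position i" using assms bij_betw_position by (metis bij_betw_imp_surj_on imageE)
  then show ?thesis by (simp add: axis_of_position)
qed

definition first :: "'n::{finite,linorder}" where
  "first = axis_of 1"

definition next_axis :: "'n::{finite,linorder} \<Rightarrow> 'n" where
  "next_axis i = axis_of (if position i = CARD('n) then 1 else position i + 1)"

definition prev_axis :: "'n::{finite,linorder} \<Rightarrow> 'n" where
  "prev_axis i = axis_of (if position i = 1 then CARD('n) else position i - 1)"

lemma position_first: "position (first :: 'n::{finite,linorder}) = 1"
  unfolding first_def by (rule position_axis_of) (simp add: Suc_leI)

lemma position_eq_1_iff: "position i = 1 \<longleftrightarrow> i = first"
  by (metis axis_of_position first_def position_first)

lemma position_next:
  "position (next_axis i) = (if position i = CARD('n) then 1 else position i + 1)" for i :: "'n::{finite,linorder}"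
  unfolding next_axis_def using position_le[of i] by (intro position_axis_of) (auto simp: Suc_leI)

lemma position_prev:
  "position (prev_axis i) = (if position i = 1 then CARD('n) else position i - 1)" for i :: "'n::{finite,linorder}"
  unfolding prev_axis_def using position_le[of i] by (intro position_axis_of) (auto simp: Suc_leI)

lemma position_inject: "position i = position j \<longleftrightarrow> i = j"
  by (metis axis_of_position)

lemma next_prev: "next_axis (prev_axis i) = i"
  and prev_next: "prev_axis (next_axis i) = i"
  for i :: "'n::{finite,linorder}"
  using position_le[of i]
  by (auto simp: position_prev position_next position_inject[symmetric])

lemma bij_prev: "bij (prev_axis :: 'n::{finite,linorder} \<Rightarrow> 'n)"
  by (rule bij_betw_byWitness[of _ next_axis]) (auto simp: next_prev prev_next)

text \<open>The reciprocal side length of the box in units of \<open>pi\<close>, and also the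
  spacing of the wave vectors along this axis.\<close>

definition axis_scale :: "'n::{finite,linorder} \<Rightarrow> real" where
  "axis_scale i = box_gamma CARD('n) ^ (position i - 1)"

lemma box_gamma_power: "0 < n \<Longrightarrow> box_gamma n ^ n = 2"
  by (simp add: box_gamma_def powr_powr flip: powr_realpow)

lemma box_gamma_ge_1: "1 \<le> box_gamma n"
  by (simp add: box_gamma_def ge_one_powr_ge_zero)

lemma axis_scale_ge_1: "1 \<le> axis_scale i"
  by (simp add: axis_scale_def box_gamma_ge_1)

lemma axis_scale_pos [simp]: "0 < axis_scale i"
  using axis_scale_ge_1[of i] by linarith

lemma axis_scale_nonzero [simp]: "axis_scale i \<noteq> 0"
  by (rule less_imp_neq[OF axis_scale_pos, symmetric])

lemma axis_scale_first: "axis_scale first = 1"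
  by (simp add: axis_scale_def position_first)

text \<open>A cyclic shift matches the geometric scales except at the wrap-around, where the full
  power of the ratio gives \<open>2\<close>. This factor makes the first component even in the image
  of the fold.\<close>

lemma axis_scale_prev: "box_gamma CARD('n) * axis_scale (prev_axis i) = (if i = first then 2 else axis_scale i)"
  for i :: "'n::{finite,linorder}"
proof (cases "i = first")
  case True
  have "box_gamma CARD('n) * axis_scale (prev_axis i) = box_gamma CARD('n) ^ Suc (CARD('n) - 1)"
    unfolding True axis_scale_def position_prev position_first power_Suc by simp
  also have "Suc (CARD('n) - 1) = CARD('n)" by simp
  also have "box_gamma CARD('n) ^ CARD('n) = 2" by (simp add: box_gamma_power)
  finally show ?thesis using True by simp
next
  case False
  then have "position i \<noteq> 1" using position_eq_1_iff by blast
  then have eq: "position i - 1 = Suc (position i - 1 - 1)" using position_le(1)[of i] by simp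
  have "box_gamma CARD('n) * axis_scale (prev_axis i) = axis_scale i"
    unfolding axis_scale_def position_prev if_not_P[OF \<open>position i \<noteq> 1\<close>] power_Suc[symmetric] eq[symmetric]
    by (rule refl)
  then show ?thesis using False by (simp only: if_False)
qed

definition sign_flip :: "('n::finite \<Rightarrow> bool) \<Rightarrow> (real, 'n) vec \<Rightarrow> (real, 'n) vec" where
  "sign_flip s x = (\<chi> i. if s i then - x $ i else x $ i)"

definition sign_flips :: "((real, 'n::finite) vec \<Rightarrow> (real, 'n) vec) set" where
  "sign_flips = range sign_flip"

definition box_walls :: "((real, 'n::{finite,linorder}) vec \<times> real) set" where
  "box_walls = range (\<lambda>i. (axis i 1, 0)) \<union> range (\<lambda>i. (axis i (-1), pi / axis_scale i))"

definition lattice_vec :: "('n::{finite,linorder} \<Rightarrow> int) \<Rightarrow> (real, 'n) vec" where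
  "lattice_vec m = (\<chi> i. axis_scale i * of_int (m i))"

definition odd_lattice_vec :: "(real, 'n::{finite,linorder}) vec \<Rightarrow> bool" where
  "odd_lattice_vec v \<longleftrightarrow> (\<exists>m. v = lattice_vec m \<and> odd (m first))"

text \<open>Adjoint of the fold map: it shifts the coordinates in the opposite cyclic
  direction.\<close>

definition box_dual_fold :: "(real, 'n::{finite,linorder}) vec \<Rightarrow> (real, 'n) vec" where
  "box_dual_fold v = (\<chi> i. box_gamma CARD('n) * v $ prev_axis i)"

lemma lattice_vec_inject: "lattice_vec m = lattice_vec m' \<longleftrightarrow> m = m'"
  by (auto simp: lattice_vec_def vec_eq_iff fun_eq_iff)

lemma odd_lattice_vec_iff: "odd_lattice_vec (lattice_vec m) \<longleftrightarrow> odd (m first)"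
  by (auto simp: odd_lattice_vec_def lattice_vec_inject)

lemma linear_sign_flip: "linear (sign_flip s)"
  by (rule linearI) (auto simp: sign_flip_def vec_eq_iff)

lemma sign_flip_inner: "sign_flip s x \<bullet> sign_flip s y = x \<bullet> y"
  by (auto simp: sign_flip_def inner_vec_def intro: sum.cong)

lemma sign_flip_lattice_vec: "sign_flip s (lattice_vec m) = lattice_vec (\<lambda>i. if s i then - m i else m i)"
  by (auto simp: sign_flip_def lattice_vec_def vec_eq_iff)

lemma box_dual_fold_lattice_vec:
  "box_dual_fold (lattice_vec m) = lattice_vec (\<lambda>i. if i = first then 2 * m (prev_axis i) else m (prev_axis i))"
  by (auto simp: box_dual_fold_def lattice_vec_def vec_eq_iff axis_scale_prev axis_scale_first simp flip: mult.assoc)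

lemma lattice_vec_norm:
  "lattice_vec m \<bullet> lattice_vec m = (\<Sum>i\<in>UNIV. (axis_scale i * of_int (m i))\<^sup>2)"
  by (simp add: lattice_vec_def inner_vec_def power2_eq_square)

section \<open>The box as a reflection domain\<close>

lemma box_set_eq: "(box_set :: (real, 'n::{finite,linorder}) vec set) = {x. \<forall>i. 0 \<le> x $ i \<and> x $ i \<le> pi / axis_scale i}"
proof -
  have "(\<forall>j\<in>{1..CARD('n)}. x $ axis_of j \<in> {0..pi / box_gamma CARD('n) ^ (j - 1)}) \<longleftrightarrow>
      (\<forall>i. 0 \<le> x $ i \<and> x $ i \<le> pi / axis_scale i)" for x :: "(real, 'n) vec"
  proof
    assume A: "\<forall>j\<in>{1..CARD('n)}. x $ axis_of j \<in> {0..pi / box_gamma CARD('n) ^ (j - 1)}"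
    show "\<forall>i. 0 \<le> x $ i \<and> x $ i \<le> pi / axis_scale i"
    proof
      fix i :: 'n
      show "0 \<le> x $ i \<and> x $ i \<le> pi / axis_scale i"
        using A[rule_format, of "position i"] position_le[of i] by (simp add: axis_of_position axis_scale_def)
    qed
  next
    assume A: "\<forall>i. 0 \<le> x $ i \<and> x $ i \<le> pi / axis_scale i"
    show "\<forall>j\<in>{1..CARD('n)}. x $ axis_of j \<in> {0..pi / box_gamma CARD('n) ^ (j - 1)}"
    proof
      fix j assume "j \<in> {1..CARD('n)}"
      then show "x $ axis_of j \<in> {0..pi / box_gamma CARD('n) ^ (j - 1)}"
        using A[rule_format, of "axis_of j"] by (simp add: axis_scale_def position_axis_of)
    qed
  qed
  then show ?thesis by (simp add: box_set_def)
qed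

lemma closed_polytope_box: "closed_polytope box_walls = box_set"
  unfolding box_set_eq
  by (auto simp: closed_polytope_def box_walls_def inner_axis' ball_Un)

text \<open>A wave depending on one coordinate only; these waves already separate the points of the
  box.\<close>

lemma wave_axis:
  "wave sign_flips (lattice_vec (\<lambda>k. if k = i then 1 else 0)) x =
    real (card (sign_flips :: ((real, 'n) vec \<Rightarrow> (real, 'n) vec) set)) * cos (axis_scale i * x $ i)"
  for x :: "(real, 'n::{finite,linorder}) vec"
proof -
  have "cos (sign_flip s (lattice_vec (\<lambda>k. if k = i then 1 else 0)) \<bullet> x) = cos (axis_scale i * x $ i)"
    for s :: "'n \<Rightarrow> bool"
  proof -
    have "sign_flip s (lattice_vec (\<lambda>k. if k = i then 1 else 0)) \<bullet> x =
        (\<Sum>k\<in>UNIV. if k = i then (if s i then - (axis_scale i * x $ i) else axis_scale i * x $ i) else 0)"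
      unfolding inner_vec_def by (rule sum.cong) (auto simp: sign_flip_def lattice_vec_def)
    also have "\<dots> = (if s i then - (axis_scale i * x $ i) else axis_scale i * x $ i)" by simp
    finally show ?thesis by simp
  qed
  then have "wave sign_flips (lattice_vec (\<lambda>k. if k = i then 1 else 0)) x =
      (\<Sum>g\<in>(sign_flips :: ((real, 'n) vec \<Rightarrow> (real, 'n) vec) set). cos (axis_scale i * x $ i))"
    unfolding wave_def by (intro sum.cong) (auto simp: sign_flips_def)
  then show ?thesis by simp
qed

lemma finite_sign_flips: "finite (sign_flips :: ((real, 'n::finite) vec \<Rightarrow> (real, 'n) vec) set)"
  by (simp add: sign_flips_def)

lemma box_discrete:
  "finite {v \<in> range (lattice_vec :: _ \<Rightarrow> (real, 'n::{finite,linorder}) vec). v \<bullet> v \<le> r}"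
proof (rule finite_subset)
  show "{v \<in> range (lattice_vec :: _ \<Rightarrow> (real, 'n) vec). v \<bullet> v \<le> r} \<subseteq> lattice_vec ` (UNIV \<rightarrow>\<^sub>E {-\<lceil>r\<rceil>..\<lceil>r\<rceil>})"
  proof
    fix v :: "(real, 'n) vec" assume "v \<in> {v \<in> range lattice_vec. v \<bullet> v \<le> r}"
    then obtain m where m: "v = lattice_vec m" "(\<Sum>i\<in>UNIV. (axis_scale i * of_int (m i))\<^sup>2) \<le> r"
      by (auto simp: lattice_vec_norm)
    have "\<bar>m i\<bar> \<le> \<lceil>r\<rceil>" for i
    proof (rule abs_le_ceiling_of_square_le)
      have "1 * (real_of_int (m i) * of_int (m i)) \<le> (axis_scale i * axis_scale i) * (real_of_int (m i) * of_int (m i))"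
        using axis_scale_ge_1[of i] mult_mono[of 1 "axis_scale i" 1 "axis_scale i"] by (intro mult_right_mono) auto
      also have "\<dots> = (axis_scale i * of_int (m i))\<^sup>2" by (simp add: power2_eq_square)
      also have "\<dots> \<le> (\<Sum>i\<in>UNIV. (axis_scale i * of_int (m i))\<^sup>2)" by (rule member_le_sum) auto
      finally show "real_of_int (m i) * of_int (m i) \<le> r" using m(2) by simp
    qed
    then have "m \<in> UNIV \<rightarrow>\<^sub>E {-\<lceil>r\<rceil>..\<lceil>r\<rceil>}" by (auto simp: abs_le_iff) (metis minus_le_iff)
    then show "v \<in> lattice_vec ` (UNIV \<rightarrow>\<^sub>E {-\<lceil>r\<rceil>..\<lceil>r\<rceil>})" using m(1) by blast
  qed
qed (intro finite_imageI finite_PiE, auto)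

lemma reflection_domain_box:
  "reflection_domain box_walls sign_flips (range (lattice_vec :: ('n::{finite,linorder} \<Rightarrow> int) \<Rightarrow> (real, 'n) vec))"
proof
  show "finite (box_walls :: ((real, 'n) vec \<times> real) set)" by (simp add: box_walls_def)
  have "(box_set :: (real, 'n) vec set) \<subseteq> cbox 0 (\<chi> i. pi / axis_scale i)"
    by (auto simp: box_set_eq cbox_def Basis_vec_def inner_axis)
  then show "bounded (closed_polytope box_walls :: (real, 'n) vec set)"
    unfolding closed_polytope_box by (rule bounded_subset[OF bounded_cbox])
  have "(\<chi> i. pi / axis_scale i / 2) \<in> (open_polytope box_walls :: (real, 'n) vec set)"
    by (auto simp: open_polytope_def box_walls_def inner_axis' ball_Un field_simps)
  then show "(open_polytope box_walls :: (real, 'n) vec set) \<noteq> {}" by blast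
  show "fst h \<noteq> 0" if "h \<in> box_walls" for h :: "(real, 'n) vec \<times> real"
    using that by (auto simp: box_walls_def axis_eq_0_iff)
  show "finite (sign_flips :: ((real, 'n) vec \<Rightarrow> (real, 'n) vec) set)" by (rule finite_sign_flips)
  have id: "id = (sign_flip (\<lambda>_. False) :: (real, 'n) vec \<Rightarrow> (real, 'n) vec)" by (auto simp: sign_flip_def)
  show "(id :: (real, 'n) vec \<Rightarrow> (real, 'n) vec) \<in> sign_flips"
    unfolding id sign_flips_def by (rule rangeI)
  show "g \<circ> g' \<in> sign_flips" if "g \<in> sign_flips" "g' \<in> sign_flips" for g g' :: "(real, 'n) vec \<Rightarrow> (real, 'n) vec"
  proof -
    have "sign_flip s \<circ> sign_flip t = sign_flip (\<lambda>i. s i \<noteq> t i)" for s t :: "'n \<Rightarrow> bool"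
      by (auto simp: sign_flip_def fun_eq_iff vec_eq_iff)
    then show ?thesis using that by (auto simp: sign_flips_def)
  qed
  show "orthogonal_transformation g" if "g \<in> sign_flips" for g :: "(real, 'n) vec \<Rightarrow> (real, 'n) vec"
    using that by (auto simp: sign_flips_def orthogonal_transformation_def linear_sign_flip sign_flip_inner)
  show "(\<lambda>w. w - (2 * (w \<bullet> fst h) / (fst h \<bullet> fst h)) *\<^sub>R fst h) \<in> sign_flips"
    if h: "h \<in> box_walls" for h :: "(real, 'n) vec \<times> real"
  proof -
    \<comment> \<open>The two opposite walls of an axis have the same linear reflection, so only the
      axis matters.\<close>
    obtain i c where h': "fst h = axis i c" "c = 1 \<or> c = -1" using h by (auto simp: box_walls_def)
    have nth: "axis i c $ k = (if k = i then c else 0)" for k by (simp add: axis_def)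
    have "(\<lambda>w. w - (2 * (w \<bullet> fst h) / (fst h \<bullet> fst h)) *\<^sub>R fst h) = sign_flip (\<lambda>k. k = i)"
      unfolding h'(1) using h'(2) by (auto simp: fun_eq_iff vec_eq_iff sign_flip_def inner_axis nth)
    then show ?thesis unfolding sign_flips_def by simp
  qed
  have zero: "0 = (lattice_vec (\<lambda>_. 0) :: (real, 'n) vec)" by (simp add: lattice_vec_def vec_eq_iff)
  show "0 \<in> range (lattice_vec :: ('n \<Rightarrow> int) \<Rightarrow> (real, 'n) vec)" unfolding zero by (rule rangeI)
  have "lattice_vec m + lattice_vec m' = lattice_vec (\<lambda>i. m i + m' i)"
    "lattice_vec m - lattice_vec m' = lattice_vec (\<lambda>i. m i - m' i)" for m m' :: "'n \<Rightarrow> int"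
    by (auto simp: lattice_vec_def vec_eq_iff algebra_simps)
  then show "u + v \<in> range lattice_vec" "u - v \<in> range lattice_vec"
    if "u \<in> range lattice_vec" "v \<in> range lattice_vec" for u v :: "(real, 'n) vec"
    using that by auto
  show "g v \<in> range lattice_vec" if "g \<in> sign_flips" "v \<in> range lattice_vec" for g and v :: "(real, 'n) vec"
    using that by (auto simp: sign_flips_def sign_flip_lattice_vec)
  show "finite {v \<in> range (lattice_vec :: ('n \<Rightarrow> int) \<Rightarrow> (real, 'n) vec). v \<bullet> v \<le> r}" for r
    by (rule box_discrete)
  show "\<exists>k. (v \<bullet> fst h) * snd h / (fst h \<bullet> fst h) = pi * of_int k"
    if "v \<in> range lattice_vec" and h: "h \<in> box_walls" for v and h :: "(real, 'n) vec \<times> real"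
  proof -
    from that(1) obtain m where m: "v = lattice_vec m" by blast
    from h consider i where "h = (axis i 1, 0)" | i where "h = (axis i (-1), pi / axis_scale i)"
      by (auto simp: box_walls_def)
    then show ?thesis
    proof cases
      case 1
      then show ?thesis by (intro exI[of _ 0]) simp
    next
      case 2
      have "axis_scale i \<noteq> 0" using axis_scale_pos[of i] by simp
      then show ?thesis using 2
        by (intro exI[of _ "- m i"]) (simp add: m lattice_vec_def inner_axis)
    qed
  qed
  show "\<exists>v\<in>range lattice_vec. wave sign_flips v x \<noteq> wave sign_flips v y"
    if x: "x \<in> closed_polytope box_walls" and y: "y \<in> closed_polytope box_walls" and "x \<noteq> y" for x y :: "(real, 'n) vec"
  proof -
    obtain i where i: "x $ i \<noteq> y $ i" using \<open>x \<noteq> y\<close> by (auto simp: vec_eq_iff)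
    have range: "0 \<le> axis_scale i * z $ i" "axis_scale i * z $ i \<le> pi" if "z \<in> box_set" for z :: "(real, 'n) vec"
      using that by (auto simp: box_set_eq pos_le_divide_eq mult.commute less_imp_le intro!: mult_nonneg_nonneg)
    have "cos (axis_scale i * x $ i) \<noteq> cos (axis_scale i * y $ i)"
    proof
      assume "cos (axis_scale i * x $ i) = cos (axis_scale i * y $ i)"
      then have "axis_scale i * x $ i = axis_scale i * y $ i"
        by (rule cos_inj_pi[OF range[OF x[unfolded closed_polytope_box]] range[OF y[unfolded closed_polytope_box]]])
      then show False using i axis_scale_pos[of i] by simp
    qed
    moreover have "sign_flips \<noteq> ({} :: ((real, 'n) vec \<Rightarrow> (real, 'n) vec) set)" by (simp add: sign_flips_def)
    ultimately have "wave sign_flips (lattice_vec (\<lambda>k. if k = i then 1 else 0)) x \<noteq>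
        wave sign_flips (lattice_vec (\<lambda>k. if k = i then 1 else 0)) y"
      unfolding wave_axis using finite_sign_flips by (simp add: card_gt_0_iff)
    then show ?thesis by blast
  qed
qed

section \<open>The fold of the box and the parity of its waves\<close>

lemma half_box: "half_set box = (box_set \<inter> {x. x $ first \<le> pi / 2} :: (real, 'n::{finite,linorder}) vec set)"
  by (auto simp: box_def first_def)

lemma mid_box: "mid_set box = (box_set \<inter> {x. x $ first = pi / 2} :: (real, 'n::{finite,linorder}) vec set)"
  by (auto simp: box_def first_def)

lemma reflection_box:
  "reflection box x = (\<chi> i. if i = first then pi - x $ i else x $ i :: (real, 'n::{finite,linorder}) vec)"
  by (simp add: box_def first_def)

lemma fold_box: "fold_map box x = (\<chi> i. box_gamma CARD('n) * x $ next_axis i :: (real, 'n::{finite,linorder}) vec)"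
  by (simp add: box_def next_axis_def)

lemma closed_box_set: "closed (box_set :: (real, 'n::{finite,linorder}) vec set)"
  using reflection_domain.compact_\<Omega>[OF reflection_domain_box]
  unfolding closed_polytope_box by (rule compact_imp_closed)

lemma box_half_fixed:
  fixes x :: "(real, 'n::{finite,linorder}) vec"
  assumes "x \<in> half_set box" "x \<in> closure (domain_set box - half_set box)"
  shows "reflection box x = x"
proof -
  have "closure (domain_set box - half_set box) \<subseteq> {x :: (real, 'n) vec. pi / 2 \<le> x $ first}"
    by (intro closure_minimal closed_Collect_le continuous_intros) (auto simp: half_box, auto simp: box_def)
  then have "x $ first = pi / 2" using assms by (auto simp: half_box)
  then show ?thesis by (simp add: reflection_box vec_eq_iff)
qed

lemma surj_fold_box: "surj (fold_map box :: (real, 'n::{finite,linorder}) vec \<Rightarrow> _)"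
  unfolding surj_def
proof
  fix y :: "(real, 'n) vec"
  have "box_gamma CARD('n) \<noteq> 0" using box_gamma_ge_1[of "CARD('n)"] by linarith
  then show "\<exists>x. y = fold_map box x"
    by (intro exI[of _ "\<chi> k. y $ prev_axis k / box_gamma CARD('n)"]) (simp add: fold_box vec_eq_iff prev_next)
qed

lemma fold_adjoint_box: "v \<bullet> fold_map box x = box_dual_fold v \<bullet> x"
  for v x :: "(real, 'n::{finite,linorder}) vec"
proof -
  have "v \<bullet> fold_map box x = (\<Sum>i\<in>UNIV. v $ i * (box_gamma CARD('n) * x $ next_axis i))"
    by (simp add: inner_vec_def fold_box)
  also have "\<dots> = (\<Sum>k\<in>UNIV. v $ prev_axis k * (box_gamma CARD('n) * x $ next_axis (prev_axis k)))"
    by (rule sum.reindex_bij_betw[OF bij_prev, symmetric])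
  also have "\<dots> = box_dual_fold v \<bullet> x"
    by (simp add: inner_vec_def box_dual_fold_def next_prev mult_ac)
  finally show ?thesis .
qed

lemma bij_box_dual_fold: "bij (box_dual_fold :: (real, 'n::{finite,linorder}) vec \<Rightarrow> _)"
proof (rule bij_betw_byWitness[of _ "\<lambda>v. \<chi> i. v $ next_axis i / box_gamma CARD('n)"])
  have "box_gamma CARD('n) \<noteq> 0" using box_gamma_ge_1[of "CARD('n)"] by linarith
  then show "\<forall>v\<in>UNIV. (\<chi> i. box_dual_fold v $ next_axis i / box_gamma CARD('n)) = (v :: (real, 'n) vec)"
    "\<forall>v\<in>UNIV. box_dual_fold (\<chi> i. v $ next_axis i / box_gamma CARD('n)) = (v :: (real, 'n) vec)"
    by (simp_all add: box_dual_fold_def vec_eq_iff prev_next next_prev)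
qed auto

lemma box_dual_fold_sign_flip:
  "box_dual_fold (sign_flip s v) = sign_flip (\<lambda>i. s (prev_axis i)) (box_dual_fold v)"
  by (simp add: box_dual_fold_def sign_flip_def vec_eq_iff)

lemma box_dual_fold_norm:
  "box_dual_fold v \<bullet> box_dual_fold v = (box_gamma CARD('n))\<^sup>2 * (v \<bullet> v)" for v :: "(real, 'n::{finite,linorder}) vec"
proof -
  have "box_dual_fold v \<bullet> box_dual_fold v = (\<Sum>k\<in>UNIV. (box_gamma CARD('n))\<^sup>2 * (v $ prev_axis k * v $ prev_axis k))"
    by (simp add: inner_vec_def box_dual_fold_def power2_eq_square mult_ac)
  also have "\<dots> = (\<Sum>i\<in>UNIV. (box_gamma CARD('n))\<^sup>2 * (v $ i * v $ i))"
    by (rule sum.reindex_bij_betw[OF bij_prev])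
  finally show ?thesis by (simp add: inner_vec_def sum_distrib_left)
qed

lemma cos_add_pi_of_int: "cos (t + pi * of_int k) = (if even k then cos t else - cos t)"
  by (simp add: cos_add)

text \<open>On phases the reflection acts as the sign flip of the first component plus
  \<open>pi\<close> times that component, an integer with the parity of \<open>m first\<close> for
  every sign pattern. The flip is absorbed by reindexing the group sum.\<close>

lemma box_reflection_parity:
  fixes x :: "(real, 'n::{finite,linorder}) vec"
  assumes "v \<in> range lattice_vec"
  shows "wave sign_flips v (reflection box x) =
    (if odd_lattice_vec v then - wave sign_flips v x else wave sign_flips v x)"
proof -
  interpret reflection_domain box_walls sign_flips "range (lattice_vec :: _ \<Rightarrow> (real, 'n) vec)"
    by (rule reflection_domain_box)
  obtain m where m: "v = lattice_vec m" using assms by blast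
  define \<rho> :: "(real, 'n) vec \<Rightarrow> (real, 'n) vec" where "\<rho> = sign_flip (\<lambda>k. k = first)"
  have \<rho>: "\<rho> \<in> sign_flips" by (simp add: \<rho>_def sign_flips_def)
  have "w \<bullet> reflection box x = \<rho> w \<bullet> x + pi * w $ first" for w
  proof -
    have "w \<bullet> reflection box x = (\<Sum>i\<in>UNIV. \<rho> w $ i * x $ i + (if i = first then pi * w $ first else 0))"
      unfolding inner_vec_def
      by (rule sum.cong) (auto simp: reflection_box \<rho>_def sign_flip_def algebra_simps)
    then show ?thesis by (simp add: sum.distrib inner_vec_def)
  qed
  moreover have "\<exists>k. g v $ first = of_int k \<and> (odd k \<longleftrightarrow> odd (m first))" if "g \<in> sign_flips" for g
  proof -
    obtain s where s: "g = sign_flip s" using \<open>g \<in> sign_flips\<close> by (auto simp: sign_flips_def)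
    have "g v $ first = of_int (if s first then - m first else m first)"
      by (simp add: s m sign_flip_lattice_vec) (simp add: lattice_vec_def axis_scale_first)
    then show ?thesis by (metis even_minus)
  qed
  ultimately have "cos (g v \<bullet> reflection box x) =
      (if odd (m first) then - 1 else 1) * cos ((\<rho> \<circ> g) v \<bullet> x)" if "g \<in> sign_flips" for g
    using that by (fastforce simp: cos_add_pi_of_int)
  then have "wave sign_flips v (reflection box x) =
      (\<Sum>g\<in>sign_flips. (if odd (m first) then - 1 else 1) * cos ((\<rho> \<circ> g) v \<bullet> x))"
    unfolding wave_def by (rule sum.cong[OF refl])
  also have "\<dots> = (if odd (m first) then - 1 else 1) * wave sign_flips v x"
    unfolding wave_def sum_distrib_left by (rule sum_G_reindex[OF \<rho>])
  finally show ?thesis by (simp add: m odd_lattice_vec_iff)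
qed

text \<open>The difference of the squared norms is an integer polynomial in the ratio, with the
  difference of the squared first components as constant coefficient; the Eisenstein argument makes
  it even.\<close>

lemma box_parity_norm:
  fixes u v :: "(real, 'n::{finite,linorder}) vec"
  assumes "u \<in> range lattice_vec" "v \<in> range lattice_vec" "u \<bullet> u = v \<bullet> v"
  shows "odd_lattice_vec u \<longleftrightarrow> odd_lattice_vec v"
proof -
  obtain m m' where m: "u = lattice_vec m" "v = lattice_vec m'" using assms by blast
  \<comment> \<open>The exponents \<open>2 * (position i - 1)\<close> can reach the dimension and
    beyond, so these powers may be rationally dependent; only the constant coefficient is
    used.\<close>
  define p where "p = (\<Sum>i\<in>UNIV. monom ((m i)\<^sup>2 - (m' i)\<^sup>2) (2 * (position i - 1)))"
  have "int_poly_eval p (box_gamma CARD('n)) =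
      (\<Sum>i\<in>UNIV. (axis_scale i * of_int (m i))\<^sup>2 - (axis_scale i * of_int (m' i))\<^sup>2)"
    unfolding p_def int_poly_eval_sum int_poly_eval_monom axis_scale_def power_even_eq power_mult_distrib
    by (intro sum.cong) (auto simp: algebra_simps)
  also have "\<dots> = 0" using assms(3) by (simp add: m lattice_vec_norm sum_subtractf)
  finally have "even (coeff p 0)"
    by (intro even_constant_coeff_of_root[of "box_gamma CARD('n)" "CARD('n)"]) (simp_all add: box_gamma_power)
  moreover have "coeff p 0 = (\<Sum>i\<in>(UNIV :: 'n set). if i = first then (m first)\<^sup>2 - (m' first)\<^sup>2 else 0)"
    unfolding p_def coeff_sum
  proof (rule sum.cong[OF refl])
    fix i :: 'n
    have "position i - 1 = 0 \<longleftrightarrow> i = first" using position_le(1)[of i] position_eq_1_iff[of i] by linarith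
    then show "coeff (monom ((m i)\<^sup>2 - (m' i)\<^sup>2) (2 * (position i - 1))) 0 =
        (if i = first then (m first)\<^sup>2 - (m' first)\<^sup>2 else 0)"
      by (auto simp: coeff_monom)
  qed
  ultimately show ?thesis by (simp add: m odd_lattice_vec_iff)
qed

lemma box_even_iff:
  fixes v :: "(real, 'n::{finite,linorder}) vec"
  assumes "v \<in> range lattice_vec"
  shows "\<not> odd_lattice_vec v \<longleftrightarrow> v \<in> box_dual_fold ` range lattice_vec"
proof -
  obtain m where m: "v = lattice_vec m" using assms by blast
  show ?thesis
  proof
    assume "\<not> odd_lattice_vec v"
    then obtain k where k: "m first = 2 * k" by (auto simp: m odd_lattice_vec_iff)
    \<comment> \<open>The inverse shift, with the first component halved at the wrap-around.\<close>
    have "v = box_dual_fold (lattice_vec (\<lambda>i. if next_axis i = first then k else m (next_axis i)))"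
      unfolding m box_dual_fold_lattice_vec lattice_vec_inject by (auto simp: fun_eq_iff next_prev k)
    then show "v \<in> box_dual_fold ` range lattice_vec" by blast
  next
    assume "v \<in> box_dual_fold ` range lattice_vec"
    then show "\<not> odd_lattice_vec v"
      by (auto simp: box_dual_fold_lattice_vec odd_lattice_vec_iff)
  qed
qed

lemma box_odd_spectrum:
  "odd_spectrum (box :: (real, 'n::{finite,linorder}) vec folding_domain) =
    {v \<bullet> v | v :: (real, 'n) vec. v \<in> range lattice_vec \<and> odd_lattice_vec v}"
proof -
  have sum: "(\<Sum>j = 1..CARD('n). (box_gamma CARD('n) ^ (j - 1) * f j)\<^sup>2) =
      (\<Sum>i\<in>UNIV. (axis_scale (i :: 'n) * f (position i))\<^sup>2)" for f
    unfolding axis_scale_def by (rule sum.reindex_bij_betw[OF bij_betw_position, symmetric])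
  show ?thesis
  proof (intro equalityI subsetI)
    fix t assume "t \<in> odd_spectrum (box :: (real, 'n) vec folding_domain)"
    then obtain m :: "nat \<Rightarrow> nat"
      where m: "t = (\<Sum>j = 1..CARD('n). (box_gamma CARD('n) ^ (j - 1) * real (m j))\<^sup>2)" "odd (m 1)"
      by (auto simp: box_def)
    let ?v = "lattice_vec (\<lambda>i. int (m (position i))) :: (real, 'n) vec"
    have "t = ?v \<bullet> ?v" unfolding m(1) sum lattice_vec_norm by simp
    moreover have "odd_lattice_vec ?v" using m(2) by (simp add: odd_lattice_vec_iff position_first)
    ultimately show "t \<in> {v \<bullet> v | v :: (real, 'n) vec. v \<in> range lattice_vec \<and> odd_lattice_vec v}" by blast
  next
    fix t assume "t \<in> {v \<bullet> v | v :: (real, 'n) vec. v \<in> range lattice_vec \<and> odd_lattice_vec v}"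
    then obtain m where m: "t = lattice_vec m \<bullet> (lattice_vec m :: (real, 'n) vec)" "odd (m first)"
      by (auto simp: odd_lattice_vec_iff)
    define m' where "m' j = nat \<bar>m (axis_of j)\<bar>" for j
    have "t = (\<Sum>i\<in>UNIV. (axis_scale i * real (m' (position (i :: 'n))))\<^sup>2)"
      unfolding m(1) lattice_vec_norm by (simp add: m'_def axis_of_position power_mult_distrib)
    then have "t = (\<Sum>j = 1..CARD('n). (box_gamma CARD('n) ^ (j - 1) * real (m' j))\<^sup>2)"
      unfolding sum .
    moreover have "odd (m' 1)" using m(2) by (simp add: m'_def first_def even_nat_iff)
    ultimately show "t \<in> odd_spectrum (box :: (real, 'n) vec folding_domain)"
      unfolding box_def by auto
  qed
qed

lemma folding_reflection_domain_box:
  "folding_reflection_domain box_walls sign_flips (range (lattice_vec :: ('n::{finite,linorder} \<Rightarrow> int) \<Rightarrow> (real, 'n) vec))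
    box box_dual_fold odd_lattice_vec"
proof (rule folding_reflection_domain.intro[OF reflection_domain_box], rule folding_reflection_domain_axioms.intro)
  show "domain_set box = (closed_polytope box_walls :: (real, 'n) vec set)"
    by (simp add: box_def closed_polytope_box)
  show "closed (half_set box :: (real, 'n) vec set)"
    unfolding half_box using closed_box_set by (intro closed_Int closed_Collect_le continuous_intros)
  show "closed (mid_set box :: (real, 'n) vec set)"
    unfolding mid_box using closed_box_set by (intro closed_Int closed_Collect_eq continuous_intros)
  show "reflection box x = x" if "x \<in> mid_set box" for x :: "(real, 'n) vec"
    using that by (simp add: mid_box reflection_box vec_eq_iff)
  show "continuous_on UNIV (fold_map box :: (real, 'n) vec \<Rightarrow> _)"
    unfolding fold_box[abs_def] by (intro continuous_intros)
  have "continuous_on UNIV (\<lambda>x :: (real, 'n) vec. if i = first then pi - x $ i else x $ i)" for i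
    by (cases "i = first") (auto intro!: continuous_intros)
  then show "continuous_on UNIV (reflection box :: (real, 'n) vec \<Rightarrow> _)"
    unfolding reflection_box[abs_def] by (intro continuous_intros)
  show "box_dual_fold v \<in> range lattice_vec" if "v \<in> range lattice_vec" for v :: "(real, 'n) vec"
    using that by (auto simp: box_dual_fold_lattice_vec)
  show "\<exists>g'\<in>sign_flips. \<forall>v. box_dual_fold (g v) = g' (box_dual_fold v)"
    if "g \<in> sign_flips" for g :: "(real, 'n) vec \<Rightarrow> (real, 'n) vec"
    using that by (auto simp: sign_flips_def box_dual_fold_sign_flip)
  show "box_dual_fold v \<bullet> box_dual_fold v = (ratio (box :: (real, 'n) vec folding_domain))\<^sup>2 * (v \<bullet> v)"
    for v :: "(real, 'n) vec"
    by (simp add: box_dual_fold_norm) (simp add: box_def)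
  have "0 < box_gamma CARD('n)" using box_gamma_ge_1[of "CARD('n)"] by linarith
  then show "0 < ratio (box :: (real, 'n) vec folding_domain)" by (simp add: box_def)
qed (fact box_half_fixed surj_fold_box fold_adjoint_box bij_box_dual_fold box_reflection_parity
    box_parity_norm box_even_iff box_odd_spectrum)+

theorem lemmaB1:
  shows
    "(let D = triangle in
        \<forall>\<mu>\<^sub>0 \<in> odd_spectrum D. \<forall>k :: nat.
          neumann_eigenvalue (domain_set D) (ratio D ^ (2 * k) * \<mu>\<^sub>0) \<and>
          nodal_deficiency (domain_set D) (ratio D ^ (2 * k) * \<mu>\<^sub>0)
            \<ge> (ereal (real (multiplicity_of (domain_set D) \<mu>\<^sub>0)) - 1) *
               (ereal_of_enat (num_subdomains D k) - 1))
     \<and> (CARD('n) \<ge> 2 \<longrightarrow>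
        (let D = (box :: (real ^ 'n::{finite,linorder}) folding_domain) in
        \<forall>\<mu>\<^sub>0 \<in> odd_spectrum D. \<forall>k :: nat.
          neumann_eigenvalue (domain_set D) (ratio D ^ (2 * k) * \<mu>\<^sub>0) \<and>
          nodal_deficiency (domain_set D) (ratio D ^ (2 * k) * \<mu>\<^sub>0)
            \<ge> (ereal (real (multiplicity_of (domain_set D) \<mu>\<^sub>0)) - 1) *
               (ereal_of_enat (num_subdomains D k) - 1)))"
  unfolding Let_def
  using triangle.nodal_deficiency_bound
    folding_reflection_domain.nodal_deficiency_bound[OF folding_reflection_domain_box]
  by blast

end
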